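(* Let $N=pq$ be a semiprime number with unknown prime factors $p$ and $q$, and let $v_p:=\nu_2(p-1)$, $v_q:=\nu_2(q-1)$. There exists a probabilistic polynomial-time reduction from computing $v_p$ and $v_q$ (given only $N$) to $CRS(k)$ for $k=1,2,\dots,\max\{v_p,v_q\}+1$; i.e. there is a randomized algorithm which, given $N$ and oracle access to procedures solving $CRS(k)$ for these $k$, computes $v_p$ and $v_q$ in time polynomial in $\log N$ with error probability that can be made arbitrarily small. Moreover, if the Extended Riemann Hypothesis holds, there exists such a reduction that is deterministic.
   Context: $\nu_2(n):=\max\{k\in\mathbb{N}_0: 2^k\mid n\}$ is the $2$-adic valuation. For $k\in\mathbb{N}_0$, a prime $p$ and $a\in\mathbb{Z}$ with $p\nmid a$, the rational $2^k$-th power residue symbol is $\left(\frac{a}{p}\right)_{2^k}=1$ if there is $x\in\mathbb{Z}$ with $x^{2^k}\equiv a \pmod p$, and $-1$ otherwise. For $n=p_1\cdots p_l$ a product of not necessarily distinct primes with $\gcd(n,a)=1$, set $\left(\frac{a}{n}\right)_{2^k}=\prod_{i=1}^l\left(\frac{a}{p_i}\right)_{2^k}$. For fixed $k\in\mathbb{N}$, the problem $CRS(k)$ is: given coprime $n,m\in\mathbb{N}$ such that $\left(\frac{m}{p}\right)_{2^{k-1}}=1$ for every prime factor $p$ of $n$, compute $\left(\frac{m}{n}\right)_{2^k}$. A (polynomial-time) reduction to $CRS(k)$ is a polynomial-time algorithm solving the problem using calls to an oracle for $CRS(k)$, each call counted as one step. *)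

theory Defs
  imports
    "HOL-Number_Theory.Cong"
    "HOL-Library.Log_Nat"
    "HOL-Probability.Probability"
    "HOL-Complex_Analysis.Complex_Analysis"
begin

section \<open>Rational power residue symbols and the problem CRS\<close>

abbreviation nu2 :: "nat \<Rightarrow> nat" where
  "nu2 n \<equiv> multiplicity 2 n"

definition prime_residue_symbol :: "nat \<Rightarrow> int \<Rightarrow> nat \<Rightarrow> int" where
  "prime_residue_symbol k a p = (if \<exists>x::int. [x ^ (2 ^ k) = a] (mod int p) then 1 else - 1)"

definition residue_symbol :: "nat \<Rightarrow> int \<Rightarrow> nat \<Rightarrow> int" where
  "residue_symbol k a n = (\<Prod>p\<in>#prime_factorization n. prime_residue_symbol k a p)"

definition CRS_instance :: "nat \<Rightarrow> nat \<Rightarrow> nat \<Rightarrow> bool" where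
  "CRS_instance k n m \<longleftrightarrow>
     k \<ge> 1 \<and> n > 0 \<and> m > 0 \<and> coprime n m \<and>
     (\<forall>p\<in>prime_factors n. prime_residue_symbol (k - 1) (int m) p = 1)"

text \<open>An oracle takes \<open>k\<close>, \<open>n\<close>, \<open>m\<close>. Being a solver for CRS(\<open>k\<close>) constrains its answers only on
  instances of CRS(\<open>k\<close>); everywhere else they are arbitrary.\<close>

type_synonym crs_oracle = "nat \<Rightarrow> nat \<Rightarrow> nat \<Rightarrow> int"

definition solves_CRS :: "crs_oracle \<Rightarrow> nat \<Rightarrow> bool" where
  "solves_CRS Or k \<longleftrightarrow>
     (\<forall>n m. CRS_instance k n m \<longrightarrow> Or k n m = residue_symbol k (int m) n)"


section \<open>Randomised oracle programs with logarithmic cost\<close>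

text \<open>The machine model is a register machine with structured control flow and integer registers.
  Time is measured by the logarithmic cost criterion: evaluating an expression costs the
  total bit size of all its intermediate values, so running times agree with those of (oracle,
  coin-tossing) Turing machines up to a polynomial. A coin toss and an oracle call cost one step.\<close>

type_synonym state = "nat \<Rightarrow> int"

datatype aexp =
    Const int
  | Reg nat
  | Add aexp aexp
  | Sub aexp aexp
  | Mul aexp aexp
  | Div aexp aexp
  | Mod aexp aexp

datatype bexp =
    Less aexp aexp
  | Eq aexp aexp
  | Neg bexp
  | Conj bexp bexp

datatype com =
    Skip
  | Assign nat aexp
  | Seq com com
  | If bexp com com
  | While bexp com
  | Flip nat
  | Query nat nat nat nat

fun aval :: "aexp \<Rightarrow> state \<Rightarrow> int" where
  "aval (Const i) s = i"
| "aval (Reg x) s = s x"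
| "aval (Add a b) s = aval a s + aval b s"
| "aval (Sub a b) s = aval a s - aval b s"
| "aval (Mul a b) s = aval a s * aval b s"
| "aval (Div a b) s = aval a s div aval b s"
| "aval (Mod a b) s = aval a s mod aval b s"

fun bval :: "bexp \<Rightarrow> state \<Rightarrow> bool" where
  "bval (Less a b) s \<longleftrightarrow> aval a s < aval b s"
| "bval (Eq a b) s \<longleftrightarrow> aval a s = aval b s"
| "bval (Neg b) s \<longleftrightarrow> \<not> bval b s"
| "bval (Conj b c) s \<longleftrightarrow> bval b s \<and> bval c s"

definition bit_size :: "int \<Rightarrow> nat" where
  "bit_size i = Suc (nat (bitlen \<bar>i\<bar>))"

fun acost :: "aexp \<Rightarrow> state \<Rightarrow> nat" where
  "acost (Const i) s = bit_size i"
| "acost (Reg x) s = bit_size (s x)"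
| "acost (Add a b) s = acost a s + acost b s + bit_size (aval (Add a b) s)"
| "acost (Sub a b) s = acost a s + acost b s + bit_size (aval (Sub a b) s)"
| "acost (Mul a b) s = acost a s + acost b s + bit_size (aval (Mul a b) s)"
| "acost (Div a b) s = acost a s + acost b s + bit_size (aval (Div a b) s)"
| "acost (Mod a b) s = acost a s + acost b s + bit_size (aval (Mod a b) s)"

fun bcost :: "bexp \<Rightarrow> state \<Rightarrow> nat" where
  "bcost (Less a b) s = acost a s + acost b s + 1"
| "bcost (Eq a b) s = acost a s + acost b s + 1"
| "bcost (Neg b) s = bcost b s + 1"
| "bcost (Conj b c) s = bcost b s + bcost c s + 1"

text \<open>\<open>exec Or c s w T s' w'\<close>: started in state \<open>s\<close> with the infinite sequence \<open>w\<close> of coin tosses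
  still to come, \<open>c\<close> halts after time \<open>T\<close> in state \<open>s'\<close>, leaving the tosses \<open>w'\<close> unused.
  \<open>Query x k n m\<close> reads the query from registers \<open>k\<close>, \<open>n\<close>, \<open>m\<close> and puts the answer in
  register \<open>x\<close>.\<close>

inductive exec ::
  "crs_oracle \<Rightarrow> com \<Rightarrow> state \<Rightarrow> bool stream \<Rightarrow> nat \<Rightarrow> state \<Rightarrow> bool stream \<Rightarrow> bool"
  for Or :: crs_oracle where
  Skip: "exec Or Skip s w 1 s w"
| Assign: "exec Or (Assign x a) s w (acost a s + 1) (s(x := aval a s)) w"
| Seq: "exec Or c1 s w T1 s1 w1 \<Longrightarrow> exec Or c2 s1 w1 T2 s2 w2 \<Longrightarrow>
        exec Or (Seq c1 c2) s w (T1 + T2) s2 w2"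
| IfTrue: "bval b s \<Longrightarrow> exec Or c1 s w T s' w' \<Longrightarrow>
        exec Or (If b c1 c2) s w (bcost b s + T) s' w'"
| IfFalse: "\<not> bval b s \<Longrightarrow> exec Or c2 s w T s' w' \<Longrightarrow>
        exec Or (If b c1 c2) s w (bcost b s + T) s' w'"
| WhileFalse: "\<not> bval b s \<Longrightarrow> exec Or (While b c) s w (bcost b s) s w"
| WhileTrue: "bval b s \<Longrightarrow> exec Or c s w T1 s1 w1 \<Longrightarrow> exec Or (While b c) s1 w1 T2 s2 w2 \<Longrightarrow>
        exec Or (While b c) s w (bcost b s + T1 + T2) s2 w2"
| Flip: "exec Or (Flip x) s w 1 (s(x := (if shd w then 1 else 0))) (stl w)"
| Query: "exec Or (Query x k n m) s w 1
        (s(x := Or (nat (s k)) (nat (s n)) (nat (s m)))) w"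

inductive_cases SkipE: "exec Or Skip s w T s' w'"
inductive_cases AssignE: "exec Or (Assign x a) s w T s' w'"
inductive_cases SeqE: "exec Or (Seq c1 c2) s w T s' w'"
inductive_cases IfE: "exec Or (If b c1 c2) s w T s' w'"
inductive_cases WhileE: "exec Or (While b c) s w T s' w'"
inductive_cases FlipE: "exec Or (Flip x) s w T s' w'"
inductive_cases QueryE: "exec Or (Query x k n m) s w T s' w'"

lemma exec_deterministic:
  assumes "exec Or c s w T s1 w1" and "exec Or c s w T' s2 w2"
  shows "T = T' \<and> s1 = s2 \<and> w1 = w2"
  using assms
proof (induction arbitrary: T' s2 w2 rule: exec.induct)
  case (Skip s w)
  then show ?case by (rule SkipE) simp
next
  case (Assign x a s w)
  then show ?case by (rule AssignE) simp
next
  case (Seq c1 s w T1 s1 w1 c2 T2 s2' w2')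
  from Seq.prems show ?case by (rule SeqE) (use Seq.IH in blast)
next
  case (IfTrue b s c1 w T s' w' c2)
  from IfTrue.prems show ?case by (rule IfE) (use IfTrue.IH IfTrue.hyps in blast)+
next
  case (IfFalse b s c2 w T s' w' c1)
  from IfFalse.prems show ?case by (rule IfE) (use IfFalse.IH IfFalse.hyps in blast)+
next
  case (WhileFalse b s c w)
  from WhileFalse.prems show ?case by (rule WhileE) (use WhileFalse.hyps in simp_all)
next
  case (WhileTrue b s c w T1 s1 w1 T2 s2' w2')
  from WhileTrue.prems show ?case by (rule WhileE) (use WhileTrue.IH WhileTrue.hyps in blast)+
next
  case (Flip x s w)
  then show ?case by (rule FlipE) simp
next
  case (Query x k n m s w)
  then show ?case by (rule QueryE) simp
qed

fun coin_free :: "com \<Rightarrow> bool" where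
  "coin_free (Seq c1 c2) \<longleftrightarrow> coin_free c1 \<and> coin_free c2"
| "coin_free (If b c1 c2) \<longleftrightarrow> coin_free c1 \<and> coin_free c2"
| "coin_free (While b c) \<longleftrightarrow> coin_free c"
| "coin_free (Flip x) \<longleftrightarrow> False"
| "coin_free _ \<longleftrightarrow> True"

definition fair_coins :: "bool stream measure" where
  "fair_coins = stream_space (measure_pmf (bernoulli_pmf (1 / 2)))"

definition input_state :: "nat list \<Rightarrow> state" where
  "input_state xs = (\<lambda>i. if i < length xs then int (xs ! i) else 0)"

definition halts_within :: "crs_oracle \<Rightarrow> com \<Rightarrow> nat list \<Rightarrow> bool stream \<Rightarrow> nat \<Rightarrow> bool" where
  "halts_within Or c xs w B \<longleftrightarrow> (\<exists>T s' w'. exec Or c (input_state xs) w T s' w' \<and> T \<le> B)"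

text \<open>The two results are delivered in registers 0 and 1, in either order: the input
  \<open>p * q\<close> does not determine which prime factor is called \<open>p\<close>.\<close>

definition outputs_pair ::
  "crs_oracle \<Rightarrow> com \<Rightarrow> nat list \<Rightarrow> bool stream \<Rightarrow> nat \<Rightarrow> nat \<Rightarrow> bool" where
  "outputs_pair Or c xs w a b \<longleftrightarrow>
     (\<exists>T s' w'. exec Or c (input_state xs) w T s' w' \<and>
        (s' 0 = int a \<and> s' 1 = int b \<or> s' 0 = int b \<and> s' 1 = int a))"


section \<open>The Extended Riemann Hypothesis\<close>

definition dirichlet_character :: "nat \<Rightarrow> (nat \<Rightarrow> complex) \<Rightarrow> bool" where
  "dirichlet_character q X \<longleftrightarrow>
     q > 0 \<and> (\<forall>a b. X (a * b) = X a * X b) \<and> (\<forall>a. X (a + q) = X a) \<and>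
     (\<forall>a. X a \<noteq> 0 \<longleftrightarrow> coprime a q)"

text \<open>\<open>f\<close> is the analytic continuation of the Dirichlet series of \<open>X\<close> to the right half-plane
  without the point 1. It exists for every Dirichlet character and is unique on this connected
  domain; 1 is left out because of the pole for principal characters.\<close>

definition is_L_function :: "(nat \<Rightarrow> complex) \<Rightarrow> (complex \<Rightarrow> complex) \<Rightarrow> bool" where
  "is_L_function X f \<longleftrightarrow>
     f holomorphic_on ({s. Re s > 0} - {1}) \<and>
     (\<forall>s. Re s > 1 \<longrightarrow> (\<lambda>n. X (Suc n) / of_nat (Suc n) powr s) sums f s)"

definition extended_riemann_hypothesis :: bool where
  "extended_riemann_hypothesis \<longleftrightarrow>
     (\<forall>q X f s. dirichlet_character q X \<and> is_L_function X f \<and>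
        0 < Re s \<and> Re s < 1 \<and> f s = 0 \<longrightarrow> Re s = 1 / 2)"

end

theory Submission
  imports Defs "HOL-Number_Theory.Number_Theory"
begin

text \<open>
  For \<open>a\<close> prime to \<open>N = p q\<close> the number \<open>a\<^bsup>2^(k-1)\<^esup>\<close> is a legal query for CRS(\<open>k\<close>), and its symbol modulo \<open>p\<close> is
  \<open>(a/p)\<close> if \<open>k \<le> v\<^sub>p\<close> and 1 otherwise. So if the Jacobi symbol of \<open>a\<close> is \<open>-1\<close>, the first level at which
  the oracle answers 1 is \<open>v\<^sub>p + 1\<close> or \<open>v\<^sub>q + 1\<close>, depending on which of \<open>(a/p)\<close>, \<open>(a/q)\<close> is \<open>-1\<close>; in
  particular the level never exceeds the permitted maximum. Both sign patterns have density at least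
  1/16 among random bit strings, and even \<open>N\<close> and squares are treated directly.

  For the deterministic version it suffices that under ERH every nonprincipal real character \<open>\<chi>\<close> modulo
  \<open>q\<close> takes the value \<open>-1\<close> at some \<open>n \<le> (log q)\<^bsup>O(1)\<^esup>\<close>. This needs no contour integration: compare Taylor
  coefficients at \<open>1 + \<eta>\<close> with \<open>\<eta>\<close> small and fixed. Since \<open>L(s, \<chi>)\<close> has no zeros with \<open>Re s > 1/2\<close> near
  1, except perhaps 1 itself, Borel-Caratheodory bounds the \<open>k\<close>-th coefficient of \<open>-L'/L\<close> by about \<open>4\<^bsup>k\<^esup> log q\<close>, while the pole of
  zeta makes that of \<open>-\<zeta>'/\<zeta>\<close> about \<open>\<eta>\<^bsup>-k\<^esup>\<close>. If \<open>\<chi> = 1\<close> on all small \<open>n\<close> prime to \<open>q\<close>, the two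
  coefficients nearly agree, which is absurd once \<open>k\<close> is of size \<open>log log q\<close>.
\<close>

section \<open>Dirichlet series\<close>

text \<open>The contradiction is a comparison of exponential rates in k. With \<eta> \<le> 1/32 the
  pole of zeta produces at least 32^(k+1). Borel-Caratheodory costs 4^(k+1), and the factor k + 1
  that comes from differentiating a logarithm is at most 2^k, so that bound is of order 8^k ln q;
  the n sharing a factor with q cost only 2^k ln q. Each error is therefore at least a factor 2^k
  below the main term, up to a constant times ln q + 1. A k with 2^k of that size suffices, and the
  cutoff (2^k)^(6/\<eta>) for n is then a fixed power of ln q.

  The ERH hypothesis speaks only about 0 < Re s < 1, whereas the logarithm of L is taken on a disc
  that crosses Re s = 1. The 3-4-1 inequality covers this line. For real characters it can be
  written with zeta in place of the square of the character, and it still permits a simple zero at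
  1.

  Each of the two sign patterns with Jacobi symbol -1 reveals one valuation. The least and the
  greatest nonzero value found therefore give the unordered pair, without deciding which value
  belongs to which prime.\<close>

definition dirichlet_sum :: "(nat \<Rightarrow> complex) \<Rightarrow> complex \<Rightarrow> complex" where
  "dirichlet_sum a s = (\<Sum>n. a n * of_nat n powr (- s))"

text \<open>Powers of the logarithm are allowed because each termwise differentiation multiplies the
  coefficients by ln n; the class contains 1 and the von Mangoldt function.\<close>

definition log_bounded :: "(nat \<Rightarrow> complex) \<Rightarrow> bool" where
  "log_bounded a \<longleftrightarrow> (\<exists>C k. \<forall>n\<ge>1. norm (a n) \<le> C * ln (real n) ^ k)"

text \<open>One term of the exponential series is at most the whole. The constant k! / \<epsilon>^k
  is kept explicit because k later grows with q; the k! cancels against the one in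
  \<open>mangoldt_coeff\<close>.\<close>

lemma power_le_fact_exp:
  fixes u \<epsilon> :: real
  assumes "u \<ge> 0" "\<epsilon> > 0"
  shows "u ^ k \<le> fact k / \<epsilon> ^ k * exp (\<epsilon> * u)"
proof -
  have "(\<epsilon> * u) ^ k /\<^sub>R fact k \<le> (\<Sum>n. (\<epsilon> * u) ^ n /\<^sub>R fact n)"
    using assms summable_exp_generic[of "\<epsilon> * u"]
    by (intro sum_le_suminf[of _ "{k}", simplified]) auto
  hence "(\<epsilon> * u) ^ k / fact k \<le> exp (\<epsilon> * u)"
    by (simp add: exp_def divide_inverse mult.commute)
  thus ?thesis
    using assms by (simp add: field_simps power_mult_distrib)
qed

lemma ln_power_le:
  fixes \<epsilon> :: real
  assumes "\<epsilon> > 0" "n \<ge> (1::nat)"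
  shows "ln (real n) ^ k \<le> fact k / \<epsilon> ^ k * real n powr \<epsilon>"
  using power_le_fact_exp[of "ln (real n)" \<epsilon> k] assms by (simp add: powr_def)

text \<open>Since \<open>0 powr s = 0\<close>, the index 0 contributes nothing to
  \<open>dirichlet_sum\<close>, whatever \<open>a 0\<close> is.\<close>

lemma norm_nat_powr: "norm (of_nat n powr s :: complex) = (if n = 0 then 0 else real n powr Re s)"
  using norm_powr_real_powr[of "of_nat n" s] by auto

lemma log_bounded_times_ln:
  assumes "log_bounded a"
  shows "log_bounded (\<lambda>n. a n * of_real (ln (real n)) ^ j)"
proof -
  obtain C k where C: "\<And>n. n \<ge> 1 \<Longrightarrow> norm (a n) \<le> C * ln (real n) ^ k"
    using assms by (auto simp: log_bounded_def)
  have "norm (a n * of_real (ln (real n)) ^ j) \<le> C * ln (real n) ^ (k + j)" if "n \<ge> 1" for n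
    using mult_right_mono[OF C[OF that], of "ln (real n) ^ j"] that
    by (simp add: norm_mult norm_power power_add mult.assoc)
  thus ?thesis unfolding log_bounded_def by blast
qed

lemma summable_log_bounded:
  assumes "log_bounded a" "\<sigma> > 1"
  shows "summable (\<lambda>n. norm (a n) * real n powr (- \<sigma>))"
proof -
  obtain C k where C: "\<And>n. n \<ge> 1 \<Longrightarrow> norm (a n) \<le> C * ln (real n) ^ k"
    using assms by (auto simp: log_bounded_def)
  define \<epsilon> where "\<epsilon> = (\<sigma> - 1) / 2"
  have \<epsilon>: "\<epsilon> > 0" using assms by (simp add: \<epsilon>_def)
  show ?thesis
  proof (rule summable_comparison_test'[where N = 1])
    show "summable (\<lambda>n. (\<bar>C\<bar> * (fact k / \<epsilon> ^ k)) * real n powr (\<epsilon> - \<sigma>))"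
      using assms by (intro summable_mult) (simp add: summable_real_powr_iff \<epsilon>_def field_simps)
    fix n :: nat assume n: "1 \<le> n"
    have "norm (a n) \<le> \<bar>C\<bar> * ln (real n) ^ k"
      using C[OF n] n by (smt (verit, best) ln_ge_zero mult_right_mono of_nat_1 of_nat_le_iff zero_le_power)
    also have "\<dots> \<le> \<bar>C\<bar> * (fact k / \<epsilon> ^ k * real n powr \<epsilon>)"
      using ln_power_le[OF \<epsilon> n, of k] by (intro mult_left_mono) auto
    finally have "norm (a n) * real n powr (-\<sigma>) \<le> \<bar>C\<bar> * (fact k / \<epsilon> ^ k * real n powr \<epsilon>) * real n powr (-\<sigma>)"
      by (intro mult_right_mono) auto
    also have "\<dots> = (\<bar>C\<bar> * (fact k / \<epsilon> ^ k)) * real n powr (\<epsilon> - \<sigma>)"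
      by (simp add: powr_diff powr_minus divide_inverse)
    finally show "norm (norm (a n) * real n powr (-\<sigma>)) \<le> \<dots>" by simp
  qed
qed

lemma summable_dirichlet:
  assumes "log_bounded a" "Re s > 1"
  shows "summable (\<lambda>n. norm (a n * of_nat n powr (- s)))"
  using summable_log_bounded[OF assms]
  by (rule summable_comparison_test'[where N = 1]) (auto simp: norm_mult norm_nat_powr)

lemma sums_dirichlet:
  assumes "log_bounded a" "Re s > 1"
  shows "(\<lambda>n. a n * of_nat n powr (- s)) sums dirichlet_sum a s"
  using summable_norm_cancel[OF summable_dirichlet[OF assms]]
  by (simp add: dirichlet_sum_def summable_sums)

lemma open_Re_gt: "open {s. Re s > x}"
  by (simp add: open_halfspace_Re_gt)

text \<open>On a ball of radius d = (Re x - 1)/2 the real part stays above 1 + d, which gives one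
  summable majorant for the whole ball and justifies termwise differentiation.\<close>

lemma dirichlet_sum_deriv:
  assumes "log_bounded a" "Re s > 1"
  shows "(dirichlet_sum a has_field_derivative
           - dirichlet_sum (\<lambda>n. a n * of_real (ln (real n))) s) (at s)"
proof -
  let ?S = "{s::complex. Re s > 1}"
  have "\<exists>g g'. \<forall>x \<in> ?S. ((\<lambda>n. a n * of_nat n powr (- x)) sums g x) \<and>
          ((\<lambda>n. - (a n * of_real (ln (real n)) * of_nat n powr (- x))) sums g' x) \<and>
          (g has_field_derivative g' x) (at x)"
  proof (rule series_and_derivative_comparison_complex[OF open_Re_gt])
    fix n :: nat and x :: complex assume "x \<in> ?S"
    show "((\<lambda>x. a n * of_nat n powr (- x)) has_field_derivative
            - (a n * of_real (ln (real n)) * of_nat n powr (- x))) (at x)"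
    proof (cases "n = 0")
      case False
      hence "ln (of_nat n :: complex) = of_real (ln (real n))"
        using Ln_of_real[of "real n"] by simp
      thus ?thesis using False
        by (auto simp: powr_def intro!: derivative_eq_intros)
    qed auto
  next
    fix x :: complex assume x: "x \<in> ?S"
    define d where "d = (Re x - 1) / 2"
    have d: "d > 0" using x by (simp add: d_def)
    define h where "h = (\<lambda>n. norm (a n) * real n powr (- (1 + d)))"
    have "summable h" unfolding h_def using d assms(1) by (intro summable_log_bounded) auto
    moreover have "norm (a n * of_nat n powr (- y)) \<le> h n" if "y \<in> ball x d" for n y
    proof -
      have "\<bar>Re x - Re y\<bar> < d"
        using that abs_Re_le_cmod[of "x - y"] by (simp add: dist_norm)
      hence "Re y \<ge> 1 + d" by (simp add: d_def abs_if field_simps split: if_splits)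
      thus ?thesis by (auto simp: h_def norm_mult norm_nat_powr intro!: mult_left_mono powr_mono)
    qed
    moreover have "h n \<ge> 0" for n by (simp add: h_def)
    ultimately show "\<exists>d h. 0 < d \<and> summable h \<and> range h \<subseteq> \<real>\<^sub>\<ge>\<^sub>0 \<and>
        (\<forall>\<^sub>F n in sequentially. \<forall>y\<in>ball x d \<inter> ?S. cmod (a n * of_nat n powr (- y)) \<le> cmod (h n))"
      using d by (intro exI[of _ d] exI[of _ "\<lambda>n. complex_of_real (h n)"])
        (auto simp: summable_of_real)
  qed
  then obtain g g' where g: "\<And>x. x \<in> ?S \<Longrightarrow> ((\<lambda>n. a n * of_nat n powr (- x)) sums g x)"
     "\<And>x. x \<in> ?S \<Longrightarrow> ((\<lambda>n. - (a n * of_real (ln (real n)) * of_nat n powr (- x))) sums g' x)"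
     "\<And>x. x \<in> ?S \<Longrightarrow> (g has_field_derivative g' x) (at x)" by blast
  have s: "s \<in> ?S" using assms by simp
  have "g' s = - dirichlet_sum (\<lambda>n. a n * of_real (ln (real n))) s"
    using sums_unique2[OF g(2)[OF s] sums_minus[OF sums_dirichlet]]
      log_bounded_times_ln[OF assms(1), of 1] assms(2) by simp
  moreover have "(dirichlet_sum a has_field_derivative g' s) (at s)"
    by (rule has_field_derivative_transform_within_open[OF g(3)[OF s] open_Re_gt s])
      (use g(1) in \<open>auto simp: dirichlet_sum_def sums_iff\<close>)
  ultimately show ?thesis by simp
qed

lemma dirichlet_sum_holomorphic:
  assumes "log_bounded a"
  shows "dirichlet_sum a holomorphic_on {s. Re s > 1}"
  using dirichlet_sum_deriv[OF assms] by (auto simp: holomorphic_on_open open_Re_gt)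

lemma dirichlet_sum_higher_deriv:
  assumes "log_bounded a" "Re s > 1"
  shows "(deriv ^^ k) (dirichlet_sum a) s =
           (-1) ^ k * dirichlet_sum (\<lambda>n. a n * of_real (ln (real n)) ^ k) s"
  using assms(2)
proof (induction k arbitrary: s)
  case (Suc k)
  let ?b = "\<lambda>n. a n * of_real (ln (real n)) ^ k"
  have b: "log_bounded ?b" by (rule log_bounded_times_ln[OF assms(1)])
  have "((\<lambda>s. (-1) ^ k * dirichlet_sum ?b s) has_field_derivative
          (-1) ^ k * (- dirichlet_sum (\<lambda>n. ?b n * of_real (ln (real n))) s)) (at s)"
    using Suc.prems by (intro DERIV_cmult dirichlet_sum_deriv b)
  hence "((deriv ^^ k) (dirichlet_sum a) has_field_derivative
          (-1) ^ k * (- dirichlet_sum (\<lambda>n. ?b n * of_real (ln (real n))) s)) (at s)"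
    by (rule has_field_derivative_transform_within_open[OF _ open_Re_gt[of 1]])
      (use Suc in auto)
  hence "deriv ((deriv ^^ k) (dirichlet_sum a)) s =
     (-1) ^ k * (- dirichlet_sum (\<lambda>n. ?b n * of_real (ln (real n))) s)"
    by (rule DERIV_imp_deriv)
  thus ?case by (simp add: mult_ac)
qed simp

text \<open>Absolute convergence permits regrouping the double sum over (d, e) by n = d e; unordered
  sums make this a reindexing along (n, d) to (d, n div d).\<close>

lemma dirichlet_sum_mult:
  assumes a: "log_bounded a" and b: "log_bounded b" and s: "Re s > 1"
    and c: "\<And>n. n > 0 \<Longrightarrow> c n = (\<Sum>d | d dvd n. a d * b (n div d))" and lc: "log_bounded c"
  shows "dirichlet_sum a s * dirichlet_sum b s = dirichlet_sum c s"
proof -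
  let ?A = "{0<..} :: nat set"
  define f where "f = (\<lambda>a n. a n * of_nat n powr (- s) :: complex)"
  have f0: "f u 0 = 0" for u by (simp add: f_def)
  have abs: "(\<lambda>n. norm (f u n)) summable_on ?A" if "log_bounded u" for u
    using norm_summable_imp_summable_on[of "\<lambda>n. norm (f u n)"] summable_dirichlet[OF that s]
    by (auto simp: f_def intro: summable_on_subset_banach)
  have hs: "infsum (f u) ?A = dirichlet_sum u s" if "log_bounded u" for u
  proof -
    have "(f u has_sum dirichlet_sum u s) UNIV"
      using norm_summable_imp_has_sum[OF _ sums_dirichlet[OF that s]] summable_dirichlet[OF that s]
      by (simp add: f_def[abs_def])
    hence "(f u has_sum dirichlet_sum u s) ?A"
      by (subst has_sum_cong_neutral[where T = UNIV and g = "f u"]) (auto simp: f0 not_less)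
    thus ?thesis by (simp add: infsumI)
  qed
  have prod: "(\<lambda>(d,e). f a d * f b e) summable_on ?A \<times> ?A"
  proof (rule abs_summable_summable, rule Infinite_Sum.abs_summable_on_Sigma_iff[THEN iffD2],
      intro conjI ballI)
    show "(\<lambda>e. norm (case (d, e) of (d, e) \<Rightarrow> f a d * f b e)) summable_on ?A" for d
      using abs[OF b] by (simp add: norm_mult summable_on_cmult_right)
    show "(\<lambda>d. norm (\<Sum>\<^sub>\<infinity>e\<in>?A. norm (case (d, e) of (d, e) \<Rightarrow> f a d * f b e))) summable_on ?A"
      using summable_on_cmult_left[OF abs[OF a]]
      by (simp add: norm_mult infsum_cmult_right' infsum_nonneg)
  qed
  have bij: "bij_betw (\<lambda>(n,d). (d, n div d)) (SIGMA n:?A. {d. d dvd n}) (?A \<times> ?A)"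
    by (rule bij_betwI[where g = "\<lambda>(d,e). (d * e, d)"]) (auto elim!: dvdE)
  have eq: "(case (case x of (n,d) \<Rightarrow> (d, n div d)) of (d,e) \<Rightarrow> f a d * f b e)
     = (case x of (n,d) \<Rightarrow> a d * b (n div d) * of_nat n powr (- s))"
    if x0: "x \<in> (SIGMA n:?A. {d. d dvd n})" for x
  proof -
    obtain n d where x: "x = (n, d)" "n > 0" "d dvd n" using x0 by auto
    then obtain e where e: "n = d * e" by auto
    with x have "d > 0" "e > 0" by auto
    thus ?thesis using x(1) e by (simp add: f_def powr_times_real)
  qed
  have "dirichlet_sum a s * dirichlet_sum b s = infsum (\<lambda>(d,e). f a d * f b e) (?A \<times> ?A)"
    using infsum_Sigma'_banach[of "\<lambda>d e. f a d * f b e" ?A "\<lambda>_. ?A", OF prod]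
    by (simp add: hs a b infsum_cmult_right' infsum_cmult_left')
  also have "\<dots> = infsum (\<lambda>(n,d). a d * b (n div d) * of_nat n powr (- s)) (SIGMA n:?A. {d. d dvd n})"
    by (subst infsum_reindex_bij_betw[OF bij, symmetric]) (intro infsum_cong eq)
  also have "\<dots> = infsum (\<lambda>n. infsum (\<lambda>d. a d * b (n div d) * of_nat n powr (- s)) {d. d dvd n}) ?A"
  proof (rule infsum_Sigma'_banach[symmetric])
    have "(\<lambda>x. (case (case x of (n,d) \<Rightarrow> (d, n div d)) of (d,e) \<Rightarrow> f a d * f b e)) summable_on (SIGMA n:?A. {d. d dvd n})"
      using summable_on_reindex_bij_betw[OF bij] prod by blast
    thus "(\<lambda>(n,d). a d * b (n div d) * of_nat n powr (- s)) summable_on (SIGMA n:?A. {d. d dvd n})"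
      using summable_on_cong[OF eq] by (rule iffD1[rotated])
  qed
  also have "\<dots> = infsum (f c) ?A"
    by (intro infsum_cong) (simp add: f_def c infsum_finite sum_distrib_right)
  finally show ?thesis by (simp add: hs lc)
qed

section \<open>The zeta function near 1\<close>

text \<open>Mean value inequality on the segment from x to y; the derivative is largest at the left
  end because its exponent is negative.\<close>

lemma powr_diff_bound:
  fixes x y :: real and s :: complex
  assumes "0 < x" "x \<le> y" "Re s > -1"
  shows "norm (of_real x powr (- s) - of_real y powr (- s)) \<le> norm s * x powr (- 1 - Re s) * (y - x)"
proof -
  let ?S = "closed_segment (of_real x) (of_real y :: complex)"
  have S: "\<exists>u. z = of_real u \<and> x \<le> u \<and> u \<le> y" if "z \<in> ?S" for z
    using that assms closed_segment_of_real[of x y, where ?'a = complex]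
    by (auto simp: closed_segment_eq_real_ivl)
  have "norm (of_real x powr (- s) - of_real y powr (- s)) \<le>
      (norm s * x powr (- 1 - Re s)) * norm (of_real x - of_real y :: complex)"
  proof (rule field_differentiable_bound)
    fix z assume "z \<in> ?S"
    then obtain u where u: "z = of_real u" "x \<le> u" "u \<le> y" using S by blast
    have "z \<notin> \<real>\<^sub>\<le>\<^sub>0" using u assms by auto
    thus "((\<lambda>z. z powr (- s)) has_field_derivative (- s * z powr (- s - 1))) (at z within ?S)"
      by (rule has_field_derivative_at_within[OF has_field_derivative_powr])
    have "norm (- s * z powr (- s - 1)) = norm s * u powr (- Re s - 1)"
      using u assms by (simp add: norm_mult norm_powr_real_powr)
    also have "\<dots> \<le> norm s * x powr (- Re s - 1)"
      using u assms by (intro mult_left_mono powr_mono2') auto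
    finally show "norm (- s * z powr (- s - 1)) \<le> norm s * x powr (- 1 - Re s)"
      by (simp add: minus_diff_commute)
  qed auto
  also have "norm (of_real x - of_real y :: complex) = y - x"
    using assms by (metis abs_minus_commute abs_of_nonneg diff_ge_0_iff_ge norm_of_real of_real_diff)
  finally show ?thesis .
qed

text \<open>Shared by \<open>zeta_reg\<close> and \<open>L\<close>, whose terms have this decay with
  K quadratic and linear in the norm of s. Monotonicity of K makes the bound uniform on balls; the
  exponent -3/2 is the worst case for Re s \<ge> 1/2.\<close>

lemma series_right_half_plane:
  fixes h :: "nat \<Rightarrow> complex \<Rightarrow> complex"
  assumes hol: "\<And>n. h n holomorphic_on {s. Re s > 0}"
    and bd: "\<And>n s. Re s > 0 \<Longrightarrow> norm (h n s) \<le> K (norm s) * real (Suc n) powr (- 1 - Re s)"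
    and K: "mono K"
  shows "(\<lambda>s. \<Sum>n. h n s) holomorphic_on {s. Re s > 0}"
    and "\<And>s. Re s > 0 \<Longrightarrow> summable (\<lambda>n. h n s)"
    and "\<And>s. Re s \<ge> 1/2 \<Longrightarrow> norm (\<Sum>n. h n s) \<le> K (norm s) * (\<Sum>n. real (Suc n) powr (- 3/2))"
proof -
  let ?S = "{s::complex. Re s > 0}"
  have sm: "summable (\<lambda>n. real (Suc n) powr (- 1 - x))" if "x > 0" for x :: real
    using summable_real_powr_iff[of "- 1 - x"] that by (subst summable_Suc_iff) auto
  have Kpos: "0 \<le> K (norm s)" if "Re s > 0" for s
    using order_trans[OF norm_ge_zero bd[OF that, of 0]] by simp
  obtain g where g: "\<forall>x \<in> ?S. ((\<lambda>n. h n x) sums g x) \<and> g field_differentiable (at x)"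
  proof (rule series_differentiable_comparison_complex[OF open_Re_gt])
    show "h n field_differentiable at x" if "x \<in> ?S" for n x
      using hol[of n] that open_Re_gt holomorphic_on_imp_differentiable_at by blast
    fix x assume x: "x \<in> ?S"
    define d where "d = Re x / 2"
    have d: "d > 0" using x by (simp add: d_def)
    define H where "H = (\<lambda>n. K (norm x + d) * real (Suc n) powr (- 1 - d))"
    have Kp: "0 \<le> K (norm x + d)" using Kpos[of x] x d monoD[OF K, of "norm x" "norm x + d"] by simp
    have "norm (h n y) \<le> H n" if "y \<in> ball x d" for n y
    proof -
      have "\<bar>Re x - Re y\<bar> < d" "norm (x - y) < d"
        using that abs_Re_le_cmod[of "x - y"] by (auto simp: dist_norm)
      hence r: "Re y \<ge> d" "norm y \<le> norm x + d"
        using norm_triangle_ineq2[of y x] by (auto simp: d_def abs_if norm_minus_commute field_simps split: if_splits)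
      have "norm (h n y) \<le> K (norm y) * real (Suc n) powr (- 1 - Re y)"
        using r d by (intro bd) auto
      also have "\<dots> \<le> H n" unfolding H_def
        using r d Kp by (intro mult_mono monoD[OF K] powr_mono) auto
      finally show ?thesis .
    qed
    moreover have "summable H" unfolding H_def by (intro summable_mult sm d)
    moreover have "H n \<ge> 0" for n using Kp by (simp add: H_def)
    ultimately show "\<exists>d h'. 0 < d \<and> summable h' \<and> range h' \<subseteq> \<real>\<^sub>\<ge>\<^sub>0 \<and>
        (\<forall>\<^sub>F n in sequentially. \<forall>y\<in>ball x d \<inter> ?S. cmod (h n y) \<le> cmod (h' n))"
      using d by (intro exI[of _ d] exI[of _ "\<lambda>n. complex_of_real (H n)"])
        (auto simp: summable_of_real)
  qed auto
  have eq: "(\<Sum>n. h n x) = g x" if "x \<in> ?S" for x using g that by (auto simp: sums_iff)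
  have "g holomorphic_on ?S"
    using g by (auto simp: holomorphic_on_def intro: field_differentiable_at_within)
  thus "(\<lambda>s. \<Sum>n. h n s) holomorphic_on ?S"
    by (rule holomorphic_transform) (simp add: eq)
  show "summable (\<lambda>n. h n s)" if "Re s > 0" for s
    using g that by (auto simp: sums_iff)
  show "norm (\<Sum>n. h n s) \<le> K (norm s) * (\<Sum>n. real (Suc n) powr (- 3/2))" if s: "Re s \<ge> 1/2" for s
  proof -
    have b: "norm (h n s) \<le> K (norm s) * real (Suc n) powr (- 3/2)" for n
    proof -
      have "norm (h n s) \<le> K (norm s) * real (Suc n) powr (- 1 - Re s)" using s by (intro bd) auto
      also have "\<dots> \<le> K (norm s) * real (Suc n) powr (- 3/2)"
        using s Kpos[of s] by (intro mult_left_mono powr_mono) auto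
      finally show ?thesis .
    qed
    have sb: "summable (\<lambda>n. real (Suc n) powr (- 3/2))" using sm[of "1/2"] by simp
    hence "norm (\<Sum>n. h n s) \<le> (\<Sum>n. K (norm s) * real (Suc n) powr (- 3/2))"
      by (intro norm_suminf_le b summable_mult)
    thus ?thesis using sb by (simp add: suminf_mult)
  qed
qed

lemma tendsto_nat_powr_0:
  assumes "Re s > 0"
  shows "(\<lambda>n. of_nat (Suc n) powr (- s) :: complex) \<longlonglongrightarrow> 0"
proof (rule tendsto_norm_zero_cancel)
  have "(\<lambda>n. real (Suc n) powr (- Re s)) \<longlonglongrightarrow> 0"
    using assms by (intro tendsto_neg_powr filterlim_compose[OF filterlim_real_sequentially filterlim_Suc]) auto
  thus "(\<lambda>n. norm (of_nat (Suc n) powr (- s) :: complex)) \<longlonglongrightarrow> 0"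
    by (simp only: norm_nat_powr) simp
qed

abbreviation zeta :: "complex \<Rightarrow> complex" where
  "zeta \<equiv> dirichlet_sum (\<lambda>_. 1)"

text \<open>\<open>(s - 1) \<zeta>(s)\<close>: subtracting the telescoping series of \<open>n\<^bsup>1-s\<^esup>\<close> makes the terms
  \<open>O(n\<^bsup>-1-Re s\<^esup>)\<close>.\<close>

definition zeta_reg :: "complex \<Rightarrow> complex" where
  "zeta_reg s = 1 + (\<Sum>n. (s - 1) * of_nat (Suc n) powr (- s)
                  - of_nat (Suc n) powr (1 - s) + of_nat (Suc (Suc n)) powr (1 - s))"

text \<open>With m = n + 1 the term is the increment over [m, m+1] of z^(1-s) + (s-1) m^(-s) z. The
  derivative of this function is (s-1)(m^(-s) - z^(-s)), which \<open>powr_diff_bound\<close> makes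
  small.\<close>

lemma zeta_term_bound:
  assumes "Re s > 0"
  shows "norm ((s - 1) * of_nat (Suc n) powr (- s)
                  - of_nat (Suc n) powr (1 - s) + of_nat (Suc (Suc n)) powr (1 - s))
       \<le> (norm s * (norm s + 1)) * real (Suc n) powr (- 1 - Re s)"
proof -
  define m where "m = real (Suc n)"
  have m: "m > 0" by (simp add: m_def)
  define c where "c = complex_of_real m powr (- s)"
  let ?S = "closed_segment (of_real m) (of_real (m + 1) :: complex)"
  let ?f = "\<lambda>z. z powr (1 - s) + (s - 1) * c * z"
  have S: "\<exists>u. z = of_real u \<and> m \<le> u \<and> u \<le> m + 1" if "z \<in> ?S" for z
    using that closed_segment_of_real[of m "m + 1", where ?'a = complex]
    by (auto simp: closed_segment_eq_real_ivl)
  have "norm (?f (of_real (m + 1)) - ?f (of_real m)) \<le>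
      (norm s * (norm s + 1) * m powr (- 1 - Re s)) * norm (of_real (m + 1) - of_real m :: complex)"
  proof (rule field_differentiable_bound)
    fix z assume z: "z \<in> ?S"
    obtain u where u: "z = of_real u" "m \<le> u" "u \<le> m + 1" using S[OF z] by blast
    have "z \<notin> \<real>\<^sub>\<le>\<^sub>0" using u m by auto
    hence "((\<lambda>z. z powr (1 - s)) has_field_derivative ((1 - s) * z powr (1 - s - 1))) (at z within ?S)"
      by (rule has_field_derivative_at_within[OF has_field_derivative_powr])
    from DERIV_add[OF this DERIV_cmult[OF DERIV_ident, of "(s - 1) * c"]]
    show "(?f has_field_derivative (1 - s) * z powr (- s) + (s - 1) * c) (at z within ?S)"
      by simp
    have "norm (c - of_real u powr (- s)) \<le> norm s * m powr (- 1 - Re s) * (u - m)"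
      unfolding c_def using u m assms by (intro powr_diff_bound) auto
    also have "\<dots> \<le> norm s * m powr (- 1 - Re s) * 1"
      using u by (intro mult_left_mono) auto
    finally have b: "norm (c - of_real u powr (- s)) \<le> norm s * m powr (- 1 - Re s)" by simp
    have "(1 - s) * z powr (- s) + (s - 1) * c = (s - 1) * (c - of_real u powr (- s))"
      by (simp add: u algebra_simps)
    also have "norm \<dots> \<le> (norm s + 1) * (norm s * m powr (- 1 - Re s))"
      unfolding norm_mult using b norm_triangle_ineq4[of s 1] by (intro mult_mono) auto
    finally show "norm ((1 - s) * z powr (- s) + (s - 1) * c) \<le> norm s * (norm s + 1) * m powr (- 1 - Re s)"
      by (simp add: mult_ac)
  qed auto
  also have "?f (of_real (m + 1)) - ?f (of_real m) =
      (s - 1) * of_nat (Suc n) powr (- s)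
                  - of_nat (Suc n) powr (1 - s) + of_nat (Suc (Suc n)) powr (1 - s)"
    by (simp add: m_def c_def algebra_simps)
  finally show ?thesis by (simp add: m_def)
qed

lemma zeta_reg_holomorphic: "zeta_reg holomorphic_on {s. Re s > 0}"
proof -
  \<comment> \<open>Monotonicity is demanded on all reals; the maxima take care of the negative ones
    and change nothing on norms.\<close>
  have "mono (\<lambda>r::real. max 0 r * (max 0 r + 1))"
    by (intro monoI mult_mono) auto
  thus ?thesis unfolding zeta_reg_def
    by (intro holomorphic_intros series_right_half_plane(1)[where K = "\<lambda>r. max 0 r * (max 0 r + 1)"])
      (auto simp del: of_nat_Suc intro!: order_trans[OF zeta_term_bound] holomorphic_intros)
qed

lemma log_bounded_1: "log_bounded (\<lambda>_. 1)"
  unfolding log_bounded_def by (intro exI[of _ 1] exI[of _ 0]) auto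

lemma zeta_reg_eq:
  assumes "Re s > 1"
  shows "zeta_reg s = (s - 1) * zeta s"
proof -
  have "(\<lambda>n. 1 * of_nat (Suc n) powr (- s)) sums (zeta s - 1 * of_nat 0 powr (- s))"
    using sums_dirichlet[OF log_bounded_1 assms] by (subst sums_Suc_iff) simp
  hence "(\<lambda>n. (s - 1) * of_nat (Suc n) powr (- s)) sums ((s - 1) * zeta s)"
    by (intro sums_mult) simp
  moreover have "(\<lambda>n. of_nat (Suc (Suc n)) powr (1 - s) - of_nat (Suc n) powr (1 - s)) sums (0 - of_nat (Suc 0) powr (1 - s))"
    using tendsto_nat_powr_0[of "s - 1"] assms by (intro telescope_sums) auto
  ultimately have "(\<lambda>n. (s - 1) * of_nat (Suc n) powr (- s) + (of_nat (Suc (Suc n)) powr (1 - s) - of_nat (Suc n) powr (1 - s)))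
      sums ((s - 1) * zeta s + (0 - of_nat (Suc 0) powr (1 - s)))"
    by (rule sums_add)
  hence "(\<lambda>n. (s - 1) * of_nat (Suc n) powr (- s)
                  - of_nat (Suc n) powr (1 - s) + of_nat (Suc (Suc n)) powr (1 - s)) sums ((s - 1) * zeta s - 1)"
    by (simp add: algebra_simps)
  thus ?thesis by (simp add: zeta_reg_def sums_iff)
qed

text \<open>At s = 1 every term of the series is 0 - 1 + 1. The value is the residue of zeta, and
  its being nonzero gives a disc around 1 free of zeros.\<close>

lemma zeta_reg_1: "zeta_reg 1 = 1"
proof -
  have "of_nat (Suc n) \<noteq> (0 :: complex)" for n by (simp del: of_nat_Suc)
  thus ?thesis by (simp add: zeta_reg_def del: of_nat_Suc)
qed

section \<open>Logarithmic derivatives and nonvanishing for Re s > 1\<close>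

abbreviation mangoldt_series :: "complex \<Rightarrow> complex" where
  "mangoldt_series \<equiv> dirichlet_sum mangoldt"

lemma log_bounded_mangoldt_mult:
  assumes "\<And>n. norm (f n) \<le> 1"
  shows "log_bounded (\<lambda>n. f n * mangoldt n)"
  unfolding log_bounded_def
proof (intro exI[of _ 1] exI[of _ 1] allI impI)
  fix n :: nat assume n: "n \<ge> 1"
  have "norm (f n) * mangoldt n \<le> 1 * ln (real n)"
    using assms[of n] mangoldt_le[of n] n mangoldt_nonneg[of n] by (intro mult_mono) auto
  thus "norm (f n * mangoldt n) \<le> 1 * ln (real n) ^ 1" by (simp add: norm_mult)
qed

lemma log_bounded_mangoldt: "log_bounded mangoldt"
  using log_bounded_mangoldt_mult[of "\<lambda>_. 1"] by simp

lemma log_bounded_le_1: "(\<And>n. norm (f n) \<le> 1) \<Longrightarrow> log_bounded f"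
  unfolding log_bounded_def by (intro exI[of _ 1] exI[of _ 0]) auto

text \<open>By complete multiplicativity the convolution of f \<Lambda> with f is f times the
  convolution of \<Lambda> with 1, that is f ln. The result is a product and not a quotient because
  nonvanishing is itself derived from it in \<open>dirichlet_sum_nonzero\<close>.\<close>

lemma mangoldt_logderiv:
  fixes f :: "nat \<Rightarrow> complex"
  assumes f: "\<And>n. norm (f n) \<le> 1" and mult: "\<And>m n. f (m * n) = f m * f n" and s: "Re s > 1"
  shows "(dirichlet_sum f has_field_derivative
           - (dirichlet_sum f s * dirichlet_sum (\<lambda>n. f n * mangoldt n) s)) (at s)"
proof -
  have lb: "log_bounded f" by (rule log_bounded_le_1[OF f])
  have "dirichlet_sum (\<lambda>n. f n * mangoldt n) s * dirichlet_sum f s =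
        dirichlet_sum (\<lambda>n. f n * of_real (ln (real n))) s"
  proof (rule dirichlet_sum_mult[OF log_bounded_mangoldt_mult[OF f] lb s])
    fix n :: nat assume n: "n > 0"
    have "(\<Sum>d | d dvd n. f d * mangoldt d * f (n div d)) = (\<Sum>d | d dvd n. f n * mangoldt d)"
    proof (rule sum.cong)
      fix d assume "d \<in> {d. d dvd n}"
      hence "f n = f d * f (n div d)" using mult[of d "n div d"] by simp
      thus "f d * mangoldt d * f (n div d) = f n * mangoldt d" by simp
    qed simp
    also have "\<dots> = f n * (\<Sum>d | d dvd n. mangoldt d)" by (simp add: sum_distrib_left)
    also have "(\<Sum>d | d dvd n. mangoldt d) = (of_real (ln (real n)) :: complex)"
      using n by (intro mangoldt_sum) auto
    finally show "f n * of_real (ln (real n)) = (\<Sum>d | d dvd n. f d * mangoldt d * f (n div d))" by simp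
  qed (use log_bounded_times_ln[OF lb, of 1] in simp)
  thus ?thesis using dirichlet_sum_deriv[OF lb s] by (simp add: mult.commute)
qed

lemma norm_dirichlet_sum_le:
  assumes a: "\<And>n. norm (a n) \<le> b n" and b: "log_bounded (\<lambda>n. of_real (b n))" and s: "Re s \<ge> \<sigma>" and \<sigma>: "\<sigma> > 1"
  shows "norm (dirichlet_sum a s) \<le> Re (dirichlet_sum (\<lambda>n. of_real (b n)) (of_real \<sigma>))"
proof -
  have b0: "b n \<ge> 0" for n using order_trans[OF norm_ge_zero a] .
  have "(\<lambda>n. of_real (b n) * of_nat n powr (- of_real \<sigma>)) sums dirichlet_sum (\<lambda>n. of_real (b n)) (of_real \<sigma>)"
    using \<sigma> by (intro sums_dirichlet b) auto
  hence "(\<lambda>n. Re (of_real (b n) * of_nat n powr (- of_real \<sigma>))) sums Re (dirichlet_sum (\<lambda>n. of_real (b n)) (of_real \<sigma>))"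
    by (rule sums_Re)
  moreover have "Re (of_real (b n) * of_nat n powr (- of_real \<sigma>)) = b n * real n powr (- \<sigma>)" for n
    using powr_of_real[of "real n" "- \<sigma>"] by simp
  ultimately have S: "(\<lambda>n. b n * real n powr (- \<sigma>)) sums Re (dirichlet_sum (\<lambda>n. of_real (b n)) (of_real \<sigma>))"
    by (simp only:)
  have "norm (a n * of_nat n powr (- s)) \<le> b n * real n powr (- \<sigma>)" for n
    using a[of n] b0[of n] s by (auto simp: norm_mult norm_nat_powr intro!: mult_mono powr_mono)
  thus ?thesis unfolding dirichlet_sum_def
    using norm_suminf_le[of "\<lambda>n. a n * of_nat n powr (- s)" "\<lambda>n. b n * real n powr (- \<sigma>)"] S
    by (simp add: sums_iff dirichlet_sum_def)
qed

text \<open>If P is a primitive of the series of f \<Lambda>, then exp P times the series of f is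
  constant. The value at s is thus compared with the one at 2, where the first term dominates. The
  bound depends on \<sigma> and s but not on f, hence not on the modulus of a character.\<close>

lemma dirichlet_sum_nonzero:
  fixes f :: "nat \<Rightarrow> complex"
  assumes f: "\<And>n. norm (f n) \<le> 1" and mult: "\<And>m n. f (m * n) = f m * f n" and f1: "f 1 = 1"
    and \<sigma>: "\<sigma> > 1" and s: "Re s \<ge> \<sigma>" "\<sigma> \<le> 2"
  shows "norm (dirichlet_sum f s) \<ge> exp (- Re (mangoldt_series (of_real \<sigma>)) * norm (s - 2)) / 4"
proof -
  let ?G = "dirichlet_sum (\<lambda>n. f n * mangoldt n)" and ?S = "{s::complex. Re s > 1}"
  define B where "B = Re (mangoldt_series (of_real \<sigma>))"
  have lb: "log_bounded f" by (rule log_bounded_le_1[OF f])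
  have cS: "convex ?S" by (simp add: convex_halfspace_Re_gt)
  obtain P where P: "\<And>x. x \<in> ?S \<Longrightarrow> (P has_field_derivative ?G x) (at x)"
  proof (rule holomorphic_convex_primitive'[OF cS open_Re_gt])
    show "?G holomorphic_on ?S"
      by (intro dirichlet_sum_holomorphic log_bounded_mangoldt_mult f)
  qed (auto simp: at_within_open[OF _ open_Re_gt])
  have "\<exists>c. \<forall>x\<in>?S. dirichlet_sum f x * exp (P x) = c"
  proof (rule has_field_derivative_zero_constant[OF cS])
    fix x assume x: "x \<in> ?S"
    have "((\<lambda>x. dirichlet_sum f x * exp (P x)) has_field_derivative 0) (at x)"
      using x by (auto intro!: derivative_eq_intros P mangoldt_logderiv[OF f mult])
    thus "((\<lambda>x. dirichlet_sum f x * exp (P x)) has_field_derivative 0) (at x within ?S)"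
      by (rule has_field_derivative_at_within)
  qed
  then obtain c where c: "\<And>x. Re x > 1 \<Longrightarrow> dirichlet_sum f x * exp (P x) = c" by auto
  have eq: "dirichlet_sum f s = dirichlet_sum f 2 * exp (P 2 - P s)"
    using c[of s] c[of 2] s \<sigma> by (simp add: exp_diff field_simps)
  have "norm (P 2 - P s) \<le> B * norm (2 - s)"
  proof (rule field_differentiable_bound[where S = "{s. Re s \<ge> \<sigma>}"])
    fix z assume z: "z \<in> {s. Re s \<ge> \<sigma>}"
    show "(P has_field_derivative ?G z) (at z within {s. Re s \<ge> \<sigma>})"
      using z \<sigma> by (auto intro: has_field_derivative_at_within[OF P])
    show "norm (?G z) \<le> B"
      using norm_dirichlet_sum_le[of "\<lambda>n. f n * mangoldt n" mangoldt \<sigma> z] z \<sigma>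
        mult_right_mono[OF f mangoldt_nonneg]
      by (simp add: norm_mult log_bounded_mangoldt B_def)
  qed (use s in \<open>auto simp: convex_halfspace_Re_ge\<close>)
  hence "Re (P 2 - P s) \<ge> - B * norm (s - 2)"
    using abs_Re_le_cmod[of "P 2 - P s"] by (simp add: norm_minus_commute)
  moreover have "norm (dirichlet_sum f 2) \<ge> 1/4"
  proof -
    have "(\<lambda>n. f (Suc n) * of_nat (Suc n) powr (- 2)) sums (dirichlet_sum f 2 - f 0 * of_nat 0 powr (- 2))"
      using sums_dirichlet[OF lb, of 2] by (subst sums_Suc_iff) simp
    hence "(\<lambda>n. f (Suc (Suc n)) * of_nat (Suc (Suc n)) powr (- 2)) sums
        (dirichlet_sum f 2 - f (Suc 0) * of_nat (Suc 0) powr (- 2))"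
      by (subst sums_Suc_iff) simp
    hence S: "(\<lambda>n. f (Suc (Suc n)) * of_nat (Suc (Suc n)) powr (- 2)) sums (dirichlet_sum f 2 - 1)"
      using f1 by simp
    have "(\<lambda>n. 1 / (real (Suc (Suc n)))\<^sup>2) sums (pi\<^sup>2 / 6 - 1 / (real (Suc 0))\<^sup>2)"
      using inverse_squares_sums by (subst sums_Suc_iff) (simp add: add.commute)
    hence T: "(\<lambda>n. 1 / (real (Suc (Suc n)))\<^sup>2) sums (pi\<^sup>2 / 6 - 1)" by simp
    have "norm (f (Suc (Suc n)) * of_nat (Suc (Suc n)) powr (- 2)) \<le> 1 / (real (Suc (Suc n)))\<^sup>2" for n
    proof -
      have "norm (f (Suc (Suc n)) * of_nat (Suc (Suc n)) powr (- 2)) \<le> 1 * real (Suc (Suc n)) powr (- 2)"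
        unfolding norm_mult norm_nat_powr using f by (intro mult_mono) auto
      also have "\<dots> = 1 / (real (Suc (Suc n)))\<^sup>2" by (simp add: powr_minus divide_inverse)
      finally show ?thesis .
    qed
    hence "norm (dirichlet_sum f 2 - 1) \<le> pi\<^sup>2 / 6 - 1"
      using norm_suminf_le[of "\<lambda>n. f (Suc (Suc n)) * of_nat (Suc (Suc n)) powr (- 2)" "\<lambda>n. 1 / (real (Suc (Suc n)))\<^sup>2"] S T
      by (simp add: sums_iff)
    \<comment> \<open>10.24 / 6 - 1 is below 3/4, so the terms with n \<ge> 2 cancel at most 3/4 of
      the first term 1.\<close>
    also have "pi\<^sup>2 \<le> 3.2\<^sup>2" using pi_less_4 pi_approx by (intro power_mono) auto
    hence "pi\<^sup>2 / 6 - 1 \<le> 3/4" by (simp add: power2_eq_square)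
    finally show ?thesis using norm_triangle_ineq2[of 1 "1 - dirichlet_sum f 2"]
      by (simp add: norm_minus_commute)
  qed
  ultimately have "1/4 * exp (- B * norm (s - 2)) \<le> norm (dirichlet_sum f 2) * exp (Re (P 2 - P s))"
    by (intro mult_mono) auto
  thus ?thesis by (simp add: eq norm_mult B_def)
qed

section \<open>Complex-analytic tools for logarithmic derivatives\<close>

text \<open>Let u be g - g(z0), rescaled to the unit disc. Because Re u < A, the map u / (2A - u)
  sends the unit disc into itself and fixes 0. Schwarz bounds it by 1/2 on half the radius, and
  solving for u gives 2A.\<close>

lemma borel_caratheodory_half:
  fixes g :: "complex \<Rightarrow> complex"
  assumes g: "g holomorphic_on ball z0 R" and R: "R > 0"
    and A: "\<And>z. z \<in> ball z0 R \<Longrightarrow> Re (g z) - Re (g z0) < A" and z: "norm (z - z0) \<le> R / 2"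
  shows "norm (g z - g z0) \<le> 2 * A"
proof -
  have A0: "A > 0" using A[of z0] R by simp
  define u where "u = (\<lambda>w. g (z0 + of_real R * w) - g z0)"
  have inb: "z0 + of_real R * w \<in> ball z0 R" if "norm w < 1" for w
    using that R by (simp add: dist_norm norm_mult)
  have Reu: "Re (u w) < A" if "norm w < 1" for w
    using A[OF inb[OF that]] by (simp add: u_def)
  have ne: "2 * of_real A - u w \<noteq> 0" if "norm w < 1" for w
  proof
    assume "2 * of_real A - u w = 0"
    hence "Re (2 * of_real A - u w) = 0" by simp
    thus False using Reu[OF that] A0 by simp
  qed
  define \<phi> where "\<phi> = (\<lambda>w. u w / (2 * of_real A - u w))"
  have uhol: "u holomorphic_on ball 0 1"
    unfolding u_def
    by (intro holomorphic_intros holomorphic_on_compose_gen[OF _ g, unfolded o_def])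
      (use inb in auto)
  have \<phi>hol: "\<phi> holomorphic_on ball 0 1"
    unfolding \<phi>_def using ne by (intro holomorphic_intros uhol) auto
  have \<phi>1: "norm (\<phi> w) < 1" if "norm w < 1" for w
  proof -
    have "(norm (u w))\<^sup>2 < (norm (2 * of_real A - u w))\<^sup>2"
    proof -
      have "(norm (2 * of_real A - u w))\<^sup>2 = (2 * A - Re (u w))\<^sup>2 + (Im (u w))\<^sup>2"
        by (simp add: cmod_power2)
      moreover have "(2 * A - Re (u w))\<^sup>2 - (Re (u w))\<^sup>2 = 4 * A * (A - Re (u w))"
        by (simp add: power2_eq_square algebra_simps)
      moreover have "4 * A * (A - Re (u w)) > 0" using A0 Reu[OF that] by simp
      ultimately show ?thesis by (simp add: cmod_power2)
    qed
    hence "norm (u w) < norm (2 * of_real A - u w)"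
      by (rule power2_less_imp_less) simp
    thus ?thesis by (simp add: \<phi>_def norm_divide divide_simps)
  qed
  define w where "w = (z - z0) / of_real R"
  have w: "norm w \<le> 1/2" using z R by (simp add: w_def norm_divide field_simps)
  hence w1: "norm w < 1" by simp
  have "\<phi> 0 = 0" by (simp add: \<phi>_def u_def)
  hence "norm (\<phi> w) \<le> norm w"
    using Schwarz_Lemma(1)[OF \<phi>hol _ \<phi>1 w1] by blast
  hence p: "norm (\<phi> w) \<le> 1/2" using w by simp
  have "u w = (2 * of_real A - u w) * \<phi> w"
    using ne[OF w1] by (simp add: \<phi>_def)
  hence eq: "u w = 2 * of_real A * \<phi> w - u w * \<phi> w"
    by (simp add: left_diff_distrib)
  have "norm (u w) \<le> norm (2 * of_real A * \<phi> w) + norm (u w * \<phi> w)"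
    by (subst eq) (rule norm_triangle_ineq4)
  also have "\<dots> \<le> 2 * A * (1/2) + norm (u w) * (1/2)"
    unfolding norm_mult using p A0 by (intro add_mono mult_mono) auto
  finally have "norm (u w) \<le> 2 * A" by simp
  thus ?thesis using R by (simp add: u_def w_def)
qed

lemma higher_deriv_inverse_minus:
  fixes z a :: complex
  assumes "z \<noteq> a"
  shows "(deriv ^^ k) (\<lambda>z. inverse (z - a)) z = (-1) ^ k * fact k / (z - a) ^ Suc k"
  using assms
proof (induction k arbitrary: z)
  case (Suc k)
  have "((\<lambda>z. (-1) ^ k * fact k / (z - a) ^ Suc k) has_field_derivative
     (-1) ^ Suc k * fact (Suc k) / (z - a) ^ Suc (Suc k)) (at z)"
    using Suc.prems by (auto intro!: derivative_eq_intros simp: divide_simps power_add power2_eq_square)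
      (cases k; simp add: algebra_simps)
  hence "((deriv ^^ k) (\<lambda>z. inverse (z - a)) has_field_derivative
     (-1) ^ Suc k * fact (Suc k) / (z - a) ^ Suc (Suc k)) (at z)"
    by (rule has_field_derivative_transform_within_open[where S = "- {a}"]) (use Suc in auto)
  thus ?case by (simp add: DERIV_imp_deriv)
qed (simp add: divide_inverse)

text \<open>If h = g (w - z0)^m with g(z0) nonzero, then h'/h = m/(w - z0) + g'/g. The limit is
  taken from the right along the reals because for points on Re s = 1 this stays where the Dirichlet
  series converges.\<close>

lemma logderiv_limit:
  fixes h :: "complex \<Rightarrow> complex"
  assumes h: "h holomorphic_on S" "open S" "connected S" "z0 \<in> S" and ex: "\<exists>w\<in>S. h w \<noteq> 0"
  obtains m :: nat where "h z0 \<noteq> 0 \<longleftrightarrow> m = 0" "m = 1 \<Longrightarrow> deriv h z0 \<noteq> 0"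
    "((\<lambda>x. of_real x * (deriv h (z0 + of_real x) / h (z0 + of_real x))) \<longlongrightarrow> of_nat m) (at_right 0)"
proof -
  define m where "m = nat (zorder h z0)"
  define g where "g = zor_poly h z0"
  from zorder_exist_zero[OF h(1-4) ex] obtain r where r: "r > 0" "cball z0 r \<subseteq> S"
      "g holomorphic_on cball z0 r" "\<And>w. w \<in> cball z0 r \<Longrightarrow> h w = g w * (w - z0) ^ m \<and> g w \<noteq> 0"
      and m0: "if h z0 = 0 then zorder h z0 > 0 else zorder h z0 = 0"
    unfolding m_def g_def by blast
  have hm: "h z0 \<noteq> 0 \<longleftrightarrow> m = 0" using m0 by (auto simp: m_def split: if_splits)
  have gb: "g holomorphic_on ball z0 r" using r(3) by (rule holomorphic_on_subset) auto
  have gd: "(g has_field_derivative deriv g w) (at w)" if "w \<in> ball z0 r" for w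
    using holomorphic_derivI[OF gb open_ball that] .
  have hd: "(h has_field_derivative deriv g w * (w - z0) ^ m + g w * (of_nat m * (w - z0) ^ (m - 1))) (at w)"
    if "w \<in> ball z0 r" for w
  proof (rule has_field_derivative_transform_within_open[where S = "ball z0 r"])
    show "((\<lambda>w. g w * (w - z0) ^ m) has_field_derivative
        deriv g w * (w - z0) ^ m + g w * (of_nat m * (w - z0) ^ (m - 1))) (at w)"
      using that by (auto intro!: derivative_eq_intros gd)
  qed (use that r(4) in auto)
  have m1: "deriv h z0 \<noteq> 0" if "m = 1"
    using DERIV_imp_deriv[OF hd[of z0]] r(1) r(4)[of z0] that by simp
  have "((\<lambda>x. of_nat m + of_real x * (deriv g (z0 + of_real x) / g (z0 + of_real x))) \<longlongrightarrow>
      of_nat m + of_real 0 * (deriv g (z0 + of_real 0) / g (z0 + of_real 0))) (at_right 0)"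
  proof (intro tendsto_intros)
    have c: "isCont (deriv g) z0" "isCont g z0"
      using r(1) holomorphic_on_imp_continuous_on[OF gb]
        holomorphic_on_imp_continuous_on[OF holomorphic_deriv[OF gb open_ball]]
      by (simp_all add: continuous_on_eq_continuous_at)
    have l: "((\<lambda>x. z0 + of_real x) \<longlongrightarrow> z0) (at_right (0::real))"
      by (auto intro!: tendsto_eq_intros)
    show "((\<lambda>x. deriv g (z0 + of_real x)) \<longlongrightarrow> deriv g (z0 + of_real 0)) (at_right 0)"
      using isCont_tendsto_compose[OF c(1) l] by simp
    show "((\<lambda>x. g (z0 + of_real x)) \<longlongrightarrow> g (z0 + of_real 0)) (at_right 0)"
      using isCont_tendsto_compose[OF c(2) l] by simp
    show "g (z0 + of_real 0) \<noteq> 0" using r(1) r(4)[of z0] by simp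
  qed
  moreover have "\<forall>\<^sub>F x in at_right 0.
      of_nat m + of_real x * (deriv g (z0 + of_real x) / g (z0 + of_real x)) =
      of_real x * (deriv h (z0 + of_real x) / h (z0 + of_real x))"
    using eventually_at_right_less[of "0::real"] eventually_at_right_real[OF r(1)]
  proof eventually_elim
    case (elim x)
    let ?w = "z0 + of_real x"
    have w: "?w \<in> ball z0 r" using elim by (simp add: dist_norm)
    have gw: "g ?w \<noteq> 0" "h ?w = g ?w * of_real x ^ m" using r(4)[of ?w] w by auto
    have dh: "deriv h ?w = deriv g ?w * of_real x ^ m + g ?w * (of_nat m * of_real x ^ (m - 1))"
      using DERIV_imp_deriv[OF hd[OF w]] by simp
    show ?case
    proof (cases m)
      case (Suc m')
      thus ?thesis using elim gw(1) unfolding dh gw(2) by (simp add: field_simps)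
    qed (use elim gw(1) in \<open>simp add: dh gw(2) field_simps\<close>)
  qed
  ultimately have "((\<lambda>x. of_real x * (deriv h (z0 + of_real x) / h (z0 + of_real x))) \<longlongrightarrow> of_nat m) (at_right 0)"
    by (simp add: filterlim_cong)
  thus ?thesis using that[OF hm] m1 by blast
qed

lemma connected_Re_gt: "connected {s. Re s > x}"
  by (simp add: convex_connected convex_halfspace_Re_gt)

lemma zeta_nonzero:
  assumes "Re s > 1" shows "zeta s \<noteq> 0"
proof -
  have "norm (zeta s) \<ge> exp (- Re (mangoldt_series (of_real (min 2 (Re s)))) * norm (s - 2)) / 4"
    using assms by (intro dirichlet_sum_nonzero) auto
  thus ?thesis by (smt (verit) divide_pos_pos exp_gt_zero norm_zero)
qed

text \<open>Logarithmic derivative of (s - 1) zeta(s): the pole is separated from a part that is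
  holomorphic wherever \<open>zeta_reg\<close> does not vanish.\<close>

lemma mangoldt_zeta_reg:
  assumes "Re s > 1"
  shows "mangoldt_series s = inverse (s - 1) - deriv zeta_reg s / zeta_reg s"
proof -
  have s1: "s \<noteq> 1" using assms by auto
  have z: "(zeta has_field_derivative - (zeta s * mangoldt_series s)) (at s)"
    using mangoldt_logderiv[of "\<lambda>_. 1" s] assms by simp
  have "((\<lambda>s. (s - 1) * zeta s) has_field_derivative zeta s - (s - 1) * (zeta s * mangoldt_series s)) (at s)"
    by (auto intro!: derivative_eq_intros z)
  hence "(zeta_reg has_field_derivative zeta s - (s - 1) * (zeta s * mangoldt_series s)) (at s)"
    by (rule has_field_derivative_transform_within_open[OF _ open_Re_gt[of 1]])
      (use assms zeta_reg_eq in auto)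
  hence "deriv zeta_reg s = zeta s * (1 - (s - 1) * mangoldt_series s)"
    by (simp add: DERIV_imp_deriv algebra_simps)
  hence "deriv zeta_reg s / zeta_reg s = (1 - (s - 1) * mangoldt_series s) / (s - 1)"
    using s1 zeta_nonzero[OF assms] by (simp add: zeta_reg_eq[OF assms])
  moreover have "inverse (s - 1) - (1 - (s - 1) * mangoldt_series s) / (s - 1) = mangoldt_series s"
    using s1 by (simp add: field_simps)
  ultimately show ?thesis by simp
qed

text \<open>The limit is 1 from the pole (if u = 0) minus the order of the zero of
  \<open>zeta_reg\<close> there. A zero of zeta on the line would only lower it, and an upper bound
  is all that the 3-4-1 argument asks for.\<close>

lemma mangoldt_limit:
  obtains l :: real where "l \<le> (if u = 0 then 1 else 0)"
    "((\<lambda>x. x * Re (mangoldt_series (1 + \<i> * of_real u + of_real x))) \<longlongrightarrow> l) (at_right 0)"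
proof -
  let ?z = "1 + \<i> * of_real u"
  have "\<exists>w\<in>{s. Re s > 0}. zeta_reg w \<noteq> 0" using zeta_reg_1 by (intro bexI[of _ 1]) auto
  then obtain m :: nat where m: "((\<lambda>x. of_real x * (deriv zeta_reg (?z + of_real x) / zeta_reg (?z + of_real x)))
      \<longlongrightarrow> of_nat m) (at_right 0)" "zeta_reg ?z \<noteq> 0 \<longleftrightarrow> m = 0"
    using logderiv_limit[OF zeta_reg_holomorphic open_Re_gt connected_Re_gt, of ?z] by auto
  have "((\<lambda>x. of_real x * inverse (?z + of_real x - 1) - of_real x * (deriv zeta_reg (?z + of_real x) / zeta_reg (?z + of_real x)))
      \<longlongrightarrow> of_real (if u = 0 then 1 else 0) - of_nat m) (at_right 0)"
  proof (intro tendsto_diff m(1))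
    show "((\<lambda>x. of_real x * inverse (?z + of_real x - 1)) \<longlongrightarrow> of_real (if u = 0 then 1 else 0)) (at_right 0)"
    proof (cases "u = 0")
      case True
      have "\<forall>\<^sub>F x in at_right (0::real). (1::complex) = of_real x * inverse (?z + of_real x - 1)"
        using eventually_at_right_less[of "0::real"] by eventually_elim (simp add: True)
      thus ?thesis using True by (auto intro: Lim_transform_eventually[OF tendsto_const])
    next
      case False
      have "((\<lambda>x. of_real x * inverse (\<i> * of_real u + of_real x)) \<longlongrightarrow> of_real 0 * inverse (\<i> * of_real u + of_real 0)) (at_right 0)"
        using False by (intro tendsto_intros) auto
      thus ?thesis using False by simp
    qed
  qed
  hence "((\<lambda>x. Re (of_real x * inverse (?z + of_real x - 1) - of_real x * (deriv zeta_reg (?z + of_real x) / zeta_reg (?z + of_real x))))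
      \<longlongrightarrow> Re (of_real (if u = 0 then 1 else 0) - of_nat m)) (at_right 0)"
    by (rule tendsto_Re)
  moreover have "\<forall>\<^sub>F x in at_right (0::real). Re (of_real x * inverse (?z + of_real x - 1) - of_real x * (deriv zeta_reg (?z + of_real x) / zeta_reg (?z + of_real x)))
     = x * Re (mangoldt_series (?z + of_real x))"
    using eventually_at_right_less[of "0::real"]
  proof eventually_elim
    case (elim x)
    have "of_real x * inverse (?z + of_real x - 1) - of_real x * (deriv zeta_reg (?z + of_real x) / zeta_reg (?z + of_real x))
        = of_real x * mangoldt_series (?z + of_real x)"
      using elim by (subst mangoldt_zeta_reg) (auto simp: right_diff_distrib)
    thus ?case by simp
  qed
  ultimately have "((\<lambda>x. x * Re (mangoldt_series (?z + of_real x))) \<longlongrightarrow> (if u = 0 then 1 else 0) - real m) (at_right 0)"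
    by (subst (asm) filterlim_cong[OF refl refl]) auto
  thus ?thesis by (rule that[rotated]) simp
qed

section \<open>Taylor coefficients at 1 + \<eta>\<close>

text \<open>Up to the sign (-1)^k this is the k-th Taylor coefficient at 1 + \<eta> of the series of
  f \<Lambda>, i.e. of -L'/L for a completely multiplicative f. Without the sign all coefficients
  for f = 1 are nonnegative sums.\<close>

definition mangoldt_coeff :: "(nat \<Rightarrow> real) \<Rightarrow> real \<Rightarrow> nat \<Rightarrow> real" where
  "mangoldt_coeff f \<eta> k = (\<Sum>n. f n * mangoldt n * ln (real n) ^ k * real n powr (- 1 - \<eta>)) / fact k"

lemma mangoldt_coeff_sums:
  assumes f: "\<And>n. \<bar>f n\<bar> \<le> 1" and \<eta>: "\<eta> > 0"
  shows "(\<lambda>n. f n * mangoldt n * ln (real n) ^ k * real n powr (- 1 - \<eta>)) sums (fact k * mangoldt_coeff f \<eta> k)"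
    and "(deriv ^^ k) (dirichlet_sum (\<lambda>n. of_real (f n) * mangoldt n)) (of_real (1 + \<eta>)) =
         of_real ((-1) ^ k * fact k * mangoldt_coeff f \<eta> k)"
proof -
  let ?a = "\<lambda>n. complex_of_real (f n) * mangoldt n"
  have lb: "log_bounded ?a" using f by (intro log_bounded_mangoldt_mult) simp
  have "(\<lambda>n. ?a n * of_real (ln (real n)) ^ k * of_nat n powr (- of_real (1 + \<eta>))) sums
      dirichlet_sum (\<lambda>n. ?a n * of_real (ln (real n)) ^ k) (of_real (1 + \<eta>))"
    using \<eta> by (intro sums_dirichlet log_bounded_times_ln lb) auto
  moreover have "?a n * of_real (ln (real n)) ^ k * of_nat n powr (- of_real (1 + \<eta>)) =
     of_real (f n * mangoldt n * ln (real n) ^ k * real n powr (- 1 - \<eta>))" for n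
  proof -
    have "complex_of_nat n powr (- of_real (1 + \<eta>)) = of_real (real n powr (- 1 - \<eta>))"
      using powr_of_real[of "real n" "- 1 - \<eta>"] by (simp del: powr_of_real)
    thus ?thesis by simp
  qed
  ultimately have S: "(\<lambda>n. complex_of_real (f n * mangoldt n * ln (real n) ^ k * real n powr (- 1 - \<eta>))) sums
      dirichlet_sum (\<lambda>n. ?a n * of_real (ln (real n)) ^ k) (of_real (1 + \<eta>))" by (simp only:)
  hence "summable (\<lambda>n. f n * mangoldt n * ln (real n) ^ k * real n powr (- 1 - \<eta>))"
    using sums_Re[OF S] by (auto simp: sums_iff)
  thus R: "(\<lambda>n. f n * mangoldt n * ln (real n) ^ k * real n powr (- 1 - \<eta>)) sums (fact k * mangoldt_coeff f \<eta> k)"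
    by (simp add: mangoldt_coeff_def summable_sums)
  show "(deriv ^^ k) (dirichlet_sum ?a) (of_real (1 + \<eta>)) =
         of_real ((-1) ^ k * fact k * mangoldt_coeff f \<eta> k)"
    using sums_unique2[OF S sums_of_real[OF R]] \<eta>
    by (subst dirichlet_sum_higher_deriv[OF lb]) auto
qed

text \<open>The pole term 1/(s-1) contributes \<eta>^(-k-1) exactly; the rest is holomorphic and
  bounded by M near 1, so Cauchy on a disc of radius r costs M / r^k. Both r and M are independent
  of \<eta> and k.\<close>

lemma zeta_coeff_lower:
  obtains r M where "r > 0" "M \<ge> 0"
    "\<And>\<eta> k. 0 < \<eta> \<Longrightarrow> \<eta> \<le> r \<Longrightarrow> mangoldt_coeff (\<lambda>_. 1) \<eta> k \<ge> inverse \<eta> ^ Suc k - M / r ^ k"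
proof -
  let ?H = "{s::complex. Re s > 0}"
  have "continuous (at 1) zeta_reg"
    using holomorphic_on_imp_continuous_on[OF zeta_reg_holomorphic] open_Re_gt[of 0]
    by (auto simp: continuous_on_eq_continuous_at)
  from continuous_at_avoid[OF this, of 0] obtain e where e: "e > 0" "\<And>y. dist 1 y < e \<Longrightarrow> zeta_reg y \<noteq> 0"
    by (auto simp: zeta_reg_1)
  \<comment> \<open>The closed disc of radius 2r around 1 must avoid the zeros of
    \<open>zeta_reg\<close> (2r < e) and stay in Re s \<ge> 1/2. For \<eta> \<le> r it contains the
    disc of radius r around 1 + \<eta>.\<close>
  define r where "r = min (e / 3) (1 / 4)"
  have r: "r > 0" using e by (simp add: r_def)
  have sub: "cball 1 (2 * r) \<subseteq> ?H"
  proof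
    fix z :: complex assume "z \<in> cball 1 (2 * r)"
    hence "\<bar>Re (1 - z)\<bar> \<le> 2 * r" using abs_Re_le_cmod[of "1 - z"] by (simp add: dist_norm)
    also have "2 * r \<le> 1/2" by (simp add: r_def)
    finally show "z \<in> ?H" by (simp add: abs_if split: if_splits)
  qed
  have nz: "zeta_reg z \<noteq> 0" if "z \<in> cball 1 (2 * r)" for z
    using that e by (intro e(2)) (auto simp: r_def min_def split: if_splits)
  let ?w = "\<lambda>s. deriv zeta_reg s / zeta_reg s"
  have dh: "deriv zeta_reg holomorphic_on ?H"
    by (intro holomorphic_deriv zeta_reg_holomorphic open_Re_gt)
  have wh: "?w holomorphic_on cball 1 (2 * r)"
    by (intro holomorphic_intros holomorphic_on_subset[OF zeta_reg_holomorphic sub]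
        holomorphic_on_subset[OF dh sub] nz)
  have "bounded (?w ` cball 1 (2 * r))"
    by (intro compact_imp_bounded compact_continuous_image holomorphic_on_imp_continuous_on wh) auto
  then obtain M where "\<forall>x\<in>?w ` cball 1 (2 * r). norm x \<le> M"
    unfolding bounded_iff by blast
  hence M: "\<And>z. z \<in> cball 1 (2 * r) \<Longrightarrow> norm (?w z) \<le> M" by blast
  have M0: "M \<ge> 0" using order_trans[OF norm_ge_zero M[of 1]] r by simp
  have "mangoldt_coeff (\<lambda>_. 1) \<eta> k \<ge> inverse \<eta> ^ Suc k - M / r ^ k" if \<eta>: "0 < \<eta>" "\<eta> \<le> r" for \<eta> k
  proof -
    define c where "c = complex_of_real (1 + \<eta>)"
    have sub2: "cball c r \<subseteq> cball 1 (2 * r)"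
      using \<eta> r by (auto simp: c_def cball_subset_cball_iff dist_norm)
    have wb: "?w holomorphic_on ball c r"
      using wh sub2 ball_subset_cball by (meson holomorphic_on_subset order_trans)
    have "norm ((deriv ^^ k) ?w c) \<le> fact k * M / r ^ k"
    proof (rule Cauchy_inequality[OF wb _ r])
      show "continuous_on (cball c r) ?w"
        by (intro holomorphic_on_imp_continuous_on holomorphic_on_subset[OF wh sub2])
      show "norm (?w x) \<le> M" if "norm (c - x) = r" for x
        using that sub2 by (intro M) (auto simp: dist_norm)
    qed
    \<comment> \<open>The formula for \<open>mangoldt_series\<close> is available only for Re s > 1,
      so derivatives are compared on this smaller open set around c.\<close>
    let ?T = "ball c r \<inter> {s. Re s > 1}"
    have T: "open ?T" "c \<in> ?T" using r \<eta> by (auto simp: c_def open_Re_gt)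
    have "(deriv ^^ k) mangoldt_series c = (deriv ^^ k) (\<lambda>s. inverse (s - 1) - ?w s) c"
      using T by (intro higher_deriv_transform_within_open[where S = ?T])
        (auto intro!: holomorphic_intros holomorphic_on_subset[OF dirichlet_sum_holomorphic[OF log_bounded_mangoldt]]
          holomorphic_on_subset[OF wb] simp: mangoldt_zeta_reg)
    also have "\<dots> = (deriv ^^ k) (\<lambda>s. inverse (s - 1)) c - (deriv ^^ k) ?w c"
      using T by (intro higher_deriv_diff[where S = ?T])
        (auto intro!: holomorphic_intros holomorphic_on_subset[OF wb])
    also have "(deriv ^^ k) (\<lambda>s. inverse (s - 1)) c = of_real ((-1) ^ k * fact k * inverse \<eta> ^ Suc k)"
      using \<eta> by (subst higher_deriv_inverse_minus) (auto simp: c_def field_simps)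
    finally have "(deriv ^^ k) ?w c = of_real ((-1) ^ k * fact k * inverse \<eta> ^ Suc k) - (deriv ^^ k) mangoldt_series c"
      by simp
    also have "(deriv ^^ k) mangoldt_series c = of_real ((-1) ^ k * fact k * mangoldt_coeff (\<lambda>_. 1) \<eta> k)"
      using mangoldt_coeff_sums(2)[of "\<lambda>_. 1" \<eta> k] \<eta> by (simp add: c_def)
    finally have "(deriv ^^ k) ?w c = of_real ((-1) ^ k * fact k * (inverse \<eta> ^ Suc k - mangoldt_coeff (\<lambda>_. 1) \<eta> k))"
      by (simp add: algebra_simps)
    hence "norm ((deriv ^^ k) ?w c) = fact k * \<bar>inverse \<eta> ^ Suc k - mangoldt_coeff (\<lambda>_. 1) \<eta> k\<bar>"
      by (simp only: norm_of_real abs_mult power_abs) simp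
    with \<open>norm ((deriv ^^ k) ?w c) \<le> fact k * M / r ^ k\<close>
    have "fact k * \<bar>inverse \<eta> ^ Suc k - mangoldt_coeff (\<lambda>_. 1) \<eta> k\<bar> \<le> fact k * (M / r ^ k)" by simp
    hence "\<bar>inverse \<eta> ^ Suc k - mangoldt_coeff (\<lambda>_. 1) \<eta> k\<bar> \<le> M / r ^ k"
      by (rule mult_left_le_imp_le) simp
    thus ?thesis by linarith
  qed
  thus ?thesis using that r M0 by blast
qed

section \<open>Real characters under ERH\<close>

locale real_character =
  fixes q :: nat and X :: "nat \<Rightarrow> real"
  assumes char: "dirichlet_character q (\<lambda>n. of_real (X n))"
    and vals: "X n \<in> {-1, 0, 1}"
    and nonprincipal: "\<exists>n. X n = -1"
begin

lemma q_pos: "q > 0" using char by (simp add: dirichlet_character_def)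

lemma mult: "X (a * b) = X a * X b"
proof -
  have "complex_of_real (X (a * b)) = of_real (X a) * of_real (X b)"
    using char unfolding dirichlet_character_def by blast
  thus ?thesis by (simp flip: of_real_mult)
qed

lemma periodic: "X (a + q) = X a"
  using char unfolding dirichlet_character_def by (metis of_real_eq_iff)

lemma nonzero_iff: "X a \<noteq> 0 \<longleftrightarrow> coprime a q"
  using char unfolding dirichlet_character_def by (metis of_real_eq_0_iff)

lemma abs_le_1: "\<bar>X n\<bar> \<le> 1" using vals[of n] by auto

lemma X_1: "X 1 = 1"
  using mult[of 1 1] nonzero_iff[of 1] by simp

text \<open>Only modulus 1 could give a nonzero value at 0, and there periodicity makes the
  character constantly 1, against the value -1.\<close>

lemma X_0: "X 0 = 0"
proof (rule ccontr)
  assume "X 0 \<noteq> 0"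
  hence "q = 1" using nonzero_iff[of 0] by simp
  hence "X (Suc n) = X n" for n using periodic[of n] by simp
  hence c: "X n = X 0" for n by (induction n) auto
  obtain n where "X n = -1" using nonprincipal by blast
  thus False using c[of n] c[of 1] X_1 by simp
qed

lemma periodic_mult: "X (a + k * q) = X a"
  by (induction k) (use periodic in \<open>auto simp: algebra_simps\<close>, metis add.assoc add.commute)

lemma X_mod: "X (a mod q) = X a"
  using periodic_mult[of "a mod q" "a div q"] by (simp add: mult.commute)

text \<open>Multiplication by b with \<open>X b = -1\<close> permutes the residues and negates the
  sum.\<close>

lemma sum_period: "(\<Sum>n<q. X n) = 0"
proof -
  obtain b where b: "X b = -1" using nonprincipal by blast
  hence cb: "coprime b q" using nonzero_iff[of b] by simp
  let ?f = "\<lambda>a. (b * a) mod q"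
  have inj: "inj_on ?f {..<q}"
  proof (rule inj_onI)
    fix x y assume xy: "x \<in> {..<q}" "y \<in> {..<q}" "?f x = ?f y"
    hence "[b * x = b * y] (mod q)" by (simp add: Cong.cong_def)
    hence "[x = y] (mod q)" using cb by (simp add: cong_mult_lcancel_nat)
    thus "x = y" using xy by (simp add: Cong.cong_def)
  qed
  have "?f ` {..<q} = {..<q}"
    using q_pos by (intro endo_inj_surj inj) auto
  hence "(\<Sum>n<q. X n) = (\<Sum>n<q. X (?f n))"
    using sum.reindex[OF inj, of X] by simp
  also have "\<dots> = (\<Sum>n<q. - X n)" by (simp add: X_mod mult b)
  finally show ?thesis by (simp add: sum_negf)
qed

definition psum :: "nat \<Rightarrow> real" where "psum n = (\<Sum>i<n. X i)"

lemma psum_add_q: "psum (n + q) = psum n"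
  by (induction n) (simp_all add: psum_def sum_period periodic)

lemma abs_psum_le: "\<bar>psum n\<bar> \<le> real q"
proof (induction n rule: less_induct)
  case (less n)
  show ?case
  proof (cases "n < q")
    case True
    have "\<bar>psum n\<bar> \<le> (\<Sum>i<n. \<bar>X i\<bar>)" unfolding psum_def by (rule sum_abs)
    also have "\<dots> \<le> (\<Sum>i<n. 1)" by (intro sum_mono abs_le_1)
    finally show ?thesis using True by simp
  next
    case False
    thus ?thesis using less.IH[of "n - q"] q_pos psum_add_q[of "n - q"] by simp
  qed
qed

text \<open>Partial summation continues the \<open>L\<close>-series to \<open>Re s > 0\<close>.\<close>

definition Lterm :: "nat \<Rightarrow> complex \<Rightarrow> complex" where
  "Lterm n s = of_real (psum (Suc (Suc n))) * (of_nat (Suc n) powr (- s) - of_nat (Suc (Suc n)) powr (- s))"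

definition L :: "complex \<Rightarrow> complex" where "L s = (\<Sum>n. Lterm n s)"

lemma Lterm_bound:
  assumes "Re s > 0"
  shows "norm (Lterm n s) \<le> (real q * norm s) * real (Suc n) powr (- 1 - Re s)"
proof -
  have "norm (complex_of_nat (Suc n) powr (- s) - of_nat (Suc (Suc n)) powr (- s)) \<le> norm s * real (Suc n) powr (- 1 - Re s)"
    using powr_diff_bound[of "real (Suc n)" "real (Suc (Suc n))" s] assms by simp
  hence "norm (Lterm n s) \<le> real q * (norm s * real (Suc n) powr (- 1 - Re s))"
    unfolding Lterm_def norm_mult using abs_psum_le by (intro mult_mono) auto
  thus ?thesis by (simp add: mult_ac)
qed

lemma Lterm_holomorphic: "Lterm n holomorphic_on A"
  unfolding Lterm_def by (auto intro!: holomorphic_intros simp del: of_nat_Suc)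

lemma mono_q: "mono (\<lambda>r. real q * r)"
  by (intro monoI mult_left_mono) auto

lemma L_holomorphic: "L holomorphic_on {s. Re s > 0}"
  using series_right_half_plane(1)[where h = Lterm and K = "\<lambda>r. real q * r", OF Lterm_holomorphic Lterm_bound mono_q]
  by (simp add: L_def[abs_def])

text \<open>Abel summation: \<open>psum (Suc N)\<close> is the sum of X over 1 to N because
  \<open>X 0 = 0\<close>, and the boundary term tends to 0 since \<open>psum\<close> is bounded by
  q.\<close>

lemma L_eq:
  assumes s: "Re s > 1"
  shows "L s = dirichlet_sum (\<lambda>n. of_real (X n)) s"
    and "(\<lambda>n. of_real (X (Suc n)) / of_nat (Suc n) powr s) sums L s"
proof -
  have lb: "log_bounded (\<lambda>n. complex_of_real (X n))"
    using abs_le_1 by (intro log_bounded_le_1) simp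
  have part: "(\<Sum>n<N. Lterm n s) = (\<Sum>n<N. of_real (X (Suc n)) * of_nat (Suc n) powr (- s))
       - of_real (psum (Suc N)) * of_nat (Suc N) powr (- s)" for N
  proof (induction N)
    case 0 show ?case by (simp add: psum_def X_0)
  next
    case (Suc N)
    have "psum (Suc (Suc N)) = psum (Suc N) + X (Suc N)" by (simp add: psum_def)
    thus ?case using Suc by (simp add: Lterm_def algebra_simps del: of_nat_Suc)
  qed
  have a: "(\<lambda>n. of_real (X (Suc n)) * of_nat (Suc n) powr (- s)) sums dirichlet_sum (\<lambda>n. of_real (X n)) s"
    using sums_dirichlet[OF lb s] by (subst sums_Suc_iff) (simp add: X_0)
  have "(\<lambda>N. of_real (psum (Suc N)) * of_nat (Suc N) powr (- s) :: complex) \<longlonglongrightarrow> 0"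
  proof (rule Lim_null_comparison)
    have "(\<lambda>N. real q * norm (of_nat (Suc N) powr (- s) :: complex)) \<longlonglongrightarrow> real q * norm (0 :: complex)"
      using s by (intro tendsto_intros tendsto_nat_powr_0) auto
    thus "(\<lambda>N. real q * norm (of_nat (Suc N) powr (- s) :: complex)) \<longlonglongrightarrow> 0" by simp
    show "\<forall>\<^sub>F N in sequentially. norm (of_real (psum (Suc N)) * of_nat (Suc N) powr (- s) :: complex)
        \<le> real q * norm (of_nat (Suc N) powr (- s) :: complex)"
      unfolding norm_mult using abs_psum_le by (intro always_eventually allI mult_right_mono) auto
  qed
  from tendsto_diff[OF a[unfolded sums_def] this]
  have "(\<lambda>n. Lterm n s) sums dirichlet_sum (\<lambda>n. of_real (X n)) s"
    by (simp add: sums_def part)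
  thus eq: "L s = dirichlet_sum (\<lambda>n. of_real (X n)) s" by (simp add: L_def sums_iff)
  show "(\<lambda>n. of_real (X (Suc n)) / of_nat (Suc n) powr s) sums L s"
    using a by (simp add: eq powr_minus divide_inverse)
qed

lemma is_L: "is_L_function (\<lambda>n. of_real (X n)) L"
  unfolding is_L_function_def
  using L_eq(2) holomorphic_on_subset[OF L_holomorphic, of "{s. Re s > 0} - {1}"] by auto

lemma L_bound:
  assumes "Re s \<ge> 1/2"
  shows "norm (L s) \<le> real q * norm s * (\<Sum>n. real (Suc n) powr (- 3/2))"
  using series_right_half_plane(3)[where h = Lterm and K = "\<lambda>r. real q * r" and s = s,
      OF Lterm_holomorphic Lterm_bound mono_q assms]
  by (simp add: L_def)

abbreviation G :: "complex \<Rightarrow> complex" where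
  "G \<equiv> dirichlet_sum (\<lambda>n. of_real (X n) * mangoldt n)"

text \<open>The lower bound is expressed by zeta data at \<sigma> alone. At 1 + \<eta> with fixed
  \<eta> it is a constant, so q enters \<open>coeff_upper\<close> only through the upper bound for
  L.\<close>

lemma L_lower:
  assumes "\<sigma> > 1" "Re s \<ge> \<sigma>" "\<sigma> \<le> 2"
  shows "norm (L s) \<ge> exp (- Re (mangoldt_series (of_real \<sigma>)) * norm (s - 2)) / 4"
  using dirichlet_sum_nonzero[of "\<lambda>n. of_real (X n)" \<sigma> s] assms abs_le_1 mult X_1 L_eq(1)[of s] by simp

lemma L_nonzero: assumes "Re s > 1" shows "L s \<noteq> 0"
proof -
  have "norm (L s) \<ge> exp (- Re (mangoldt_series (of_real (min 2 (Re s)))) * norm (s - 2)) / 4"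
    using assms by (intro L_lower) auto
  thus ?thesis by (smt (verit) divide_pos_pos exp_gt_zero norm_zero)
qed

lemma L_deriv:
  assumes "Re s > 1" shows "deriv L s = - (L s * G s)"
proof -
  have "(dirichlet_sum (\<lambda>n. of_real (X n)) has_field_derivative
          - (dirichlet_sum (\<lambda>n. of_real (X n)) s * G s)) (at s)"
    using assms abs_le_1 mult by (intro mangoldt_logderiv) auto
  hence "(L has_field_derivative - (dirichlet_sum (\<lambda>n. of_real (X n)) s * G s)) (at s)"
    by (rule has_field_derivative_transform_within_open[OF _ open_Re_gt[of 1]]) (use assms L_eq in auto)
  thus ?thesis using L_eq(1)[OF assms] by (simp add: DERIV_imp_deriv)
qed

section \<open>Zeros of L with Re s > 1/2\<close>

text \<open>The square of X is the principal character, and zeta stands in for its L-function. Where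
  X n is +-1 this is 2 (1 +- cos)^2; where X n = 0 the middle term is absent and 3 + cos of the
  double angle is positive by itself.\<close>

lemma three_four_one:
  assumes "\<sigma> > 1"
  shows "3 * Re (mangoldt_series (of_real \<sigma>)) + 4 * Re (G (of_real \<sigma> + \<i> * of_real t))
     + Re (mangoldt_series (of_real \<sigma> + \<i> * of_real (2 * t))) \<ge> 0"
proof -
  have S: "(\<lambda>n. Re (f n * mangoldt n * of_nat n powr (- s))) sums Re (dirichlet_sum (\<lambda>n. f n * mangoldt n) s)"
    if "\<And>n. norm (f n) \<le> 1" "Re s > 1" for f :: "nat \<Rightarrow> complex" and s
    by (intro sums_Re sums_dirichlet log_bounded_mangoldt_mult that)
  have "(\<lambda>n. 3 * Re (1 * mangoldt n * of_nat n powr (- of_real \<sigma>))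
     + 4 * Re (of_real (X n) * mangoldt n * of_nat n powr (- (of_real \<sigma> + \<i> * of_real t)))
     + Re (1 * mangoldt n * of_nat n powr (- (of_real \<sigma> + \<i> * of_real (2 * t))))) sums
     (3 * Re (dirichlet_sum (\<lambda>n. 1 * mangoldt n) (of_real \<sigma>)) + 4 * Re (G (of_real \<sigma> + \<i> * of_real t))
     + Re (dirichlet_sum (\<lambda>n. 1 * mangoldt n) (of_real \<sigma> + \<i> * of_real (2 * t))))" (is "?f sums ?s")
    using assms abs_le_1 by (intro sums_add sums_mult S) auto
  moreover have "?f n \<ge> 0" for n
  proof (cases "n = 0")
    case False
    define c where "c = cos (t * ln (real n))"
    define p where "p = real n powr (- \<sigma>)"
    have pw: "Re (of_nat n powr (- (of_real \<sigma> + \<i> * of_real u))) = p * cos (u * ln (real n))" for u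
    proof -
      have "complex_of_nat n powr (- (of_real \<sigma> + \<i> * of_real u)) = exp (- (of_real \<sigma> + \<i> * of_real u) * of_real (ln (real n)))"
        using False Ln_of_real[of "real n"] by (simp add: powr_def)
      thus ?thesis using False by (simp add: p_def powr_def Re_exp mult.commute)
    qed
    have 0: "Re (of_nat n powr (- of_real \<sigma>)) = p" using pw[of 0] by simp
    have M: "Re (of_real r * mangoldt n * w) = r * mangoldt n * Re w" for r w
      by simp
    have "?f n = mangoldt n * p * (3 + 4 * X n * c + cos (2 * (t * ln (real n))))"
      using M[of 1] M[of "X n"] unfolding pw 0 of_real_1
      by (simp only: pw 0 c_def) (simp add: algebra_simps)
    also have "cos (2 * (t * ln (real n))) = 2 * c\<^sup>2 - 1" by (simp add: c_def cos_double_cos)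
    also have "3 + 4 * X n * c + (2 * c\<^sup>2 - 1) \<ge> 0"
    proof -
      have "X n = 1 \<or> X n = -1 \<or> X n = 0" using vals[of n] by auto
      moreover have "3 + 4 * c + (2 * c\<^sup>2 - 1) = 2 * (1 + c)\<^sup>2" "3 - 4 * c + (2 * c\<^sup>2 - 1) = 2 * (1 - c)\<^sup>2"
          "3 + (2 * c\<^sup>2 - 1) = 2 + 2 * c\<^sup>2"
        by (simp_all add: power2_eq_square algebra_simps)
      moreover have "0 \<le> (1 + c)\<^sup>2" "0 \<le> (1 - c)\<^sup>2" "0 \<le> c\<^sup>2" by simp_all
      ultimately show ?thesis by (elim disjE) simp_all
    qed
    hence "mangoldt n * p * (3 + 4 * X n * c + (2 * c\<^sup>2 - 1)) \<ge> 0"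
      by (intro mult_nonneg_nonneg) (auto simp: mangoldt_nonneg p_def)
    finally show ?thesis .
  qed simp
  ultimately have "?s \<ge> 0" using sums_le[OF _ sums_zero, of ?f ?s] by blast
  thus ?thesis by simp
qed

text \<open>Multiply the inequality at \<sigma> = 1 + x by x and let x tend to 0 from the right: 3 l
  - 4 m + l' \<ge> 0, where m is the order of the zero of L at 1 + it and l, l' bound the pole
  contributions of zeta.\<close>

lemma L_line:
  shows "t \<noteq> 0 \<Longrightarrow> L (1 + \<i> * of_real t) \<noteq> 0" and "L 1 = 0 \<Longrightarrow> deriv L 1 \<noteq> 0"
proof -
  have *: "(t \<noteq> 0 \<longrightarrow> L (1 + \<i> * of_real t) \<noteq> 0) \<and> (t = 0 \<and> L 1 = 0 \<longrightarrow> deriv L 1 \<noteq> 0)" for t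
  proof -
    let ?z = "1 + \<i> * of_real t"
    have "\<exists>w\<in>{s. Re s > 0}. L w \<noteq> 0" using L_nonzero[of 2] by (intro bexI[of _ 2]) auto
    then obtain m :: nat where m: "L ?z \<noteq> 0 \<longleftrightarrow> m = 0" "m = 1 \<Longrightarrow> deriv L ?z \<noteq> 0"
      "((\<lambda>x. of_real x * (deriv L (?z + of_real x) / L (?z + of_real x))) \<longlongrightarrow> of_nat m) (at_right 0)"
      using logderiv_limit[OF L_holomorphic open_Re_gt connected_Re_gt, of ?z] by auto
    have "\<forall>\<^sub>F x in at_right (0::real). Re (of_real x * (deriv L (?z + of_real x) / L (?z + of_real x)))
       = - (x * Re (G (?z + of_real x)))"
      using eventually_at_right_less[of "0::real"]
    proof eventually_elim
      case (elim x)
      hence "deriv L (?z + of_real x) / L (?z + of_real x) = - G (?z + of_real x)"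
        using L_nonzero[of "?z + of_real x"] L_deriv[of "?z + of_real x"] by simp
      thus ?case by simp
    qed
    from Lim_transform_eventually[OF tendsto_Re[OF m(3)] this]
    have "((\<lambda>x. - (x * Re (G (?z + of_real x)))) \<longlongrightarrow> real m) (at_right 0)" by simp
    from tendsto_minus[OF this]
    have lG: "((\<lambda>x. x * Re (G (?z + of_real x))) \<longlongrightarrow> - real m) (at_right 0)" by simp
    obtain l where l: "l \<le> 1" "((\<lambda>x. x * Re (mangoldt_series (1 + \<i> * of_real 0 + of_real x))) \<longlongrightarrow> l) (at_right 0)"
      using mangoldt_limit[of 0] by auto
    obtain l' where l': "l' \<le> (if t = 0 then 1 else 0)"
      "((\<lambda>x. x * Re (mangoldt_series (1 + \<i> * of_real (2 * t) + of_real x))) \<longlongrightarrow> l') (at_right 0)"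
      using mangoldt_limit[of "2 * t"] by auto
    have "((\<lambda>x. 3 * (x * Re (mangoldt_series (1 + \<i> * of_real 0 + of_real x))) + 4 * (x * Re (G (?z + of_real x)))
       + x * Re (mangoldt_series (1 + \<i> * of_real (2 * t) + of_real x))) \<longlongrightarrow> 3 * l + 4 * (- real m) + l') (at_right 0)"
      by (intro tendsto_intros lG l(2) l'(2))
    moreover have "\<forall>\<^sub>F x in at_right (0::real). 0 \<le> 3 * (x * Re (mangoldt_series (1 + \<i> * of_real 0 + of_real x))) + 4 * (x * Re (G (?z + of_real x)))
       + x * Re (mangoldt_series (1 + \<i> * of_real (2 * t) + of_real x))"
      using eventually_at_right_less[of "0::real"]
    proof eventually_elim
      case (elim x)
      have e: "1 + \<i> * of_real u + of_real x = of_real (1 + x) + \<i> * of_real u" for u by simp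
      have "0 \<le> x * (3 * Re (mangoldt_series (of_real (1 + x))) + 4 * Re (G (of_real (1 + x) + \<i> * of_real t))
         + Re (mangoldt_series (of_real (1 + x) + \<i> * of_real (2 * t))))"
        using elim three_four_one[of "1 + x" t] by (intro mult_nonneg_nonneg) auto
      thus ?case unfolding e by (simp add: algebra_simps)
    qed
    ultimately have "0 \<le> 3 * l + 4 * (- real m) + l'"
      by (intro tendsto_lowerbound) auto
    \<comment> \<open>For t = 0 both zeta terms may have a pole, so 4m \<le> 3 + 1 and a simple zero
      survives; for nonzero t the second is at most 0, so 4m \<le> 3 and m = 0.\<close>
    hence "real m \<le> (if t = 0 then 1 else 3/4)" using l(1) l'(1) by (auto split: if_splits)
    hence "m \<le> 1" "t \<noteq> 0 \<Longrightarrow> m = 0" by (auto split: if_splits)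
    thus ?thesis using m(1,2) by (cases m) auto
  qed
  show "t \<noteq> 0 \<Longrightarrow> L (1 + \<i> * of_real t) \<noteq> 0" "L 1 = 0 \<Longrightarrow> deriv L 1 \<noteq> 0"
    using *[of t] *[of 0] by auto
qed

text \<open>ERH treats Re s < 1, absolute convergence treats Re s > 1, and the line in between is
  \<open>L_line\<close>.\<close>

lemma L_zeros:
  assumes erh: extended_riemann_hypothesis and s: "Re s > 1/2" "L s = 0"
  shows "s = 1"
proof (cases "Re s < 1")
  case True
  have "dirichlet_character q (\<lambda>n. of_real (X n)) \<and> is_L_function (\<lambda>n. of_real (X n)) L \<and>
        0 < Re s \<and> Re s < 1 \<and> L s = 0"
    using True s char is_L by simp
  hence "Re s = 1/2" using erh unfolding extended_riemann_hypothesis_def by blast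
  thus ?thesis using s by simp
next
  case False
  hence "Re s = 1" using L_nonzero[of s] s by force
  hence "s = 1 + \<i> * of_real (Im s)" by (simp add: complex_eq_iff)
  thus ?thesis using L_line(1)[of "Im s"] s by (metis add_0_right mult_zero_right of_real_0)
qed

text \<open>ERH as stated says nothing about zeros on the line \<open>Re s = 1\<close>. A simple zero at 1 itself is not excluded
  here: after dividing it out it contributes a negative term \<open>-\<eta>\<^bsup>-k-1\<^esup>\<close>, which only helps the upper bound.\<close>

lemma coeff_upper:
  fixes \<eta> :: real and k :: nat
  defines "S \<equiv> (\<Sum>n. real (Suc n) powr (- 3/2))" and "D \<equiv> Re (mangoldt_series (of_real (1 + \<eta>)))"
  assumes erh: extended_riemann_hypothesis and \<eta>: "0 < \<eta>" "\<eta> \<le> 1/16"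
  shows "mangoldt_coeff X \<eta> k \<le> 2 * real (k + 1) * 4 ^ (k + 1) * (ln (real q) + (ln (8 * S) + D + ln 4 + 1))"
proof -
  define c where "c = complex_of_real (1 + \<eta>)"
  \<comment> \<open>Centre 1 + \<eta> and radius 1/2 keep the disc strictly inside Re s > 1/2, where
    1 is the only possible zero of L.\<close>
  let ?B = "ball c (1/2)"
  have S1: "S \<ge> 1"
  proof -
    have sm: "summable (\<lambda>n. real (Suc n) powr (- 3/2))"
      using summable_real_powr_iff[of "-3/2"] by (subst summable_Suc_iff) auto
    have "(\<Sum>n\<in>{0}. real (Suc n) powr (- 3/2)) \<le> S"
      unfolding S_def by (intro sum_le_suminf sm) auto
    thus ?thesis by simp
  qed
  have D0: "D \<ge> 0"
    using norm_dirichlet_sum_le[of mangoldt mangoldt "1 + \<eta>" "of_real (1 + \<eta>)"] \<eta>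
    by (auto simp: D_def log_bounded_mangoldt intro: order_trans[OF norm_ge_zero])
  have q1: "real q \<ge> 1" using q_pos by simp
  have Bre: "Re z > 1/2 + \<eta>" "norm z \<le> 2" if "z \<in> ?B" for z
  proof -
    have "\<bar>Re (c - z)\<bar> < 1/2" "norm (c - z) < 1/2"
      using that abs_Re_le_cmod[of "c - z"] by (auto simp: dist_norm)
    moreover have "norm z \<le> norm c + norm (c - z)"
      using norm_triangle_ineq4[of c "c - z"] by simp
    moreover have "norm c = 1 + \<eta>" unfolding c_def norm_of_real using \<eta> by simp
    ultimately show "Re z > 1/2 + \<eta>" "norm z \<le> 2" using \<eta> by (auto simp: c_def abs_if split: if_splits)
  qed
  have LB: "norm (L z) \<le> 2 * real q * S" if "Re z \<ge> 1/2" "norm z \<le> 2" for z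
  proof -
    have "norm (L z) \<le> real q * norm z * S" unfolding S_def by (rule L_bound[OF that(1)])
    also have "\<dots> \<le> real q * 2 * S" using that S1 by (intro mult_right_mono mult_left_mono) auto
    finally show ?thesis by simp
  qed
  \<comment> \<open>j is the order of the zero at 1. The factor 8 comes from dividing 2 q S by a
    distance of at least 1/4 from 1; closer to 1 the maximum principle carries the bound inwards
    from the circle of radius 1/4.\<close>
  obtain H j where H: "H holomorphic_on ?B" "\<And>z. z \<in> ?B \<Longrightarrow> L z = (z - 1) ^ j * H z"
      "\<And>z. z \<in> ?B \<Longrightarrow> H z \<noteq> 0" "\<And>z. z \<in> ?B \<Longrightarrow> norm (H z) \<le> 8 * real q * S" "j \<le> (1::nat)"
  proof (cases "L 1 = 0")
    case False
    show ?thesis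
    proof (rule that[of L 0])
      show "L holomorphic_on ?B" using Bre \<eta> by (intro holomorphic_on_subset[OF L_holomorphic]) force
      fix z assume z: "z \<in> ?B"
      show "L z \<noteq> 0" using L_zeros[OF erh, of z] Bre[OF z] False \<eta> by auto
      show "norm (L z) \<le> 8 * real q * S"
      proof (rule order_trans[OF LB])
        show "2 * real q * S \<le> 8 * real q * S" using S1 by (intro mult_right_mono) auto
      qed (use Bre[OF z] \<eta> in auto)
    qed auto
  next
    case True
    define H where "H = (\<lambda>z. if z = 1 then deriv L 1 else (L z - L 1) / (z - 1))"
    have hol: "H holomorphic_on {s. Re s > 0}"
      unfolding H_def by (intro pole_lemma L_holomorphic) (simp add: interior_open open_Re_gt)
    have far: "norm (H z) \<le> 8 * real q * S" if "norm (z - 1) \<ge> 1/4" "Re z \<ge> 1/2" "norm z \<le> 2" for z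
    proof -
      have "norm (H z) = norm (L z) / norm (z - 1)"
        using that True by (auto simp: H_def norm_divide)
      also have "\<dots> \<le> (2 * real q * S) / (1/4)"
        using that LB[of z] S1 by (intro frac_le) auto
      finally show ?thesis by simp
    qed
    show ?thesis
    proof (rule that[of H 1])
      show "H holomorphic_on ?B" using Bre \<eta> by (intro holomorphic_on_subset[OF hol]) force
      fix z assume z: "z \<in> ?B"
      show "L z = (z - 1) ^ 1 * H z" using True by (simp add: H_def)
      show "H z \<noteq> 0"
        using L_zeros[OF erh, of z] Bre[OF z] True L_line(2) \<eta> by (auto simp: H_def)
      show "norm (H z) \<le> 8 * real q * S"
      proof (cases "norm (z - 1) \<ge> 1/4")
        case True
        thus ?thesis using far[of z] Bre[OF z] \<eta> by auto
      next
        case False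
        have sub: "cball 1 (1/4) \<subseteq> {s. Re s \<ge> 1/2 \<and> norm s \<le> 2}"
        proof
          fix w :: complex assume "w \<in> cball 1 (1/4)"
          hence "norm (1 - w) \<le> 1/4" by (simp add: dist_norm)
          thus "w \<in> {s. Re s \<ge> 1/2 \<and> norm s \<le> 2}"
            using abs_Re_le_cmod[of "1 - w"] norm_triangle_ineq4[of 1 "1 - w"] by auto
        qed
        show ?thesis
        proof (rule maximum_modulus_frontier[of H "ball 1 (1/4)"])
          show "H holomorphic_on interior (ball 1 (1/4))"
          proof (rule holomorphic_on_subset[OF hol])
            have "interior (ball (1::complex) (1/4)) \<subseteq> cball 1 (1/4)" by (simp add: interior_open ball_subset_cball)
            also have "\<dots> \<subseteq> {s. Re s > 0}" using sub by force
            finally show "interior (ball (1::complex) (1/4)) \<subseteq> {s. Re s > 0}" .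
          qed
          show "continuous_on (closure (ball 1 (1/4))) H"
            using sub by (intro holomorphic_on_imp_continuous_on holomorphic_on_subset[OF hol]) force
          show "norm (H w) \<le> 8 * real q * S" if "w \<in> frontier (ball 1 (1/4))" for w
          proof -
            have "norm (w - 1) = 1/4" using that by (simp add: dist_norm norm_minus_commute)
            moreover have "w \<in> cball 1 (1/4)" using that by simp
            ultimately show ?thesis using sub by (intro far) auto
          qed
          show "z \<in> ball 1 (1/4)" using False by (simp add: dist_norm norm_minus_commute)
        qed auto
      qed
    qed auto
  qed
  have cB: "c \<in> ?B" by simp
  obtain g where g: "g holomorphic_on ?B" "\<And>z. z \<in> ?B \<Longrightarrow> exp (g z) = H z"
    using holomorphic_logarithm_exists[OF convex_ball open_ball H(1) H(3) cB] by blast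
  have Reg: "Re (g z) = ln (norm (H z))" if "z \<in> ?B" for z
    using g(2)[OF that] by (metis ln_exp norm_exp_eq_Re)
  \<comment> \<open>ln q + ln(8S) bounds ln |H| from above on the disc, -D - ln 4 bounds it from
    below at the centre, and the final 1 makes the inequality strict.\<close>
  define A where "A = ln (real q) + (ln (8 * S) + D + ln 4 + 1)"
  have "norm (H c) \<ge> exp (- D) / 4"
  proof -
    have "norm (L c) \<le> norm (H c)"
    proof -
      have "norm ((c - 1) ^ j) \<le> 1"
        using \<eta> by (simp add: c_def norm_power power_le_one)
      thus ?thesis using H(2)[OF cB] mult_right_mono[of "norm ((c - 1) ^ j)" 1 "norm (H c)"]
        by (simp add: norm_mult)
    qed
    moreover have "norm (L c) \<ge> exp (- D * norm (c - 2)) / 4"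
      unfolding D_def using \<eta> by (intro L_lower) (auto simp: c_def)
    moreover have "norm (c - 2) \<le> 1"
    proof -
      have "c - 2 = of_real (\<eta> - 1)" by (simp add: c_def)
      hence "norm (c - 2) = \<bar>\<eta> - 1\<bar>" by (simp only: norm_of_real)
      thus ?thesis using \<eta> by simp
    qed
    hence "D * norm (c - 2) \<le> D * 1" using D0 by (intro mult_left_mono)
    hence "exp (- D) \<le> exp (- D * norm (c - 2))" by simp
    ultimately show ?thesis by linarith
  qed
  hence "ln (exp (- D) / 4) \<le> ln (norm (H c))" by (subst ln_le_cancel_iff) (auto simp: H(3)[OF cB])
  hence g0: "Re (g c) \<ge> - D - ln 4" using Reg[OF cB] by (simp add: ln_div)
  have gA: "Re (g z) - Re (g c) < A" if z: "z \<in> ?B" for z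
  proof -
    have "ln (norm (H z)) \<le> ln (8 * real q * S)"
      using H(3,4)[OF z] q1 S1 by (subst ln_le_cancel_iff) auto
    also have "\<dots> = ln (real q) + ln (8 * S)"
      using ln_mult[of "real q" "8 * S"] q1 S1 by (simp add: mult_ac)
    finally show ?thesis using Reg[OF z] g0 by (simp add: A_def)
  qed
  have bc: "norm (g z - g c) \<le> 2 * A" if "norm (z - c) \<le> 1/4" for z
    using borel_caratheodory_half[OF g(1) _ gA, of z] that by simp
  have gsub: "cball c (1/4) \<subseteq> ?B" by (auto simp: subset_eq)
  have ghol: "(\<lambda>z. g z - g c) holomorphic_on ?B" by (intro holomorphic_intros g)
  \<comment> \<open>The logarithmic derivative is the derivative of g, so its k-th Taylor
    coefficient needs k + 1 derivatives of g; hence the factors k + 1 and 4^(k+1).\<close>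
  have ci: "norm ((deriv ^^ Suc k) (\<lambda>z. g z - g c) c) \<le> fact (Suc k) * (2 * A) / (1/4) ^ Suc k"
  proof (rule Cauchy_inequality)
    show "(\<lambda>z. g z - g c) holomorphic_on ball c (1/4)"
      using gsub ball_subset_cball by (intro holomorphic_on_subset[OF ghol]) auto
    show "continuous_on (cball c (1/4)) (\<lambda>z. g z - g c)"
      by (intro holomorphic_on_imp_continuous_on holomorphic_on_subset[OF ghol gsub])
    show "norm (g x - g c) \<le> 2 * A" if "norm (c - x) = 1/4" for x
      using that by (intro bc) (simp add: norm_minus_commute)
  qed auto
  let ?T = "?B \<inter> {s. Re s > 1}"
  have T: "open ?T" "c \<in> ?T" using \<eta> by (auto simp: open_Re_gt c_def)
  have lbG: "log_bounded (\<lambda>n. of_real (X n) * mangoldt n)"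
    using abs_le_1 by (intro log_bounded_mangoldt_mult) simp
  have Ghol: "G holomorphic_on ?T"
    by (rule holomorphic_on_subset[OF dirichlet_sum_holomorphic[OF lbG]]) auto
  have ihol: "(\<lambda>s. of_nat j * inverse (s - 1)) holomorphic_on ?T"
    by (intro holomorphic_intros) auto
  have dg: "deriv (\<lambda>z. g z - g c) z = - G z - of_nat j * inverse (z - 1)" if z: "z \<in> ?T" for z
  proof -
    have zB: "z \<in> ?B" and z1: "Re z > 1" "z \<noteq> 1" using z by auto
    have gd: "(g has_field_derivative deriv g z) (at z)"
      using holomorphic_derivI[OF g(1) open_ball zB] .
    have "((\<lambda>z. (z - 1) ^ j * exp (g z)) has_field_derivative
        of_nat j * (z - 1) ^ (j - 1) * exp (g z) + (z - 1) ^ j * (exp (g z) * deriv g z)) (at z)"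
      by (auto intro!: derivative_eq_intros gd)
    hence "(L has_field_derivative
        of_nat j * (z - 1) ^ (j - 1) * exp (g z) + (z - 1) ^ j * (exp (g z) * deriv g z)) (at z)"
      by (rule has_field_derivative_transform_within_open[OF _ open_ball zB]) (simp add: H(2) g(2))
    hence "deriv L z = of_nat j * (z - 1) ^ (j - 1) * H z + (z - 1) ^ j * (H z * deriv g z)"
      using g(2)[OF zB] by (simp add: DERIV_imp_deriv)
    hence "(z - 1) ^ j * H z * (- G z) = of_nat j * (z - 1) ^ (j - 1) * H z + (z - 1) ^ j * (H z * deriv g z)"
      using L_deriv[OF z1(1)] H(2)[OF zB] by simp
    moreover have "of_nat j * (z - 1) ^ (j - 1) * H z = (z - 1) ^ j * H z * (of_nat j * inverse (z - 1))"
      using z1 by (cases j) auto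
    ultimately have "(z - 1) ^ j * H z * (- G z) = (z - 1) ^ j * H z * (of_nat j * inverse (z - 1) + deriv g z)"
      by (simp add: algebra_simps)
    hence "- G z = of_nat j * inverse (z - 1) + deriv g z"
      by (subst (asm) mult_left_cancel) (use z1 H(3)[OF zB] in auto)
    moreover have "deriv (\<lambda>z. g z - g c) z = deriv g z"
      using DERIV_imp_deriv[OF DERIV_diff[OF gd DERIV_const[of "g c"]]] by simp
    ultimately show ?thesis by (simp add: algebra_simps)
  qed
  have "(deriv ^^ Suc k) (\<lambda>z. g z - g c) c = (deriv ^^ k) (deriv (\<lambda>z. g z - g c)) c"
    by (simp add: funpow_swap1)
  also have "\<dots> = (deriv ^^ k) (\<lambda>z. - G z - of_nat j * inverse (z - 1)) c"
  proof (rule higher_deriv_transform_within_open[where S = ?T])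
    show "deriv (\<lambda>z. g z - g c) holomorphic_on ?T"
      by (rule holomorphic_on_subset[OF holomorphic_deriv[OF ghol open_ball]]) auto
    show "(\<lambda>z. - G z - of_nat j * inverse (z - 1)) holomorphic_on ?T"
      by (rule holomorphic_on_diff[OF holomorphic_on_minus[OF Ghol] ihol])
  qed (use T dg in auto)
  also have "\<dots> = (deriv ^^ k) (\<lambda>z. - G z) c - (deriv ^^ k) (\<lambda>z. of_nat j * inverse (z - 1)) c"
    using T Ghol ihol by (intro higher_deriv_diff[where S = ?T] holomorphic_intros) auto
  also have "(deriv ^^ k) (\<lambda>z. - G z) c = - (deriv ^^ k) G c"
    using T Ghol by (intro higher_deriv_uminus[where S = ?T]) auto
  also have "(deriv ^^ k) G c = of_real ((-1) ^ k * fact k * mangoldt_coeff X \<eta> k)"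
    unfolding c_def using abs_le_1 \<eta> by (intro mangoldt_coeff_sums) auto
  also have "(deriv ^^ k) (\<lambda>z. of_nat j * inverse (z - 1)) c = of_nat j * (deriv ^^ k) (\<lambda>z. inverse (z - 1)) c"
    using T by (intro higher_deriv_cmult[where A = ?T]) (auto intro!: holomorphic_intros)
  also have "(deriv ^^ k) (\<lambda>z. inverse (z - 1)) c = of_real ((-1) ^ k * fact k * inverse \<eta> ^ Suc k)"
    using \<eta> by (subst higher_deriv_inverse_minus) (auto simp: c_def field_simps)
  finally have "(deriv ^^ Suc k) (\<lambda>z. g z - g c) c =
      of_real (- ((-1) ^ k * fact k * (mangoldt_coeff X \<eta> k + real j * inverse \<eta> ^ Suc k)))"
    by (simp add: algebra_simps)
  hence "norm ((deriv ^^ Suc k) (\<lambda>z. g z - g c) c) = fact k * \<bar>mangoldt_coeff X \<eta> k + real j * inverse \<eta> ^ Suc k\<bar>"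
    by (simp only: norm_of_real abs_mult power_abs abs_minus_cancel) simp
  with ci have "fact k * \<bar>mangoldt_coeff X \<eta> k + real j * inverse \<eta> ^ Suc k\<bar> \<le> fact k * (real (k + 1) * (2 * A) * 4 ^ (k + 1))"
    by (simp add: divide_simps mult_ac)
  hence "\<bar>mangoldt_coeff X \<eta> k + real j * inverse \<eta> ^ Suc k\<bar> \<le> real (k + 1) * (2 * A) * 4 ^ (k + 1)"
    by (rule mult_left_le_imp_le) simp
  moreover have "real j * inverse \<eta> ^ Suc k \<ge> 0" using \<eta> by simp
  ultimately have "mangoldt_coeff X \<eta> k \<le> real (k + 1) * (2 * A) * 4 ^ (k + 1)" by linarith
  thus ?thesis unfolding A_def[symmetric] by (simp add: mult_ac)
qed

end

section \<open>Comparing the coefficients for X and for 1\<close>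

text \<open>ln q is the sum of \<Lambda> over all divisors of q; keep the prime divisors
  only.\<close>

lemma sum_ln_prime_factors_le:
  assumes "q > (0::nat)"
  shows "(\<Sum>p\<in>prime_factors q. ln (real p)) \<le> ln (real q)"
proof -
  have "(\<Sum>p\<in>prime_factors q. ln (real p)) = (\<Sum>p\<in>prime_factors q. mangoldt p)"
    by (intro sum.cong) (auto simp: in_prime_factors_iff)
  also have "\<dots> \<le> (\<Sum>d | d dvd q. mangoldt d)"
    using assms by (intro sum_mono2) (auto simp: in_prime_factors_iff mangoldt_nonneg)
  also have "\<dots> = ln (real q)" using mangoldt_sum[of q, where ?'a = real] assms by simp
  finally show ?thesis .
qed

text \<open>3/4 bounds p^(-1/2) for every prime p, and 3 = (3/4) / (1 - 3/4).\<close>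

lemma geometric_sum_le_3:
  fixes x :: real
  assumes "0 \<le> x" "x \<le> 3/4"
  shows "(\<Sum>j\<in>{1..N}. x ^ j) \<le> 3"
proof -
  have "(1 - x) * (\<Sum>j\<in>{1..N}. x ^ j) = x - x ^ Suc N"
  proof (induction N)
    case (Suc N)
    have e: "(1 - x) * (\<Sum>j\<in>{1..Suc N}. x ^ j) = (1 - x) * (\<Sum>j\<in>{1..N}. x ^ j) + (1 - x) * x ^ Suc N"
      by (simp add: distrib_left)
    show ?case unfolding e Suc.IH by (simp add: algebra_simps)
  qed simp
  also have "\<dots> \<le> 3/4" using assms zero_le_power[of x "Suc N"] by linarith
  finally have "(1 - x) * (\<Sum>j\<in>{1..N}. x ^ j) \<le> 3/4" .
  moreover have "(1/4) * (\<Sum>j\<in>{1..N}. x ^ j) \<le> (1 - x) * (\<Sum>j\<in>{1..N}. x ^ j)"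
    using assms by (intro mult_right_mono sum_nonneg) auto
  ultimately show ?thesis by linarith
qed

lemma powr_half_prime: "prime (p::nat) \<Longrightarrow> real p powr (-1/2) \<le> 3/4"
proof -
  assume "prime p"
  hence "real p powr (-1/2) \<le> 2 powr (-1/2)"
    using prime_ge_2_nat[of p] by (intro powr_mono2') auto
  also have "\<dots> = 1 / sqrt 2" using powr_minus_divide[of "2::real" "1/2"] by (simp add: powr_half_sqrt)
  also have "\<dots> \<le> 3/4"
  proof -
    have "4/3 \<le> sqrt 2" by (rule real_le_rsqrt) (simp add: power2_eq_square)
    thus ?thesis by (simp add: field_simps)
  qed
  finally show ?thesis .
qed

text \<open>Only powers of primes dividing q contribute, each prime a geometric series times ln p.
  The exponent -1/2 is what remains of -1 after \<open>coeff_lower\<close> spends n^(1/2) on the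
  power of the logarithm.\<close>

lemma mangoldt_not_coprime_sum:
  fixes q :: nat
  defines "f \<equiv> (\<lambda>n. if coprime n q then 0 else mangoldt n * real n powr (-1/2))"
  assumes q: "q > 0"
  shows "summable f" "suminf f \<le> 3 * ln (real q)"
proof -
  have nn: "f n \<ge> 0" for n by (simp add: f_def mangoldt_nonneg)
  have bd: "sum f {..<N} \<le> 3 * ln (real q)" for N
  proof -
    let ?I = "prime_factors q \<times> {1..N}" and ?h = "\<lambda>(p::nat, j::nat). p ^ j"
    have sub: "n \<in> ?h ` ?I" if "n < N" "f n \<noteq> 0" for n
    proof -
      have nc: "\<not> coprime n q" and "primepow n"
        using that by (auto simp: f_def mangoldt_def split: if_splits)
      then obtain p j where pj: "prime p" "j > 0" "n = p ^ j" by (auto simp: primepow_def)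
      have "p dvd q" using nc pj prime_imp_coprime[OF pj(1), of q] by auto
      \<comment> \<open>Since j < p^j < N, the finitely many exponents up to N reach all prime
        powers in the partial sum.\<close>
      moreover have "j < p ^ j" using prime_gt_1_nat[OF pj(1)] by (simp add: power_gt_expt)
      ultimately show ?thesis using pj q that(1) by (intro image_eqI[of _ _ "(p, j)"]) (auto simp: in_prime_factors_iff)
    qed
    have "sum f {..<N} = sum f {n\<in>{..<N}. f n \<noteq> 0}"
      by (intro sum.mono_neutral_right) auto
    also have "\<dots> \<le> sum f (?h ` ?I)"
      using sub nn by (intro sum_mono2) auto
    also have "\<dots> \<le> (\<Sum>i\<in>?I. f (?h i))"
      using sum_image_le[of ?I f ?h] nn by (simp add: o_def)
    also have "\<dots> = (\<Sum>p\<in>prime_factors q. \<Sum>j\<in>{1..N}. f (p ^ j))"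
      by (simp add: sum.cartesian_product case_prod_unfold)
    also have "\<dots> \<le> (\<Sum>p\<in>prime_factors q. ln (real p) * 3)"
    proof (intro sum_mono)
      fix p assume "p \<in> prime_factors q"
      hence p: "prime p" "p \<ge> 2" by (auto simp: in_prime_factors_iff prime_ge_2_nat)
      have "(\<Sum>j\<in>{1..N}. f (p ^ j)) \<le> (\<Sum>j\<in>{1..N}. ln (real p) * (real p powr (-1/2)) ^ j)"
      proof (intro sum_mono)
        fix j assume j: "j \<in> {1..N}"
        have "real (p ^ j) powr (-1/2) = (real p powr (-1/2)) ^ j"
          using p by (simp add: powr_realpow[symmetric] powr_powr mult.commute)
        thus "f (p ^ j) \<le> ln (real p) * (real p powr (-1/2)) ^ j"
          using p j by (auto simp: f_def)
      qed
      also have "\<dots> = ln (real p) * (\<Sum>j\<in>{1..N}. (real p powr (-1/2)) ^ j)" by (simp add: sum_distrib_left)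
      also have "\<dots> \<le> ln (real p) * 3"
        using p powr_half_prime[OF p(1)] by (intro mult_left_mono geometric_sum_le_3) auto
      finally show "(\<Sum>j\<in>{1..N}. f (p ^ j)) \<le> ln (real p) * 3" .
    qed
    also have "\<dots> \<le> 3 * ln (real q)"
      using sum_ln_prime_factors_le[OF q] by (simp flip: sum_distrib_right)
    finally show ?thesis .
  qed
  show "summable f" by (rule summableI_nonneg_bounded[OF nn bd])
  thus "suminf f \<le> 3 * ln (real q)" by (rule suminf_le_const[OF _ bd])
qed

lemma summable_ln_powr:
  assumes "\<eta> > 0"
  shows "summable (\<lambda>n. ln (real n) * real n powr (- 1 - \<eta>))"
proof -
  have "log_bounded (\<lambda>n. of_real (ln (real n)))"
    using log_bounded_times_ln[OF log_bounded_1, of 1] by simp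
  from summable_log_bounded[OF this, of "1 + \<eta>"] assms
  have "summable (\<lambda>n. \<bar>ln (real n)\<bar> * real n powr (- 1 - \<eta>))" by simp
  moreover have "\<bar>ln (real n)\<bar> * real n powr (- 1 - \<eta>) = ln (real n) * real n powr (- 1 - \<eta>)" for n
    by (cases "n = 0") auto
  ultimately show ?thesis by simp
qed

context real_character
begin

text \<open>The series for X and for 1 agree where X n = 1, lose one term where X n = 0 and two
  where X n = -1. The first loss is \<open>mangoldt_not_coprime_sum\<close>. For the second n > x:
  of the exponent \<eta>, one half yields x^(-\<eta>/2), one quarter absorbs the logarithms, and the
  last quarter keeps the sum convergent.\<close>

lemma coeff_lower:
  fixes \<eta> x :: real and k :: nat
  assumes x: "x > 0" and no: "\<And>n. real n \<le> x \<Longrightarrow> X n \<noteq> -1" and \<eta>: "\<eta> > 0"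
  shows "mangoldt_coeff X \<eta> k \<ge> mangoldt_coeff (\<lambda>_. 1) \<eta> k - 3 * 2 ^ k * ln (real q)
           - 2 * (4 / \<eta>) ^ k * x powr (- \<eta> / 2) * (\<Sum>n. ln (real n) * real n powr (- 1 - \<eta> / 4))"
proof -
  define bad where "bad = (\<lambda>n. if coprime n q then 0 else mangoldt n * real n powr (-1/2) :: real)"
  define t where "t = (\<lambda>n. mangoldt n * ln (real n) ^ k * real n powr (- 1 - \<eta>) :: real)"
  define e where "e = (\<lambda>n. ln (real n) * real n powr (- 1 - \<eta> / 4))"
  define c1 c2 where "c1 = fact k * (2::real) ^ k" and "c2 = fact k * (2 * (4 / \<eta>) ^ k * x powr (- \<eta> / 2))"
  have bad: "summable bad" "suminf bad \<le> 3 * ln (real q)"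
    using mangoldt_not_coprime_sum[OF q_pos] by (auto simp: bad_def)
  have se: "summable e" using summable_ln_powr[of "\<eta> / 4"] \<eta> by (simp add: e_def)
  have s1: "(\<lambda>n. X n * t n) sums (fact k * mangoldt_coeff X \<eta> k)"
    using mangoldt_coeff_sums(1)[of X \<eta> k] abs_le_1 \<eta> by (simp add: t_def mult.assoc)
  have s2: "t sums (fact k * mangoldt_coeff (\<lambda>_. 1) \<eta> k)"
    using mangoldt_coeff_sums(1)[of "\<lambda>_. 1" \<eta> k] \<eta> by (simp add: t_def)
  have s3: "(\<lambda>n. t n - c1 * bad n - c2 * e n) sums (fact k * mangoldt_coeff (\<lambda>_. 1) \<eta> k - c1 * suminf bad - c2 * suminf e)"
    by (intro sums_diff s2 sums_mult summable_sums bad se)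
  have le: "t n - c1 * bad n - c2 * e n \<le> X n * t n" for n
  proof (cases "n = 0")
    case True
    thus ?thesis by (simp add: t_def bad_def e_def X_0)
  next
    case False
    hence n: "n \<ge> 1" by simp
    have c: "c1 \<ge> 0" "c2 \<ge> 0" using \<eta> by (auto simp: c1_def c2_def)
    have nn: "t n \<ge> 0" "bad n \<ge> 0" "e n \<ge> 0"
      using n by (auto simp: t_def bad_def e_def mangoldt_nonneg)
    have nn': "c1 * bad n \<ge> 0" "c2 * e n \<ge> 0" using nn c by auto
    consider "X n = 1" | "X n = 0" | "X n = -1" using vals[of n] by auto
    thus ?thesis
    proof cases
      case 1 thus ?thesis using nn' by simp
    next
      case 2
      hence nc: "\<not> coprime n q" using nonzero_iff[of n] by auto
      have "t n \<le> mangoldt n * (fact k / (1/2) ^ k * real n powr (1/2)) * real n powr (- 1)"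
        unfolding t_def
      proof (rule mult_mono[OF mult_left_mono])
        show "ln (real n) ^ k \<le> fact k / (1/2) ^ k * real n powr (1/2)"
          using n by (intro ln_power_le) auto
        show "real n powr (- 1 - \<eta>) \<le> real n powr (- 1)" using n \<eta> by (intro powr_mono) auto
      qed (auto simp: mangoldt_nonneg)
      also have "\<dots> = c1 * (mangoldt n * (real n powr (1/2) * real n powr (- 1)))"
        by (simp add: c1_def field_simps)
      also have "real n powr (1/2) * real n powr (- 1) = real n powr (-1/2)"
        unfolding powr_add[symmetric] by simp
      finally show ?thesis using 2 nc nn' by (simp add: bad_def)
    next
      case 3
      hence xn: "real n > x" using no[of n] by force
      have "t n \<le> ln (real n) * (fact k / (\<eta>/4) ^ k * real n powr (\<eta>/4)) * (real n powr (- 1 - \<eta>/2) * real n powr (- \<eta>/2))"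
        unfolding t_def
      proof (rule mult_mono[OF mult_mono])
        show "mangoldt n \<le> ln (real n)" using n by (intro mangoldt_le) auto
        show "ln (real n) ^ k \<le> fact k / (\<eta>/4) ^ k * real n powr (\<eta>/4)"
          using n \<eta> by (intro ln_power_le) auto
        show "real n powr (- 1 - \<eta>) \<le> real n powr (- 1 - \<eta>/2) * real n powr (- \<eta>/2)"
        proof -
          have "- 1 - \<eta>/2 + - \<eta>/2 = - 1 - \<eta>" by (simp add: field_simps)
          thus ?thesis by (metis powr_add order_refl)
        qed
      qed (use n \<eta> in auto)
      also have "\<dots> \<le> ln (real n) * (fact k / (\<eta>/4) ^ k * real n powr (\<eta>/4)) * (real n powr (- 1 - \<eta>/2) * x powr (- \<eta>/2))"
      proof (intro mult_left_mono)
        show "real n powr (- \<eta>/2) \<le> x powr (- \<eta>/2)"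
          using \<eta> x xn by (intro powr_mono2') auto
      qed (use n \<eta> in auto)
      also have "\<dots> = fact k * (4 / \<eta>) ^ k * x powr (- \<eta> / 2) * (ln (real n) * (real n powr (\<eta>/4) * real n powr (- 1 - \<eta>/2)))"
        using \<eta> by (simp add: power_divide field_simps)
      also have "real n powr (\<eta>/4) * real n powr (- 1 - \<eta>/2) = real n powr (- 1 - \<eta>/4)"
      proof -
        have "\<eta>/4 + (- 1 - \<eta>/2) = - 1 - \<eta>/4" by (simp add: field_simps)
        thus ?thesis by (metis powr_add)
      qed
      finally have "2 * t n \<le> c2 * e n" by (simp add: c2_def e_def)
      thus ?thesis using 3 nn' by simp
    qed
  qed
  have "fact k * mangoldt_coeff (\<lambda>_. 1) \<eta> k - c1 * suminf bad - c2 * suminf e \<le> fact k * mangoldt_coeff X \<eta> k"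
    by (rule sums_le[OF le s3 s1])
  moreover have "c1 * suminf bad \<le> c1 * (3 * ln (real q))"
    using bad by (intro mult_left_mono) (auto simp: c1_def)
  moreover have "c1 * (3 * ln (real q)) = fact k * (3 * 2 ^ k * ln (real q))"
    "c2 * suminf e = fact k * (2 * (4 / \<eta>) ^ k * x powr (- \<eta> / 2) * suminf e)"
    unfolding c1_def c2_def by simp_all
  ultimately have "fact k * mangoldt_coeff (\<lambda>_. 1) \<eta> k - fact k * (3 * 2 ^ k * ln (real q))
       - fact k * (2 * (4 / \<eta>) ^ k * x powr (- \<eta> / 2) * suminf e) \<le> fact k * mangoldt_coeff X \<eta> k"
    by linarith
  hence "fact k * (mangoldt_coeff (\<lambda>_. 1) \<eta> k - 3 * 2 ^ k * ln (real q)
       - 2 * (4 / \<eta>) ^ k * x powr (- \<eta> / 2) * suminf e) \<le> fact k * mangoldt_coeff X \<eta> k"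
    by (simp only: right_diff_distrib)
  thus ?thesis unfolding e_def by (rule mult_left_le_imp_le) simp
qed

end

theorem erh_small_nonresidue:
  assumes erh: extended_riemann_hypothesis
  shows "\<exists>K e. K > 0 \<and> e \<ge> 0 \<and> (\<forall>q X. real_character q X \<longrightarrow>
           (\<exists>n. X n = -1 \<and> real n \<le> (K * (ln (real q) + 1)) powr e))"
proof -
  obtain r M where rM: "r > 0" "M \<ge> 0"
    "\<And>\<eta> k. 0 < \<eta> \<Longrightarrow> \<eta> \<le> r \<Longrightarrow> mangoldt_coeff (\<lambda>_. 1) \<eta> k \<ge> inverse \<eta> ^ Suc k - M / r ^ k"
    using zeta_coeff_lower by blast
  \<comment> \<open>2 \<eta> \<le> r puts the error M / r^k a factor 2^k below \<eta>^(-k). The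
    bound 1/32 gives \<eta>^(-k) \<ge> 32^k, which exceeds 8^k even after division by 2^k.\<close>
  define \<eta> where "\<eta> = min (r / 2) (1 / 32)"
  have \<eta>: "\<eta> > 0" "\<eta> \<le> r" "\<eta> \<le> 1/16" "2 * \<eta> \<le> r" "\<eta> \<le> 1/32" using rM by (auto simp: \<eta>_def)
  define E where "E = (\<Sum>n. ln (real n) * real n powr (- 1 - \<eta> / 4))"
  have E0: "E \<ge> 0"
  proof -
    have "0 \<le> ln (real n) * real n powr (- 1 - \<eta> / 4)" for n by (cases "n = 0") auto
    thus ?thesis unfolding E_def using \<eta> by (intro suminf_nonneg summable_ln_powr) auto
  qed
  define C where "C = \<bar>ln (8 * (\<Sum>n. real (Suc n) powr (- 3/2))) + Re (mangoldt_series (of_real (1 + \<eta>))) + ln 4 + 1\<bar>"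
  \<comment> \<open>Chosen so that 2 Y \<le> K (l + 1) for the \<open>Y\<close> below: 45 is the
    coefficient 44 of l in \<open>Y\<close> plus the final 1.\<close>
  define K where "K = 2 * (4 * (M + 2 * E) + 44 * C + 45)"
  have "\<exists>n. X n = -1 \<and> real n \<le> (K * (ln (real q) + 1)) powr (6 / \<eta>)" if rc: "real_character q X" for q X
  proof (rule ccontr)
    assume "\<not> ?thesis"
    hence no: "X n \<noteq> -1" if "real n \<le> (K * (ln (real q) + 1)) powr (6 / \<eta>)" for n using that by auto
    interpret real_character q X by (rule rc)
    define l where "l = ln (real q)"
    have l0: "l \<ge> 0" using q_pos by (simp add: l_def)
    define Y where "Y = 4 * (M + 2 * E) + 44 * (l + C) + 1"
    have C0: "C \<ge> 0" by (simp add: C_def)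
    have Y1: "Y \<ge> 1" using rM E0 l0 C0 by (simp add: Y_def)
    define k where "k = nat \<lceil>log 2 Y\<rceil>"
    have k1: "2 ^ k \<ge> Y" and k2: "2 ^ k \<le> 2 * Y"
    proof -
      have "log 2 Y \<ge> 0" using Y1 by simp
      hence "log 2 Y \<le> real k" "real k \<le> log 2 Y + 1" unfolding k_def by linarith+
      hence "2 powr (log 2 Y) \<le> 2 powr real k" "2 powr real k \<le> 2 powr (log 2 Y + 1)" by simp_all
      thus "2 ^ k \<ge> Y" "2 ^ k \<le> 2 * Y" using Y1 by (simp_all add: powr_realpow powr_add)
    qed
    \<comment> \<open>The exponent 6/\<eta> makes x^(-\<eta>/2) equal to 8^(-k), turning the factor
      (4/\<eta>)^k of \<open>coeff_lower\<close> into (1/(2\<eta>))^k.\<close>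
    define x where "x = (2 ^ k :: real) powr (6 / \<eta>)"
    have x0: "x > 0" by (simp add: x_def)
    have KY: "2 * Y \<le> K * (l + 1)"
    proof -
      have "K * (l + 1) - 2 * Y = 2 * ((4 * (M + 2 * E) + 44 * C + 1) * l + 44)"
        by (simp add: K_def Y_def algebra_simps)
      moreover have "(4 * (M + 2 * E) + 44 * C + 1) * l \<ge> 0" using rM E0 l0 C0 by simp
      ultimately have "0 \<le> K * (l + 1) - 2 * Y" by simp
      thus ?thesis by simp
    qed
    have "x \<le> (K * (l + 1)) powr (6 / \<eta>)"
      unfolding x_def using \<eta> k2 KY by (intro powr_mono2) auto
    hence no': "X n \<noteq> -1" if "real n \<le> x" for n using no[of n] that by (auto simp: l_def)
    have x8: "x powr (- \<eta> / 2) = 1 / 8 ^ k"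
    proof -
      have "x powr (- \<eta> / 2) = (2 ^ k) powr (- 3)" using \<eta> by (simp add: x_def powr_powr)
      also have "\<dots> = 1 / (2 ^ k) ^ 3" by (simp add: powr_minus divide_inverse)
      also have "(2 ^ k) ^ 3 = (8 :: real) ^ k" by (simp add: power_mult[symmetric] mult.commute[of k] power_mult)
      finally show ?thesis .
    qed
    define u where "u = inverse \<eta> ^ k"
    have u0: "u > 0" using \<eta> by (simp add: u_def)
    have ge32: "32 ^ k \<le> u" unfolding u_def using \<eta> by (intro power_mono) (auto simp: field_simps)
    have "mangoldt_coeff (\<lambda>_. 1) \<eta> k - 3 * 2 ^ k * l - 2 * (4 / \<eta>) ^ k * x powr (- \<eta> / 2) * E \<le> mangoldt_coeff X \<eta> k"
      using coeff_lower[OF x0 no' \<eta>(1), of k] by (simp add: l_def E_def)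
    also have "mangoldt_coeff X \<eta> k \<le> 2 * real (k + 1) * 4 ^ (k + 1) * (l + C)"
      unfolding l_def C_def using q_pos
      by (intro order_trans[OF coeff_upper[OF erh \<eta>(1,3)]] mult_left_mono add_left_mono abs_ge_self) auto
    finally have "inverse \<eta> ^ Suc k \<le> M / r ^ k + 3 * 2 ^ k * l + 2 * (4 / \<eta>) ^ k * x powr (- \<eta> / 2) * E
        + 2 * real (k + 1) * 4 ^ (k + 1) * (l + C)"
      using rM(3)[OF \<eta>(1,2), of k] by linarith
    moreover have "inverse \<eta> ^ Suc k \<ge> 32 * u"
    proof -
      have "32 \<le> inverse \<eta>" using \<eta> by (simp add: field_simps)
      thus ?thesis using u0 by (simp add: u_def)
    qed
    moreover have "M / r ^ k \<le> M * (u / 2 ^ k)"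
    proof -
      have "1 / r ^ k \<le> 1 / (2 * \<eta>) ^ k"
        using \<eta> rM by (intro divide_left_mono power_mono) auto
      also have "\<dots> = u / 2 ^ k" by (simp add: u_def power_mult_distrib divide_inverse power_inverse)
      finally have "M * (1 / r ^ k) \<le> M * (u / 2 ^ k)" using rM(2) by (rule mult_left_mono)
      thus ?thesis by simp
    qed
    moreover have "2 * (4 / \<eta>) ^ k * x powr (- \<eta> / 2) * E = 2 * E * (u / 2 ^ k)"
    proof -
      have "(4 / \<eta>) ^ k / 8 ^ k = u / 2 ^ k"
      proof -
        have "(8::real) ^ k = 4 ^ k * 2 ^ k" by (simp flip: power_mult_distrib)
        thus ?thesis by (simp add: u_def divide_inverse power_mult_distrib power_inverse)
      qed
      moreover have "2 * (4 / \<eta>) ^ k * x powr (- \<eta> / 2) * E = 2 * E * ((4 / \<eta>) ^ k / 8 ^ k)"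
        unfolding x8 by simp
      ultimately show ?thesis by simp
    qed
    moreover have "3 * 2 ^ k * l + 2 * real (k + 1) * 4 ^ (k + 1) * (l + C) \<le> 11 * (l + C) * (u / 2 ^ k)"
    proof -
      have "real (k + 1) \<le> 2 ^ k" by (induction k) auto
      hence "2 * real (k + 1) * 4 ^ (k + 1) * (l + C) \<le> 2 * 2 ^ k * 4 ^ (k + 1) * (l + C)"
        using l0 C0 by (intro mult_right_mono mult_left_mono) auto
      also have "\<dots> = 8 * 8 ^ k * (l + C)" by (simp flip: power_mult_distrib)
      finally have 1: "2 * real (k + 1) * 4 ^ (k + 1) * (l + C) \<le> 8 * 8 ^ k * (l + C)" .
      have "3 * 2 ^ k * l \<le> 3 * 8 ^ k * (l + C)"
        using l0 C0 by (intro mult_mono power_mono) auto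
      with 1 have "3 * 2 ^ k * l + 2 * real (k + 1) * 4 ^ (k + 1) * (l + C) \<le> 11 * (l + C) * 8 ^ k"
        by (simp add: algebra_simps)
      also have "8 ^ k \<le> u / 2 ^ k"
      proof -
        have "(8::real) ^ k * 2 ^ k \<le> 32 ^ k" by (simp flip: power_mult_distrib add: power_mono)
        thus ?thesis using ge32 by (simp add: field_simps)
      qed
      hence "11 * (l + C) * 8 ^ k \<le> 11 * (l + C) * (u / 2 ^ k)" using l0 C0 by (intro mult_left_mono) auto
      finally show ?thesis .
    qed
    ultimately have "32 * u \<le> M * (u / 2 ^ k) + 2 * E * (u / 2 ^ k) + 11 * (l + C) * (u / 2 ^ k)" by linarith
    also have "\<dots> = (M + 2 * E + 11 * (l + C)) * (u / 2 ^ k)" by (simp add: algebra_simps)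
    also have "\<dots> \<le> Y * (u / 2 ^ k)"
      using u0 rM E0 l0 C0 by (intro mult_right_mono) (auto simp: Y_def)
    also have "\<dots> \<le> 2 ^ k * (u / 2 ^ k)" using u0 k1 by (intro mult_right_mono) auto
    finally show False using u0 by simp
  qed
  moreover have "K > 0" using rM E0 by (simp add: K_def C_def add_nonneg_pos)
  moreover have "6 / \<eta> \<ge> 0" using \<eta> by simp
  ultimately show ?thesis by blast
qed

section \<open>Power residue symbols modulo semiprimes\<close>

text \<open>For odd p and a prime to p this is the Legendre symbol. At multiples of p it is 1, not
  0, hence the coprimality conditions wherever it is used multiplicatively.\<close>

abbreviation chi :: "nat \<Rightarrow> int \<Rightarrow> int" where
  "chi p a \<equiv> prime_residue_symbol 1 a p"

lemma chi_values:
  fixes p :: nat and a :: int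
  shows "chi p a = 1 \<or> chi p a = -1"
  by (simp add: prime_residue_symbol_def)

lemma prime_residue_symbol_cong:
  assumes "[a = b] (mod int p)"
  shows "prime_residue_symbol k a p = prime_residue_symbol k b p"
  using assms unfolding prime_residue_symbol_def by (meson cong_sym cong_trans)

lemma prime_not_dvd_iff_coprime: "prime p \<Longrightarrow> \<not> int p dvd a \<longleftrightarrow> coprime a (int p)"
  by (metis coprime_commute coprime_absorb_left not_prime_unit prime_imp_coprime prime_nat_int_transfer)

lemma fermat_int:
  assumes "prime p" "coprime a (int p)"
  shows "[a ^ (p - 1) = 1] (mod int p)"
proof -
  have p0: "p > 0" using assms by (simp add: prime_gt_0_nat)
  define b where "b = nat (a mod int p)"
  have b: "[int b = a] (mod int p)" using p0 by (simp add: b_def Cong.cong_def)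
  have "\<not> int p dvd int b"
    using assms prime_not_dvd_iff_coprime[of p a] b by (simp add: cong_dvd_iff[OF cong_sym[OF b]] cong_dvd_iff)
  hence "[b ^ (p - 1) = 1] (mod p)" using fermat_theorem[of p b] assms(1) by simp
  hence "[int b ^ (p - 1) = 1] (mod int p)" by (metis cong_int_iff of_nat_1 of_nat_power)
  thus ?thesis using cong_pow[OF cong_sym[OF b], of "p - 1"] by (rule cong_trans[rotated])
qed

lemma chi_euler:
  assumes p: "prime p" "p > 2" and a: "coprime a (int p)"
  shows "[a ^ ((p - 1) div 2) = chi p a] (mod int p)"
proof -
  have na: "\<not> [a = 0] (mod int p)"
    using prime_not_dvd_iff_coprime[OF p(1)] a by (simp add: cong_0_iff)
  have "[Legendre a (int p) = a ^ ((p - 1) div 2)] (mod int p)"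
    using euler_criterion[of p a] p by simp
  moreover have "Legendre a (int p) = chi p a"
    using na by (simp add: Legendre_def prime_residue_symbol_def QuadRes_def)
  ultimately show ?thesis by (simp add: cong_sym)
qed

lemma sign_cong_imp_eq:
  assumes "[u = v] (mod int p)" "p > 2" "u = 1 \<or> u = -1" "v = 1 \<or> v = -1"
  shows "u = v"
proof (rule ccontr)
  assume "u \<noteq> v"
  hence "int p dvd 2"
    using assms by (auto simp: cong_iff_dvd_diff)
  hence "int p \<le> 2" by (rule zdvd_imp_le) simp
  thus False using assms by simp
qed

lemma chi_mult:
  assumes p: "prime p" "p > 2" and a: "coprime a (int p)" "coprime b (int p)"
  shows "chi p (a * b) = chi p a * chi p b"
proof (rule sign_cong_imp_eq[OF _ p(2)])
  let ?e = "(p - 1) div 2"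
  have "[chi p (a * b) = (a * b) ^ ?e] (mod int p)"
    using a by (intro cong_sym[OF chi_euler[OF p]]) simp
  also have "(a * b) ^ ?e = a ^ ?e * b ^ ?e" by (rule power_mult_distrib)
  also have "[a ^ ?e * b ^ ?e = chi p a * chi p b] (mod int p)"
    by (intro cong_mult chi_euler p a)
  finally show "[chi p (a * b) = chi p a * chi p b] (mod int p)" .
  show "chi p a * chi p b = 1 \<or> chi p a * chi p b = -1"
    using chi_values[of a p] chi_values[of b p] by auto
qed (rule chi_values)

lemma chi_1: "chi p 1 = 1"
  by (auto simp: prime_residue_symbol_def intro!: exI[of _ 1])

text \<open>Otherwise squaring would be onto, hence one-to-one, on the nonzero residues, but 1 and p
  - 1 have the same square.\<close>

lemma ex_nonresidue:
  assumes p: "prime p" "p > 2"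
  shows "\<exists>a::nat. a < p \<and> coprime (int a) (int p) \<and> chi p (int a) = -1"
proof (rule ccontr)
  assume "\<not> ?thesis"
  hence all: "chi p (int a) = 1" if "a < p" "coprime (int a) (int p)" for a
    using that chi_values by blast
  let ?U = "{1..<p}" and ?f = "\<lambda>x. (x * x) mod p"
  have cop: "coprime (int a) (int p)" if "a \<in> ?U" for a
    using that p prime_not_dvd_iff_coprime[OF p(1), of "int a"] nat_dvd_not_less[of a p] by auto
  have "?U \<subseteq> ?f ` ?U"
  proof
    fix a assume a: "a \<in> ?U"
    hence "chi p (int a) = 1" using all[of a] cop[OF a] by auto
    then obtain x :: int where x: "[x ^ 2 = int a] (mod int p)"
      by (auto simp: prime_residue_symbol_def split: if_splits)
    define y where "y = nat (x mod int p)"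
    have yi: "int y = x mod int p" using p by (simp add: y_def)
    have "[int y ^ 2 = x ^ 2] (mod int p)" unfolding yi by (intro cong_pow) simp
    hence "[int y ^ 2 = int a] (mod int p)" using x by (rule cong_trans)
    hence "[y ^ 2 = a] (mod p)" by (simp flip: of_nat_power add: cong_int_iff)
    hence fy: "?f y = a" using a by (simp add: Cong.cong_def power2_eq_square)
    have "y < p" using p by (simp add: y_def nat_less_iff)
    moreover have "y \<noteq> 0" using fy a by (intro notI) simp
    ultimately show "a \<in> ?f ` ?U" using fy by (intro image_eqI[of _ _ y]) auto
  qed
  hence "card ?U \<le> card (?f ` ?U)" by (intro card_mono) auto
  hence "card (?f ` ?U) = card ?U" using card_image_le[of ?U ?f] by simp
  hence inj: "inj_on ?f ?U" by (intro eq_card_imp_inj_on) auto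
  have "?f 1 = ?f (p - 1)"
  proof -
    have "[int (p - 1) * int (p - 1) = (-1) * (-1)] (mod int p)"
      using p by (intro cong_mult) (auto simp: cong_iff_dvd_diff of_nat_diff)
    hence "[int ((p - 1) * (p - 1)) = int 1] (mod int p)" by simp
    hence "[(p - 1) * (p - 1) = 1] (mod p)" by (simp only: cong_int_iff)
    thus ?thesis by (simp add: Cong.cong_def)
  qed
  hence "1 = p - 1" by (rule inj_onD[OF inj]) (use p in auto)
  thus False using p by simp
qed

text \<open>For k \<le> v put w = (p-1) / 2^k. If m were x^(2^k), raising to the power w would give
  x^(p-1) = 1 on one side and a^((p-1)/2), the symbol of a, on the other. Conversely, a square root
  of a is a 2^k-th root of m.\<close>

lemma symbol_of_power:
  assumes p: "prime p" "p > 2" and a: "coprime a (int p)" and k: "k \<ge> 1"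
    and m: "[m = a ^ (2 ^ (k - 1))] (mod int p)"
  shows "prime_residue_symbol (k - 1) m p = 1"
    and "prime_residue_symbol k m p = (if k \<le> nu2 (p - 1) then chi p a else 1)"
proof -
  show "prime_residue_symbol (k - 1) m p = 1"
    using cong_sym[OF m] unfolding prime_residue_symbol_def by auto
  have kk: "2 ^ k = 2 * (2::nat) ^ (k - 1)" using k by (cases k) auto
  show "prime_residue_symbol k m p = (if k \<le> nu2 (p - 1) then chi p a else 1)"
  proof (cases "k \<le> nu2 (p - 1)")
    case True
    hence "2 ^ k dvd p - 1" by (rule multiplicity_dvd')
    then obtain w where w: "p - 1 = 2 ^ k * w" by auto
    show ?thesis
    proof (cases "chi p a = 1")
      case 1: True
      then obtain y where y: "[y ^ 2 = a] (mod int p)" by (auto simp: prime_residue_symbol_def split: if_splits)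
      have "[(y ^ 2) ^ (2 ^ (k - 1)) = a ^ (2 ^ (k - 1))] (mod int p)" by (rule cong_pow[OF y])
      hence "[(y ^ 2) ^ (2 ^ (k - 1)) = m] (mod int p)" using cong_sym[OF m] by (rule cong_trans)
      hence "[y ^ (2 ^ k) = m] (mod int p)" by (simp only: kk power_mult)
      thus ?thesis using True 1 by (auto simp: prime_residue_symbol_def)
    next
      case False
      hence c: "chi p a = -1" using chi_values by blast
      have "\<not> [x ^ (2 ^ k) = m] (mod int p)" for x
      proof
        assume "[x ^ (2 ^ k) = m] (mod int p)"
        hence x: "[x ^ (2 ^ k) = a ^ (2 ^ (k - 1))] (mod int p)" using m by (rule cong_trans)
        have "coprime (a ^ (2 ^ (k - 1))) (int p)" using a by simp
        hence "coprime (x ^ (2 ^ k)) (int p)" using cong_imp_coprime[OF cong_sym[OF x]] by blast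
        hence "coprime x (int p)" by simp
        hence "[1 = x ^ (p - 1)] (mod int p)" by (intro cong_sym[OF fermat_int[OF p(1)]])
        also have "x ^ (p - 1) = (x ^ (2 ^ k)) ^ w" by (simp only: w power_mult)
        also have "[(x ^ (2 ^ k)) ^ w = (a ^ (2 ^ (k - 1))) ^ w] (mod int p)" by (rule cong_pow[OF x])
        also have "(a ^ (2 ^ (k - 1))) ^ w = a ^ ((p - 1) div 2)"
        proof -
          have "(p - 1) div 2 = 2 ^ (k - 1) * w" unfolding w kk by simp
          thus ?thesis by (simp only: power_mult)
        qed
        also have "[a ^ ((p - 1) div 2) = chi p a] (mod int p)" by (rule chi_euler[OF p a])
        finally have "1 = chi p a" using p(2) chi_values by (intro sign_cong_imp_eq) auto
        thus False using c by simp
      qed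
      thus ?thesis using True c by (auto simp: prime_residue_symbol_def)
    qed
  next
    \<comment> \<open>For k > v, p - 1 divides 2^(k-1) u with u odd. Writing u + 1 = 2t, the element
      a^t is a 2^k-th root of a^(2^(k-1)).\<close>
    case False
    define v where "v = nu2 (p - 1)"
    obtain u where u: "p - 1 = 2 ^ v * u" using multiplicity_dvd[of 2 "p - 1"] by (auto simp: v_def)
    have "odd u"
    proof
      assume "even u"
      hence "2 ^ Suc v dvd p - 1" unfolding u by auto
      hence "Suc v \<le> nu2 (p - 1)" using p by (intro multiplicity_geI) auto
      thus False by (simp add: v_def)
    qed
    then obtain t where t: "u + 1 = 2 * t" by (metis even_Suc Suc_eq_plus1 evenE)
    have d: "p - 1 dvd 2 ^ (k - 1) * u"
      unfolding u using False by (intro mult_dvd_mono le_imp_power_dvd) (auto simp: v_def)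
    have one: "[a ^ (2 ^ (k - 1) * u) = 1] (mod int p)"
    proof -
      obtain z where z: "2 ^ (k - 1) * u = (p - 1) * z" using d by auto
      show ?thesis unfolding z power_mult using cong_pow[OF fermat_int[OF p(1) a], of z] by simp
    qed
    have "(a ^ t) ^ (2 ^ k) = a ^ (2 ^ (k - 1)) * a ^ (2 ^ (k - 1) * u)"
    proof -
      have "t * 2 ^ k = 2 ^ (k - 1) * (2 * t)" by (simp add: kk)
      also have "\<dots> = 2 ^ (k - 1) * (u + 1)" by (simp only: t)
      also have "\<dots> = 2 ^ (k - 1) + 2 ^ (k - 1) * u" by simp
      finally show ?thesis by (simp only: power_mult[symmetric] power_add)
    qed
    also have "[\<dots> = a ^ (2 ^ (k - 1)) * 1] (mod int p)" by (intro cong_mult one) simp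
    finally have "[(a ^ t) ^ (2 ^ k) = m] (mod int p)" using cong_trans[OF _ cong_sym[OF m]] by simp
    thus ?thesis using False by (auto simp: prime_residue_symbol_def)
  qed
qed

lemma residue_symbol_semiprime:
  assumes "prime p" "prime q"
  shows "residue_symbol k a (p * q) = prime_residue_symbol k a p * prime_residue_symbol k a q"
  using assms by (simp add: residue_symbol_def prime_factorization_mult prime_factorization_prime)

text \<open>Reducing the power modulo N keeps the query short and changes neither symbol, as p and q
  divide N. The bound on k is what entitles one to trust the oracle.\<close>

lemma oracle_answer:
  fixes p q a k :: nat
  assumes p: "prime p" "p > 2" and q: "prime q" "q > 2" and N: "N = p * q" and a: "coprime a N"
    and k: "1 \<le> k" "k \<le> max (nu2 (p - 1)) (nu2 (q - 1)) + 1"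
    and Or: "\<forall>k\<in>{1..max (nu2 (p - 1)) (nu2 (q - 1)) + 1}. solves_CRS Or k"
  shows "Or k N (a ^ (2 ^ (k - 1)) mod N) =
    (if k \<le> nu2 (p - 1) then chi p (int a) else 1) * (if k \<le> nu2 (q - 1) then chi q (int a) else 1)"
proof -
  define m where "m = a ^ (2 ^ (k - 1)) mod N"
  have cp: "coprime (int a) (int p)" and cq: "coprime (int a) (int q)" using a by (auto simp: N)
  have "[int m = int a ^ (2 ^ (k - 1))] (mod int N)"
    unfolding m_def by (simp add: Cong.cong_def zmod_int)
  hence mp: "[int m = int a ^ (2 ^ (k - 1))] (mod int p)" and mq: "[int m = int a ^ (2 ^ (k - 1))] (mod int q)"
    unfolding N of_nat_mult by (auto intro: cong_modulus_mult) (metis cong_modulus_mult mult.commute)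
  note sp = symbol_of_power[OF p cp k(1) mp] and sq = symbol_of_power[OF q cq k(1) mq]
  have N1: "N > 1" unfolding N using p q by (metis less_1_mult prime_gt_1_nat)
  have cm: "coprime N m"
    unfolding m_def using a N1
    by (metis coprime_commute coprime_mod_left_iff coprime_power_left_iff not_one_less_zero)
  have "m \<noteq> 0" using cm N1 by (intro notI) simp
  moreover have "prime_factors N = {p, q}"
    using p q by (simp add: N prime_factorization_mult prime_factorization_prime insert_commute)
  ultimately have "CRS_instance k N m"
    unfolding CRS_instance_def using k(1) N1 cm sp(1) sq(1) by auto
  moreover have "solves_CRS Or k" using Or k by auto
  ultimately have "Or k N m = residue_symbol k (int m) N" by (simp add: solves_CRS_def)
  thus ?thesis using sp(2) sq(2) residue_symbol_semiprime[OF p(1) q(1), of k "int m"]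
    by (simp add: N m_def)
qed

section \<open>Frequency and size of sign patterns\<close>

lemma ex_pattern:
  assumes p: "prime p" "p > 2" and q: "prime q" "q > 2" and pq: "p \<noteq> q"
    and e: "e = 1 \<or> e = -1" "f = 1 \<or> f = -1"
  shows "\<exists>a::nat. coprime a (p * q) \<and> chi p (int a) = e \<and> chi q (int a) = f"
proof -
  have r: "\<exists>b::nat. coprime b r \<and> chi r (int b) = g" if "prime r" "r > 2" "g = 1 \<or> g = -1" for r g
    using that ex_nonresidue[OF that(1,2)] chi_1[of r] by (metis coprime_1_left coprime_int_iff of_nat_1)
  obtain b c where b: "coprime b p" "chi p (int b) = e" and c: "coprime c q" "chi q (int c) = f"
    using r[OF p e(1)] r[OF q e(2)] by blast
  have "coprime p q" using p q pq by (simp add: primes_coprime)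
  then obtain x where x: "[x = b] (mod p)" "[x = c] (mod q)" using binary_chinese_remainder_nat by blast
  have "coprime x p" "coprime x q" using x b c by (metis cong_imp_coprime cong_sym)+
  moreover have "chi p (int x) = e" "chi q (int x) = f"
    using x b c prime_residue_symbol_cong by (metis cong_int_iff)+
  ultimately show ?thesis by auto
qed

text \<open>With p = i + 3 and q = j + 3 the claim reads i j + i + j \<ge> 1, which would fail only
  for p = q = 3. It says that at least half of the residues are prime to p q.\<close>

lemma odd_semiprime_bound:
  assumes "prime p" "p > 2" "prime q" "q > (2::nat)" "p \<noteq> q"
  shows "p * q \<le> 2 * ((p - 1) * (q - 1))"
proof -
  have odd: "odd p" "odd q" using assms by (auto simp: prime_odd_nat)
  have "p \<ge> 3" "q \<ge> 3" using assms by auto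
  then obtain i j where ij: "p = i + 3" "q = j + 3" by (metis le_add_diff_inverse2)
  have "even i" "even j" using odd ij by auto
  hence "i \<ge> 2 \<or> j \<ge> 2" using ij assms(5) by presburger
  thus ?thesis unfolding ij by (auto simp: algebra_simps)
qed

text \<open>Multiplication by a residue with suitable signs maps any sign pattern injectively into any other, so
  all four are equally frequent.\<close>

lemma card_pattern:
  assumes p: "prime p" "p > 2" and q: "prime q" "q > 2" and pq: "p \<noteq> q"
    and e: "e = 1 \<or> e = -1" "f = 1 \<or> f = -1"
  shows "p * q \<le> 8 * card {a. a < p * q \<and> coprime a (p * q) \<and> chi p (int a) = e \<and> chi q (int a) = f}"
proof -
  let ?N = "p * q"
  define S where "S = (\<lambda>e f. {a. a < ?N \<and> coprime a ?N \<and> chi p (int a) = e \<and> chi q (int a) = f})"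
  have fin: "finite (S e f)" for e f by (rule finite_subset[of _ "{..<?N}"]) (auto simp: S_def)
  have N1: "?N > 1" using p q by (metis less_1_mult prime_gt_1_nat)
  have le: "card (S e' f') \<le> card (S e f)" if ef: "e' = 1 \<or> e' = -1" "f' = 1 \<or> f' = -1" for e' f' :: int
  proof -
    obtain b where b: "coprime b ?N" "chi p (int b) = e * e'" "chi q (int b) = f * f'"
      using ex_pattern[OF p q pq, of "e * e'" "f * f'"] e ef by auto
    let ?h = "\<lambda>a. (b * a) mod ?N"
    have "inj_on ?h (S e' f')"
    proof (rule inj_onI)
      fix x y assume xy: "x \<in> S e' f'" "y \<in> S e' f'" "?h x = ?h y"
      hence "[b * x = b * y] (mod ?N)" by (simp add: Cong.cong_def)
      hence "[x = y] (mod ?N)" using b(1) by (simp add: cong_mult_lcancel_nat)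
      thus "x = y" using xy by (simp add: Cong.cong_def S_def)
    qed
    moreover have "?h ` S e' f' \<subseteq> S e f"
    proof
      fix z assume "z \<in> ?h ` S e' f'"
      then obtain x where x: "x \<in> S e' f'" "z = ?h x" by blast
      have cx: "coprime x ?N" "chi p (int x) = e'" "chi q (int x) = f'" using x by (auto simp: S_def)
      have "[z = b * x] (mod ?N)" using x by (simp add: Cong.cong_def)
      hence zN: "[int z = int b * int x] (mod int ?N)" by (metis cong_int_iff of_nat_mult)
      have zp: "[int z = int b * int x] (mod int p)" "[int z = int b * int x] (mod int q)"
        using zN unfolding of_nat_mult by (auto intro: cong_modulus_mult) (metis cong_modulus_mult mult.commute)
      have "chi p (int z) = chi p (int b) * chi p (int x)"
        using b cx prime_residue_symbol_cong[OF zp(1)] chi_mult[OF p, of "int b" "int x"] by auto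
      moreover have "chi q (int z) = chi q (int b) * chi q (int x)"
        using b cx prime_residue_symbol_cong[OF zp(2)] chi_mult[OF q, of "int b" "int x"] by auto
      moreover have "coprime z ?N"
        unfolding x(2) using b(1) cx(1) p q
        by (subst coprime_mod_left_iff) (auto simp del: coprime_mult_right_iff)
      moreover have "z < ?N" unfolding x(2) using N1 by (intro mod_less_divisor) linarith
      moreover have "e * e' * e' = e" "f * f' * f' = f" using ef by auto
      ultimately show "z \<in> S e f" using b cx by (simp add: S_def)
    qed
    ultimately show ?thesis using card_inj_on_le fin by blast
  qed
  have U: "{a. a < ?N \<and> coprime a ?N} = S 1 1 \<union> S 1 (-1) \<union> S (-1) 1 \<union> S (-1) (-1)"
    using chi_values by (auto simp: S_def)
  have "card {a. a < ?N \<and> coprime a ?N} \<le> card (S 1 1) + card (S 1 (-1)) + card (S (-1) 1) + card (S (-1) (-1))"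
    unfolding U using card_Un_le[of "S 1 1" "S 1 (-1)"] card_Un_le[of "S 1 1 \<union> S 1 (-1)" "S (-1) 1"]
      card_Un_le[of "S 1 1 \<union> S 1 (-1) \<union> S (-1) 1" "S (-1) (-1)"] by linarith
  hence 4: "card {a. a < ?N \<and> coprime a ?N} \<le> 4 * card (S e f)"
    using le[of 1 1] le[of 1 "-1"] le[of "-1" 1] le[of "-1" "-1"] by linarith
  have "totatives ?N \<subseteq> {a. a < ?N \<and> coprime a ?N}"
  proof
    fix a assume a: "a \<in> totatives ?N"
    show "a \<in> {a. a < ?N \<and> coprime a ?N}"
      using totatives_less[OF a] N1 a by (simp add: in_totatives_iff)
  qed
  hence "totient ?N \<le> card {a. a < ?N \<and> coprime a ?N}"
    unfolding totient_def by (intro card_mono) auto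
  moreover have "totient ?N = (p - 1) * (q - 1)"
    using p q pq by (simp add: totient_mult_coprime primes_coprime totient_prime)
  ultimately show ?thesis using 4 odd_semiprime_bound[OF p q pq] by (simp add: S_def)
qed

lemma less_power_bit_size: "\<bar>i\<bar> < 2 ^ (bit_size i - 1)"
  using bitlen_bounds[of "\<bar>i\<bar>"] by (cases "i = 0") (auto simp: bit_size_def)

lemma bit_size_le:
  assumes "\<bar>i\<bar> < 2 ^ n" shows "bit_size i \<le> n + 1"
  using assms bitlen_le_iff_power[of "\<bar>i\<bar>" n] by (simp add: bit_size_def nat_le_iff)

lemma bit_size_mono: "\<bar>i\<bar> \<le> \<bar>j\<bar> \<Longrightarrow> bit_size i \<le> bit_size j"
  using bit_size_le[of i "bit_size j - 1"] less_power_bit_size[of j] by (simp add: bit_size_def)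

text \<open>ln 2 < 1 handles the binary length; the summand 1 is paid by the extra unit in
  \<open>bit_size\<close>.\<close>

lemma ln_le_bit_size:
  assumes "n > 0" shows "ln (real n) + 1 \<le> real (bit_size (int n))"
proof -
  define L where "L = bit_size (int n) - 1"
  have "int n < 2 ^ L" using less_power_bit_size[of "int n"] by (simp add: L_def)
  hence "real_of_int (int n) < real_of_int (2 ^ L)" by (simp only: of_int_less_iff)
  hence "real n < 2 ^ L" by simp
  hence "ln (real n) \<le> ln (2 ^ L)" using assms by (subst ln_le_cancel_iff) auto
  also have "\<dots> = real L * ln 2" by (simp add: ln_realpow)
  also have "\<dots> \<le> real L * 1" using ln_2_less_1 by (intro mult_left_mono) auto
  finally show ?thesis by (simp add: L_def bit_size_def)
qed

text \<open>Products of symbols \<open>chi\<close> take values +-1 everywhere; cutting them off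
  outside the residues prime to N turns them into characters modulo N.\<close>

lemma real_character_of_signs:
  fixes f :: "nat \<Rightarrow> int"
  assumes N: "N > 0" and f: "\<And>a. f a = 1 \<or> f a = -1"
    and mult: "\<And>a b. coprime a N \<Longrightarrow> coprime b N \<Longrightarrow> f (a * b) = f a * f b"
    and per: "\<And>a. f (a + N) = f a" and ex: "\<exists>a. coprime a N \<and> f a = -1"
  shows "real_character N (\<lambda>a. if coprime a N then of_int (f a) else 0)"
proof
  show "dirichlet_character N (\<lambda>a. of_real (if coprime a N then of_int (f a) else 0))"
    unfolding dirichlet_character_def
  proof (intro conjI allI N)
    fix a b
    show "complex_of_real (if coprime (a * b) N then of_int (f (a * b)) else 0) =
      of_real (if coprime a N then of_int (f a) else 0) * of_real (if coprime b N then of_int (f b) else 0)"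
      using mult[of a b] by simp
    show "complex_of_real (if coprime (a + N) N then of_int (f (a + N)) else 0) =
      of_real (if coprime a N then of_int (f a) else 0)"
    proof -
      have "coprime (a + N) N \<longleftrightarrow> coprime a N" by (metis coprime_iff_gcd_eq_1 gcd_add1)
      thus ?thesis by (simp add: per)
    qed
    show "(complex_of_real (if coprime a N then of_int (f a) else 0) \<noteq> 0) = coprime a N"
      using f[of a] by auto
  qed
  show "(if coprime n N then of_int (f n) else 0) \<in> {-1, 0, 1 :: real}" for n
    using f[of n] by auto
  show "\<exists>n. (if coprime n N then of_int (f n) else 0) = (-1 :: real)"
  proof -
    obtain a where "coprime a N" "f a = -1" using ex by blast
    thus ?thesis by (intro exI[of _ a]) simp
  qed
qed

text \<open>The characters \<open>\<chi>\<^sub>p\<close> and \<open>\<chi>\<^sub>p \<chi>\<^sub>q\<close> modulo \<open>p q\<close> are both \<open>-1\<close> somewhere below \<open>B\<close>; either one of these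
  two numbers or their product has the required pattern.\<close>

lemma erh_patterns:
  assumes erh: extended_riemann_hypothesis
  obtains C :: nat where "\<And>p q. prime p \<Longrightarrow> p > 2 \<Longrightarrow> prime q \<Longrightarrow> q > 2 \<Longrightarrow> p \<noteq> q \<Longrightarrow>
     \<exists>a\<le>(C * bit_size (int (p * q))) ^ C. coprime a (p * q) \<and> chi p (int a) = -1 \<and> chi q (int a) = 1"
proof -
  obtain K e where K: "K > 0" "e \<ge> 0" and Ke: "\<And>q X. real_character q X \<Longrightarrow>
       \<exists>n. X n = -1 \<and> real n \<le> (K * (ln (real q) + 1)) powr e"
    using erh_small_nonresidue[OF erh] by blast
  \<comment> \<open>Dominates both the real base factor and the real exponent, so that the bound
    becomes a natural number a program can compute.\<close>
  define C0 where "C0 = nat \<lceil>max K e\<rceil> + 1"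
  have C0: "K \<le> real C0" "e \<le> real C0" "C0 \<ge> 1" unfolding C0_def by linarith+
  have main: "\<exists>a\<le>(2 * C0 * bit_size (int (p * q))) ^ (2 * C0). coprime a (p * q) \<and> chi p (int a) = -1 \<and> chi q (int a) = 1"
    if p: "prime p" "p > 2" and q: "prime q" "q > 2" and pq: "p \<noteq> q" for p q :: nat
  proof -
    let ?N = "p * q"
    define b where "b = bit_size (int ?N)"
    define B where "B = (C0 * b) ^ C0"
    have N0: "?N > 0" using p q by simp
    have b1: "b \<ge> 1" by (simp add: b_def bit_size_def)
    have C0b: "C0 * b \<ge> 1" using b1 C0(3) by simp
    have B1: "B \<ge> 1" unfolding B_def using C0b by (rule one_le_power)
    have "1 \<le> real ?N" using N0 by (metis One_nat_def Suc_leI of_nat_1 of_nat_le_iff)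
    hence lnN: "0 \<le> ln (real p * real q)" by simp
    have bd: "(K * (ln (real ?N) + 1)) powr e \<le> real B"
    proof -
      have "(K * (ln (real ?N) + 1)) powr e \<le> (real C0 * real b) powr e"
        using K C0 ln_le_bit_size[OF N0] N0 lnN by (intro powr_mono2 mult_mono) (auto simp: b_def)
      also have "\<dots> \<le> (real C0 * real b) powr real C0"
        using C0 C0b by (intro powr_mono) (auto simp flip: of_nat_mult)
      also have "\<dots> = real B"
        using C0b by (simp add: B_def powr_realpow flip: of_nat_mult)
      finally show ?thesis .
    qed
    have char: "\<exists>n\<le>B. coprime n ?N \<and> f n = -1"
      if hf: "\<And>a. f a = 1 \<or> f a = -1" "\<And>a b. coprime a ?N \<Longrightarrow> coprime b ?N \<Longrightarrow> f (a * b) = f a * f b"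
        "\<And>a. f (a + ?N) = f a" "\<exists>a. coprime a ?N \<and> f a = -1" for f :: "nat \<Rightarrow> int"
    proof -
      obtain n where n: "(if coprime n ?N then of_int (f n) else 0) = (-1 :: real)"
         "real n \<le> (K * (ln (real ?N) + 1)) powr e"
        using Ke[OF real_character_of_signs[OF N0 hf]] by blast
      have "coprime n ?N" using n(1) by (auto split: if_splits)
      moreover have "f n = -1" using n(1) calculation hf(1)[of n] by auto
      moreover have "n \<le> B" using n(2) bd by linarith
      ultimately show ?thesis by blast
    qed
    have mp: "chi p (int (a * b)) = chi p (int a) * chi p (int b)"
       and mq: "chi q (int (a * b)) = chi q (int a) * chi q (int b)"
      if "coprime a ?N" "coprime b ?N" for a b
      using that chi_mult[OF p, of "int a" "int b"] chi_mult[OF q, of "int a" "int b"] by auto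
    have pp: "chi p (int (a + ?N)) = chi p (int a)" and pq': "chi q (int (a + ?N)) = chi q (int a)" for a
      by (auto intro!: prime_residue_symbol_cong simp: cong_iff_dvd_diff)
    \<comment> \<open>c shows that both characters take the value -1. They are taken modulo p q, so
      that the small witnesses are prime to both primes.\<close>
    obtain c where c: "coprime c ?N" "chi p (int c) = -1" "chi q (int c) = 1"
      using ex_pattern[OF p q pq, of "-1" 1] by auto
    have "\<exists>n\<le>B. coprime n ?N \<and> chi p (int n) = -1"
      by (intro char chi_values mp pp) (use c in auto)
    then obtain x where x: "x \<le> B" "coprime x ?N" "chi p (int x) = -1" by blast
    have "\<exists>n\<le>B. coprime n ?N \<and> chi p (int n) * chi q (int n) = -1"
    proof (intro char)
      show "chi p (int a) * chi q (int a) = 1 \<or> chi p (int a) * chi q (int a) = -1" for a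
        using chi_values[of "int a" p] chi_values[of "int a" q] by auto
      show "chi p (int (a * b)) * chi q (int (a * b)) = chi p (int a) * chi q (int a) * (chi p (int b) * chi q (int b))"
        if "coprime a ?N" "coprime b ?N" for a b using mp[OF that] mq[OF that] by simp
      show "chi p (int (a + ?N)) * chi q (int (a + ?N)) = chi p (int a) * chi q (int a)" for a
        by (simp only: pp pq')
    qed (use c in auto)
    then obtain y where y: "y \<le> B" "coprime y ?N" "chi p (int y) * chi q (int y) = -1" by blast
    \<comment> \<open>The product x y may be as large as B^2, hence the exponent 2 C0; the base is
      enlarged as well so that one constant C serves in both places.\<close>
    have BB: "B * B \<le> (2 * C0 * b) ^ (2 * C0)" "B \<le> B * B"
    proof -
      have "B * B = (C0 * b) ^ (2 * C0)" by (simp add: B_def mult_2 power_add)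
      also have "\<dots> \<le> (2 * C0 * b) ^ (2 * C0)" by (intro power_mono) auto
      finally show "B * B \<le> (2 * C0 * b) ^ (2 * C0)" .
      show "B \<le> B * B" using B1 by simp
    qed
    have B2: "B \<le> (2 * C0 * b) ^ (2 * C0)" using BB by (rule order_trans[rotated])
    consider "chi q (int x) = 1" | "chi p (int y) = -1" "chi q (int y) = 1" |
       "chi q (int x) = -1" "chi p (int y) = 1" "chi q (int y) = -1"
      using y(3) chi_values[of "int x" q] chi_values[of "int y" p] chi_values[of "int y" q] by auto
    thus ?thesis
    proof cases
      case 1 thus ?thesis using x B2 by (intro exI[of _ x]) (auto simp: b_def)
    next
      case 2 thus ?thesis using y B2 by (intro exI[of _ y]) (auto simp: b_def)
    next
      case 3
      have "chi p (int (x * y)) = -1" "chi q (int (x * y)) = 1"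
        using mp[OF x(2) y(2)] mq[OF x(2) y(2)] x y 3 by auto
      moreover have "x * y \<le> B * B" using x y by (intro mult_mono) auto
      moreover have "coprime (x * y) ?N" using x y by simp
      ultimately show ?thesis using BB by (intro exI[of _ "x * y"]) (auto simp: b_def)
    qed
  qed
  show ?thesis by (rule that[of "2 * C0"]) (use main in blast)
qed

section \<open>A program logic with step counts\<close>

lemma bit_size_pos: "bit_size i \<ge> 1"
  by (simp add: bit_size_def)

lemma bit_size_le_abs: "bit_size i \<le> nat \<bar>i\<bar> + 1"
proof (rule bit_size_le)
  have "nat \<bar>i\<bar> < 2 ^ nat \<bar>i\<bar>" by (rule less_exp)
  hence "int (nat \<bar>i\<bar>) < int (2 ^ nat \<bar>i\<bar>)" by (simp only: of_nat_less_iff)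
  thus "\<bar>i\<bar> < 2 ^ nat \<bar>i\<bar>" by simp
qed

lemma bit_size_le_add:
  assumes "\<bar>k\<bar> \<le> \<bar>i\<bar> + \<bar>j\<bar>"
  shows "bit_size k \<le> bit_size i + bit_size j"
proof -
  define m n where "m = bit_size i - 1" and "n = bit_size j - 1"
  have "\<bar>i\<bar> < 2 ^ m" "\<bar>j\<bar> < 2 ^ n" unfolding m_def n_def by (rule less_power_bit_size)+
  moreover have "(2::int) ^ m \<le> 2 ^ (m + n)" "(2::int) ^ n \<le> 2 ^ (m + n)" by (auto intro: power_increasing)
  ultimately have "\<bar>k\<bar> < 2 ^ (m + n) + 2 ^ (m + n)" using assms by linarith
  hence "\<bar>k\<bar> < 2 ^ (m + n + 1)" by simp
  hence "bit_size k \<le> (m + n + 1) + 1" by (rule bit_size_le)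
  thus ?thesis using bit_size_pos[of i] bit_size_pos[of j] by (simp add: m_def n_def)
qed

lemma bit_size_mult: "bit_size (i * j) \<le> bit_size i + bit_size j"
proof -
  define m n where "m = bit_size i - 1" and "n = bit_size j - 1"
  have "\<bar>i\<bar> < 2 ^ m" "\<bar>j\<bar> < 2 ^ n" unfolding m_def n_def by (rule less_power_bit_size)+
  hence "\<bar>i * j\<bar> < 2 ^ (m + n)" unfolding abs_mult power_add by (intro mult_strict_mono) auto
  hence "bit_size (i * j) \<le> (m + n) + 1" by (rule bit_size_le)
  thus ?thesis using bit_size_pos[of i] bit_size_pos[of j] by (simp add: m_def n_def)
qed

lemma abs_div_le: "\<bar>i div j\<bar> \<le> \<bar>i\<bar>" for i j :: int
proof (cases "j = 0")
  case False
  have *: "\<bar>a div b\<bar> \<le> \<bar>a\<bar>" if b: "b > 0" for a b :: int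
  proof (cases "a \<ge> 0")
    case True
    thus ?thesis using b zdiv_mono2[of a 1 b] by (simp add: pos_imp_zdiv_nonneg_iff)
  next
    case False
    have "a div b \<ge> a" using b False zdiv_mono2_neg[of a 1 b] by simp
    moreover have "a div b < 0" using b False by (simp add: div_neg_pos_less0)
    ultimately show ?thesis by simp
  qed
  show ?thesis
  proof (cases "j > 0")
    case True thus ?thesis by (rule *)
  next
    case neg: False
    have "i div j = (- i) div (- j)" by simp
    thus ?thesis using *[of "- j" "- i"] neg False by simp
  qed
qed simp

lemma abs_mod_le: "\<bar>i mod j\<bar> \<le> \<bar>i\<bar> + \<bar>j\<bar>" for i j :: int
proof (cases "j = 0")
  case False
  thus ?thesis using abs_mod_less[of j i] by linarith
qed simp

text \<open>Bit sizes of results are at most additive under every operation, and so are the weights;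
  a constant is charged its absolute value plus 1, a crude bound for its bit size.\<close>

fun aweight :: "aexp \<Rightarrow> nat" where
  "aweight (Const i) = nat \<bar>i\<bar> + 1"
| "aweight (Reg x) = 1"
| "aweight (Add a b) = aweight a + aweight b"
| "aweight (Sub a b) = aweight a + aweight b"
| "aweight (Mul a b) = aweight a + aweight b"
| "aweight (Div a b) = aweight a + aweight b"
| "aweight (aexp.Mod a b) = aweight a + aweight b"

text \<open>Follows the recursion of \<open>acost\<close>: every inner node pays in addition for the
  size of its own value.\<close>

fun acoeff :: "aexp \<Rightarrow> nat" where
  "acoeff (Const i) = nat \<bar>i\<bar> + 1"
| "acoeff (Reg x) = 1"
| "acoeff (Add a b) = acoeff a + acoeff b + (aweight a + aweight b)"
| "acoeff (Sub a b) = acoeff a + acoeff b + (aweight a + aweight b)"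
| "acoeff (Mul a b) = acoeff a + acoeff b + (aweight a + aweight b)"
| "acoeff (Div a b) = acoeff a + acoeff b + (aweight a + aweight b)"
| "acoeff (aexp.Mod a b) = acoeff a + acoeff b + (aweight a + aweight b)"

fun bcoeff :: "bexp \<Rightarrow> nat" where
  "bcoeff (Less a b) = acoeff a + acoeff b + 1"
| "bcoeff (Eq a b) = acoeff a + acoeff b + 1"
| "bcoeff (Neg b) = bcoeff b + 1"
| "bcoeff (Conj b c) = bcoeff b + bcoeff c + 1"

definition small :: "int \<Rightarrow> state \<Rightarrow> bool" where
  "small V s \<longleftrightarrow> (\<forall>x. \<bar>s x\<bar> \<le> V)"

lemma small_bit_size: "small V s \<Longrightarrow> bit_size (s x) \<le> bit_size V"
  by (intro bit_size_mono) (auto simp: small_def intro: order_trans[OF _ abs_ge_self])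

lemma const_weight: "bit_size i \<le> (nat \<bar>i\<bar> + 1) * bit_size V"
proof -
  have "bit_size i \<le> (nat \<bar>i\<bar> + 1) * 1" using bit_size_le_abs[of i] by simp
  also have "\<dots> \<le> (nat \<bar>i\<bar> + 1) * bit_size V" by (intro mult_left_mono bit_size_pos) simp
  finally show ?thesis .
qed

lemma bit_size_aval: "small V s \<Longrightarrow> bit_size (aval a s) \<le> aweight a * bit_size V"
proof (induction a)
  case (Const i) show ?case using const_weight[of i V] by simp
next
  case (Reg x) thus ?case using small_bit_size by simp
next
  case (Add a b)
  have "bit_size (aval (Add a b) s) \<le> bit_size (aval a s) + bit_size (aval b s)"
    by (intro bit_size_le_add) simp
  thus ?case using Add by (simp add: add_mult_distrib)
next
  case (Sub a b)
  have "bit_size (aval (Sub a b) s) \<le> bit_size (aval a s) + bit_size (aval b s)"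
    by (intro bit_size_le_add) simp
  thus ?case using Sub by (simp add: add_mult_distrib)
next
  case (Mul a b)
  thus ?case using bit_size_mult[of "aval a s" "aval b s"] by (simp add: add_mult_distrib)
next
  case (Div a b)
  have "bit_size (aval (Div a b) s) \<le> bit_size (aval a s)"
    by (intro bit_size_mono) (simp add: abs_div_le)
  thus ?case using Div by (simp add: add_mult_distrib)
next
  case (Mod a b)
  have "bit_size (aval (aexp.Mod a b) s) \<le> bit_size (aval a s) + bit_size (aval b s)"
    by (intro bit_size_le_add) (simp add: abs_mod_le)
  thus ?case using Mod by (simp add: add_mult_distrib)
qed

lemma acost_le: assumes "small V s" shows "acost a s \<le> acoeff a * bit_size V"
proof (induction a)
  case (Const i) show ?case using const_weight[of i V] by simp
next
  case (Reg x) thus ?case using small_bit_size[OF assms] by simp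
next
  case (Add a b) thus ?case using bit_size_aval[OF assms, of "Add a b"] by (simp add: add_mult_distrib)
next
  case (Sub a b) thus ?case using bit_size_aval[OF assms, of "Sub a b"] by (simp add: add_mult_distrib)
next
  case (Mul a b) thus ?case using bit_size_aval[OF assms, of "Mul a b"] by (simp add: add_mult_distrib)
next
  case (Div a b) thus ?case using bit_size_aval[OF assms, of "Div a b"] by (simp add: add_mult_distrib)
next
  case (Mod a b) thus ?case using bit_size_aval[OF assms, of "aexp.Mod a b"] by (simp add: add_mult_distrib)
qed

lemma bcost_le: assumes "small V s" shows "bcost b s \<le> bcoeff b * bit_size V"
proof (induction b)
  case (Less a b)
  thus ?case using acost_le[OF assms, of a] acost_le[OF assms, of b] bit_size_pos[of V] by (simp add: add_mult_distrib)
next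
  case (Eq a b)
  thus ?case using acost_le[OF assms, of a] acost_le[OF assms, of b] bit_size_pos[of V] by (simp add: add_mult_distrib)
next
  case (Neg b)
  thus ?case using bit_size_pos[of V] by simp
next
  case (Conj b c)
  thus ?case using bit_size_pos[of V] by (simp add: add_mult_distrib)
qed

text \<open>\<open>n\<close> counts elementary commands and tests; each costs at most \<open>K * bit_size V\<close> as long as all
  registers stay bounded by \<open>V\<close>.\<close>

definition runs ::
  "crs_oracle \<Rightarrow> int \<Rightarrow> nat \<Rightarrow> com \<Rightarrow> state \<Rightarrow> bool stream \<Rightarrow> nat \<Rightarrow> (state \<Rightarrow> bool stream \<Rightarrow> bool) \<Rightarrow> bool" where
  "runs Or V K c s w n Q \<longleftrightarrow> (small V s \<longrightarrow>
     (\<exists>T s' w'. exec Or c s w T s' w' \<and> T \<le> n * (K * bit_size V) \<and> small V s' \<and> Q s' w'))"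

lemma runs_mono:
  assumes "runs Or V K c s w n Q" "n \<le> n'" "\<And>s' w'. Q s' w' \<Longrightarrow> Q' s' w'"
  shows "runs Or V K c s w n' Q'"
  using assms unfolding runs_def by (meson mult_le_mono1 order_trans)

lemma unit_cost:
  assumes "c \<le> k * bit_size V" "k \<le> K" "1 \<le> n"
  shows "c \<le> n * (K * bit_size V)"
proof -
  have "c \<le> 1 * (K * bit_size V)" using assms by (simp add: order_trans[OF _ mult_le_mono1])
  also have "\<dots> \<le> n * (K * bit_size V)" using assms by (intro mult_le_mono1)
  finally show ?thesis .
qed

lemma runs_Assign:
  assumes "acoeff a + 1 \<le> K" "1 \<le> n" "small V s \<Longrightarrow> \<bar>aval a s\<bar> \<le> V" "Q (s(x := aval a s)) w"
  shows "runs Or V K (Assign x a) s w n Q"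
  unfolding runs_def
proof (intro impI exI conjI)
  assume s: "small V s"
  show "exec Or (Assign x a) s w (acost a s + 1) (s(x := aval a s)) w" by (rule exec.Assign)
  have "acost a s + 1 \<le> (acoeff a + 1) * bit_size V"
    using acost_le[OF s, of a] bit_size_pos[of V] by simp
  thus "acost a s + 1 \<le> n * (K * bit_size V)" using assms(1,2) by (rule unit_cost)
  show "small V (s(x := aval a s))" using s assms(3) by (simp add: small_def)
qed (rule assms)

lemma runs_Skip:
  assumes "1 \<le> K" "1 \<le> n" "Q s w" shows "runs Or V K Skip s w n Q"
  unfolding runs_def using exec.Skip unit_cost[of 1 1 V K n] bit_size_pos[of V] assms by fastforce

lemma runs_Flip:
  assumes "1 \<le> K" "1 \<le> n" "1 \<le> V" "Q (s(x := (if shd w then 1 else 0))) (stl w)"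
  shows "runs Or V K (Flip x) s w n Q"
  unfolding runs_def
proof (intro impI exI conjI)
  show "exec Or (Flip x) s w 1 (s(x := (if shd w then 1 else 0))) (stl w)" by (rule exec.Flip)
  show "1 \<le> n * (K * bit_size V)" using unit_cost[of 1 1 V K n] bit_size_pos[of V] assms by simp
  show "small V (s(x := if shd w then 1 else 0))" if "small V s"
    using that assms(3) by (simp add: small_def)
qed (rule assms)

lemma runs_Query:
  assumes "1 \<le> K" "1 \<le> n" "\<bar>Or (nat (s k)) (nat (s i)) (nat (s m))\<bar> \<le> V"
    "Q (s(x := Or (nat (s k)) (nat (s i)) (nat (s m)))) w"
  shows "runs Or V K (Query x k i m) s w n Q"
  unfolding runs_def
proof (intro impI exI conjI)
  show "exec Or (Query x k i m) s w 1 (s(x := Or (nat (s k)) (nat (s i)) (nat (s m)))) w" by (rule exec.Query)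
  show "1 \<le> n * (K * bit_size V)" using unit_cost[of 1 1 V K n] bit_size_pos[of V] assms by simp
  show "small V (s(x := Or (nat (s k)) (nat (s i)) (nat (s m))))" if "small V s"
    using that assms(3) by (simp add: small_def)
qed (rule assms)

text \<open>The remaining budget n - k sits inside the postcondition, so a program is verified by
  chaining rules from left to right.\<close>

lemma runs_Seq:
  assumes "runs Or V K c1 s w k (\<lambda>s1 w1. runs Or V K c2 s1 w1 (n - k) Q)" "k \<le> n"
  shows "runs Or V K (Seq c1 c2) s w n Q"
  unfolding runs_def
proof
  assume "small V s"
  then obtain T1 s1 w1 where 1: "exec Or c1 s w T1 s1 w1" "T1 \<le> k * (K * bit_size V)" "small V s1"
      "runs Or V K c2 s1 w1 (n - k) Q"
    using assms(1) unfolding runs_def by blast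
  then obtain T2 s2 w2 where 2: "exec Or c2 s1 w1 T2 s2 w2" "T2 \<le> (n - k) * (K * bit_size V)" "small V s2" "Q s2 w2"
    unfolding runs_def by blast
  have "T1 + T2 \<le> k * (K * bit_size V) + (n - k) * (K * bit_size V)" using 1 2 by simp
  also have "\<dots> = n * (K * bit_size V)" using assms(2) by (simp flip: add_mult_distrib)
  finally show "\<exists>T s' w'. exec Or (Seq c1 c2) s w T s' w' \<and> T \<le> n * (K * bit_size V) \<and> small V s' \<and> Q s' w'"
    using exec.Seq[OF 1(1) 2(1)] 2 by blast
qed

lemma runs_If:
  assumes "bcoeff b \<le> K" "1 \<le> n" "bval b s \<Longrightarrow> runs Or V K c1 s w (n - 1) Q" "\<not> bval b s \<Longrightarrow> runs Or V K c2 s w (n - 1) Q"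
  shows "runs Or V K (If b c1 c2) s w n Q"
  unfolding runs_def
proof
  assume s: "small V s"
  have "bcost b s \<le> 1 * (K * bit_size V)"
    by (rule unit_cost[OF bcost_le[OF s] assms(1)]) simp
  moreover obtain T s' w' where "exec Or (if bval b s then c1 else c2) s w T s' w'" "T \<le> (n - 1) * (K * bit_size V)" "small V s'" "Q s' w'"
    using assms(3,4) s unfolding runs_def by (cases "bval b s") fastforce+
  moreover have "1 * (K * bit_size V) + (n - 1) * (K * bit_size V) = n * (K * bit_size V)"
    using assms(2) by (simp only: add_mult_distrib[symmetric]) simp
  ultimately show "\<exists>T s' w'. exec Or (If b c1 c2) s w T s' w' \<and> T \<le> n * (K * bit_size V) \<and> small V s' \<and> Q s' w'"
    by (intro exI[of _ "bcost b s + T"] exI[of _ s'] exI[of _ w'])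
      (cases "bval b s"; auto intro: exec.IfTrue exec.IfFalse)
qed

text \<open>The first argument of I is a strictly decreasing variant: at most j rounds of cost n + 1
  each, and one final test.\<close>

lemma runs_While:
  assumes b: "bcoeff b \<le> K"
    and step: "\<And>j s w. I j s w \<Longrightarrow> bval b s \<Longrightarrow> runs Or V K c s w n (\<lambda>s' w'. \<exists>j'<j. I j' s' w')"
    and exit: "\<And>j s w. I j s w \<Longrightarrow> \<not> bval b s \<Longrightarrow> Q s w"
    and init: "I j s w" and m: "(j + 1) * (n + 1) \<le> m"
  shows "runs Or V K (While b c) s w m Q"
proof (rule runs_mono[OF _ m])
  show "runs Or V K (While b c) s w ((j + 1) * (n + 1)) Q"
    using init
  proof (induction j arbitrary: s w rule: less_induct)
    case (less j)
    show ?case unfolding runs_def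
    proof
      assume s: "small V s"
      let ?M = "K * bit_size V"
      have bc: "bcost b s \<le> 1 * ?M" by (rule unit_cost[OF bcost_le[OF s] b]) simp
      show "\<exists>T s' w'. exec Or (While b c) s w T s' w' \<and> T \<le> (j + 1) * (n + 1) * ?M \<and> small V s' \<and> Q s' w'"
      proof (cases "bval b s")
        case False
        have "bcost b s \<le> (j + 1) * (n + 1) * ?M" using bc by (simp add: trans_le_add1)
        thus ?thesis using exec.WhileFalse[of b s Or c w] False s exit[OF less.prems False] by blast
      next
        case True
        obtain T1 s1 w1 j' where 1: "exec Or c s w T1 s1 w1" "T1 \<le> n * ?M" "small V s1" "j' < j" "I j' s1 w1"
          using step[OF less.prems True] s unfolding runs_def by blast
        obtain T2 s2 w2 where 2: "exec Or (While b c) s1 w1 T2 s2 w2" "T2 \<le> (j' + 1) * (n + 1) * ?M" "small V s2" "Q s2 w2"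
          using less.IH[OF 1(4,5)] 1(3) unfolding runs_def by blast
        have "(j' + 1) * (n + 1) * ?M \<le> j * (n + 1) * ?M" using 1(4) by (intro mult_le_mono1) simp
        hence "bcost b s + T1 + T2 \<le> 1 * ?M + n * ?M + j * (n + 1) * ?M" using bc 1 2 by linarith
        also have "\<dots> = (j + 1) * (n + 1) * ?M" by (simp add: algebra_simps)
        finally show ?thesis using exec.WhileTrue[OF True 1(1) 2(1)] 2 by blast
      qed
    qed
  qed
qed

lemma runs_Assign_Seq:
  assumes "acoeff a + 1 \<le> K" "1 \<le> n" "small V s \<Longrightarrow> \<bar>aval a s\<bar> \<le> V"
    "runs Or V K c (s(x := aval a s)) w (n - 1) Q"
  shows "runs Or V K (Seq (Assign x a) c) s w n Q"
  by (rule runs_Seq[OF runs_Assign[OF assms(1) order_refl assms(3)]]) (use assms in auto)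

lemma smallD: "small V s \<Longrightarrow> \<bar>s x\<bar> \<le> V"
  by (simp add: small_def)

section \<open>The reduction\<close>

text \<open>Frame condition: A lists the registers that may have changed.\<close>

definition agree :: "nat set \<Rightarrow> state \<Rightarrow> state \<Rightarrow> bool" where
  "agree A s s' \<longleftrightarrow> (\<forall>r. r \<notin> A \<longrightarrow> s' r = s r)"

lemma agree_refl: "agree A s s"
  by (simp add: agree_def)

lemma agree_mono: "agree A s s' \<Longrightarrow> A \<subseteq> B \<Longrightarrow> agree B s s'"
  by (auto simp: agree_def)

lemma agree_upd: "x \<in> A \<Longrightarrow> agree A s s' \<Longrightarrow> agree A s (s'(x := v))"
  by (auto simp: agree_def)

text \<open>Registers: 0 holds \<open>N\<close>, 2 the sample, 3 to 5 are scratch, 6 to 8 hold the level, the current power and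
  the oracle's answer, 9 and 10 the least and greatest value found so far (0 if none), 13 the loop counter.\<close>

definition gcd_prog :: com where
  "gcd_prog = While (Neg (Eq (Reg 4) (Const 0)))
     (Seq (Assign 5 (aexp.Mod (Reg 3) (Reg 4))) (Seq (Assign 3 (Reg 4)) (Assign 4 (Reg 5))))"

text \<open>Each Euclidean step at least halves the product of the two arguments, because 2 (x mod
  y) \<le> x for 0 < y < x. The exponent j is therefore a variant.\<close>

lemma gcd_prog_correct:
  assumes xy: "0 \<le> s 4" "s 4 < s 3" "s 3 \<le> V" "s 3 * s 4 < 2 ^ j" and K: "60 \<le> K"
  shows "runs Or V K gcd_prog s w (4 * (j + 1))
    (\<lambda>s' w'. w' = w \<and> s' 3 = gcd (s 3) (s 4) \<and> agree {3,4,5} s s')"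
proof -
  define I where "I = (\<lambda>j s' w'. w' = w \<and> agree {3,4,5} s s' \<and> 0 \<le> s' 4 \<and> s' 4 < s' 3 \<and> s' 3 \<le> V \<and>
      gcd (s' 3) (s' 4) = gcd (s 3) (s 4) \<and> s' 3 * s' 4 < (2::int) ^ j)"
  show ?thesis unfolding gcd_prog_def
  proof (rule runs_While[where I = I and j = j and n = 3])
    show "I j s w" using xy by (simp add: I_def agree_refl)
  next
    fix j s' w' assume I: "I j s' w'" and b: "\<not> bval (Neg (Eq (Reg 4) (Const 0))) s'"
    thus "w' = w \<and> s' 3 = gcd (s 3) (s 4) \<and> agree {3,4,5} s s'"
      by (auto simp: I_def)
  next
    fix j s' w' assume I: "I j s' w'" and b: "bval (Neg (Eq (Reg 4) (Const 0))) s'"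
    define x y where "x = s' 3" and "y = s' 4"
    have y: "0 < y" "y < x" "x \<le> V" "x * y < 2 ^ j" using I b by (auto simp: I_def x_def y_def)
    have r: "0 \<le> x mod y" "x mod y < y" using y by auto
    have "x = x div y * y + x mod y" by simp
    moreover have "1 * y \<le> x div y * y" using y by (intro mult_right_mono) (auto simp: pos_imp_zdiv_pos_iff int_one_le_iff_zero_less)
    ultimately have "2 * (x mod y) \<le> x" using r by linarith
    hence "2 * (x mod y) * y \<le> x * y" using y by (intro mult_right_mono) auto
    moreover have "2 * (y * (x mod y)) = 2 * (x mod y) * y" by simp
    ultimately have h: "2 * (y * (x mod y)) < 2 ^ j" using y(4) by linarith
    have "x * y \<ge> 1" using y by (simp add: int_one_le_iff_zero_less)
    hence "j \<noteq> 0" using y by (intro notI) simp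
    then obtain i where i: "j = Suc i" by (cases j) auto
    have fin: "I i (s'(5 := x mod y, 3 := y, 4 := x mod y)) w'"
      using I r y h unfolding I_def i x_def[symmetric] y_def[symmetric]
      by (auto simp: agree_upd gcd_red_int[symmetric] gcd.commute x_def[symmetric] y_def[symmetric])
    show "runs Or V K (Seq (Assign 5 (aexp.Mod (Reg 3) (Reg 4))) (Seq (Assign 3 (Reg 4)) (Assign 4 (Reg 5)))) s' w' 3
        (\<lambda>s' w'. \<exists>j'<j. I j' s' w')"
      using K r y fin i
      by (intro runs_Assign_Seq runs_Assign exI[of _ i] conjI) (auto simp: x_def y_def)
  qed (use K in auto)
qed

text \<open>Squaring register 7 turns the query for one level into that for the next. The loop stops
  at the first answer other than -1, so no question is asked above the levels where the oracle is
  reliable.\<close>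

definition level_prog :: com where
  "level_prog = Seq (Assign 6 (Const 1)) (Seq (Assign 7 (aexp.Mod (Reg 2) (Reg 0))) (Seq (Query 8 6 0 7)
     (While (Eq (Reg 8) (Const (-1)))
       (Seq (Assign 6 (Add (Reg 6) (Const 1))) (Seq (Assign 7 (aexp.Mod (Mul (Reg 7) (Reg 7)) (Reg 0)))
         (Query 8 6 0 7))))))"

text \<open>The level found is one more than the valuation, hence the decrement. Value 0 carries no
  information and is dropped; the separate test of register 9 is there because its 0 means "none so
  far" and would win every minimum.\<close>

definition update_prog :: com where
  "update_prog = Seq (Assign 6 (Sub (Reg 6) (Const 1))) (If (Less (Const 0) (Reg 6))
     (Seq (If (Eq (Reg 9) (Const 0)) (Assign 9 (Reg 6)) (If (Less (Reg 6) (Reg 9)) (Assign 9 (Reg 6)) Skip))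
        (If (Less (Reg 10) (Reg 6)) (Assign 10 (Reg 6)) Skip)) Skip)"

definition sample_prog :: com where
  "sample_prog = Seq (Assign 3 (Reg 0)) (Seq (Assign 4 (aexp.Mod (Reg 2) (Reg 0))) (Seq gcd_prog
     (If (Eq (Reg 3) (Const 1)) (Seq level_prog update_prog) Skip)))"

text \<open>0 marks a sample that reveals nothing: a not prime to N, or both symbols equal. For odd
  primes it cannot be mistaken for a valuation, since p - 1 is even.\<close>

definition sample_value :: "nat \<Rightarrow> nat \<Rightarrow> nat \<Rightarrow> nat" where
  "sample_value p q a = (if coprime a (p * q) then
      (if chi p (int a) = -1 \<and> chi q (int a) = 1 then nu2 (p - 1)
       else if chi p (int a) = 1 \<and> chi q (int a) = -1 then nu2 (q - 1) else 0) else 0)"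

definition update_range :: "int \<times> int \<Rightarrow> nat \<Rightarrow> int \<times> int" where
  "update_range r v = (if v = 0 then r else
     (if fst r = 0 \<or> int v < fst r then int v else fst r, max (snd r) (int v)))"

lemma nu2_bounds:
  assumes "prime p" "p > (2::nat)"
  shows "nu2 (p - 1) \<ge> 1" "nu2 (p - 1) < p" "2 ^ nu2 (p - 1) < p"
proof -
  have "odd p" using assms by (simp add: prime_odd_nat)
  hence "2 ^ 1 dvd p - 1" by simp
  thus "nu2 (p - 1) \<ge> 1" using assms by (intro multiplicity_geI) auto
  have "2 ^ nu2 (p - 1) dvd p - 1" by (rule multiplicity_dvd)
  hence "2 ^ nu2 (p - 1) \<le> p - 1" using assms by (intro dvd_imp_le) auto
  thus "2 ^ nu2 (p - 1) < p" using assms by simp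
  thus "nu2 (p - 1) < p" using less_exp[of "nu2 (p - 1)"] by linarith
qed

section \<open>Processing one sample\<close>

text \<open>60 exceeds the cost coefficient of every fixed expression in the programs, the largest
  being the sample count in \<open>random_reduction\<close>. V leaves room for doubling numbers
  below N.\<close>

locale semiprime_run =
  fixes Or :: crs_oracle and V :: int and K p q N b :: nat
  assumes p: "prime p" "p > 2" and q: "prime q" "q > 2" and N: "N = p * q"
    and Or: "\<forall>k\<in>{1..max (nu2 (p - 1)) (nu2 (q - 1)) + 1}. solves_CRS Or k"
    and V: "4 * int N + 4 \<le> V" and K: "60 \<le> K" and b: "N < 2 ^ b"
begin

abbreviation "val \<equiv> sample_value p q"
abbreviation "run \<equiv> runs Or V K"

lemma N_gt_1: "N > 1" unfolding N using p q by (metis less_1_mult prime_gt_1_nat)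

lemma p_le_N: "p \<le> N" "q \<le> N" using p q by (auto simp: N)

lemma val_less: "val a < N"
  using nu2_bounds(2)[OF p] nu2_bounds(2)[OF q] p_le_N N_gt_1 by (auto simp: sample_value_def)

text \<open>If exactly one symbol is -1, the answer is -1 precisely up to the valuation belonging to
  that prime. If the symbols agree they cancel at level 1, both valuations being at least 1; then
  \<open>val a = 0\<close> and only level 1 is asked.\<close>

lemma oracle_level:
  assumes a: "coprime a N" and k: "1 \<le> k" "k \<le> val a + 1"
  shows "Or k N (a ^ (2 ^ (k - 1)) mod N) = (if k \<le> val a then -1 else 1)"
proof -
  have "k \<le> max (nu2 (p - 1)) (nu2 (q - 1)) + 1"
    using k by (auto simp: sample_value_def split: if_splits)
  note ans = oracle_answer[OF p q N a k(1) this Or]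
  have "chi p (int a) = 1 \<or> chi p (int a) = -1" "chi q (int a) = 1 \<or> chi q (int a) = -1"
    by (rule chi_values)+
  thus ?thesis unfolding ans using k a nu2_bounds(1)[OF p] nu2_bounds(1)[OF q]
    by (elim disjE) (auto simp: sample_value_def N[symmetric])
qed

lemma level_prog_correct:
  assumes a: "coprime a N" and s: "s 0 = int N" "s 2 = int a"
  shows "run level_prog s w (4 * val a + 8)
    (\<lambda>s' w'. w' = w \<and> s' 6 = int (val a) + 1 \<and> agree {6,7,8} s s')"
proof -
  define ans where "ans = (\<lambda>k::nat. if k \<le> val a then -1 else 1 :: int)"
  define m where "m = (\<lambda>k. a ^ (2 ^ (k - 1)) mod N)"
  have or: "Or k N (m k) = ans k" if "1 \<le> k" "k \<le> val a + 1" for k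
    using oracle_level[OF a that] by (simp add: ans_def m_def)
  have mN: "m k < N" for k using N_gt_1 by (simp add: m_def)
  have mSuc: "m (Suc k) = (m k * m k) mod N" if "k \<ge> 1" for k
  proof -
    have "2 ^ (Suc k - 1) = 2 ^ (k - 1) + (2::nat) ^ (k - 1)" using that by (cases k) auto
    thus ?thesis by (simp add: m_def power_add mod_mult_eq)
  qed
  have absans: "\<bar>ans k\<bar> \<le> V" for k using V by (simp add: ans_def)
  \<comment> \<open>The variant counts the levels left before the answer turns to 1.\<close>
  define I where "I = (\<lambda>j s' w'. \<exists>k. w' = w \<and> agree {6,7,8} s s' \<and> 1 \<le> k \<and> k \<le> val a + 1 \<and>
     s' 6 = int k \<and> s' 7 = int (m k) \<and> s' 8 = ans k \<and> j = val a + 1 - k)"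
  let ?body = "Seq (Assign 6 (Add (Reg 6) (Const 1))) (Seq (Assign 7 (aexp.Mod (Mul (Reg 7) (Reg 7)) (Reg 0)))
      (Query 8 6 0 7))"
  let ?loop = "While (Eq (Reg 8) (Const (-1))) ?body"
  let ?Q = "\<lambda>s' w'. w' = w \<and> s' 6 = int (val a) + 1 \<and> agree {6,7,8} s s'"
  let ?s2 = "s(6 := 1, 7 := int (m 1))"
  show ?thesis unfolding level_prog_def
  proof (intro runs_Assign_Seq)
    let ?s1 = "s(6 := aval (Const 1) s)"
    have "int a mod int N = int (m 1)" by (simp add: m_def zmod_int)
    hence s2: "s(6 := aval (Const 1) s, 7 := aval (aexp.Mod (Reg 2) (Reg 0)) ?s1) = ?s2"
      using s by simp
    have o1: "Or (Suc 0) N (m 1) = ans 1" using or[of 1] by simp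
    show "run (Seq (Query 8 6 0 7) ?loop) (s(6 := aval (Const 1) s, 7 := aval (aexp.Mod (Reg 2) (Reg 0)) ?s1)) w (4 * val a + 8 - 1 - 1)
       ?Q"
      unfolding s2
    proof (rule runs_Seq[where k = 1], rule runs_Query)
      show "\<bar>Or (nat (?s2 6)) (nat (?s2 0)) (nat (?s2 7))\<bar> \<le> V"
        using s o1 absans[of 1] by simp
      have s3: "?s2(8 := Or (nat (?s2 6)) (nat (?s2 0)) (nat (?s2 7)))
         = s(6 := 1, 7 := int (m 1), 8 := ans 1)" using s o1 by simp
      show "run ?loop (?s2(8 := Or (nat (?s2 6)) (nat (?s2 0)) (nat (?s2 7))))
          w (4 * val a + 8 - 1 - 1 - 1)
       ?Q"
        unfolding s3
      proof (rule runs_While[where I = I and j = "val a" and n = 3])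
        show "I (val a) (s(6 := 1, 7 := int (m 1), 8 := ans 1)) w"
          unfolding I_def by (intro exI[of _ 1]) (auto simp: agree_def)
      next
        fix j s' w' assume "I j s' w'" "\<not> bval (Eq (Reg 8) (Const (-1))) s'"
        thus "?Q s' w'"
          by (auto simp: I_def ans_def split: if_splits)
      next
        fix j s' w' assume I: "I j s' w'" and b: "bval (Eq (Reg 8) (Const (-1))) s'"
        then obtain k where k: "w' = w" "agree {6,7,8} s s'" "1 \<le> k" "k \<le> val a + 1"
           "s' 6 = int k" "s' 7 = int (m k)" "s' 8 = ans k" "j = val a + 1 - k" by (auto simp: I_def)
        have kv: "k \<le> val a" using b k(7) by (auto simp: ans_def split: if_splits)
        have s0: "s' 0 = int N" using k(2) s by (simp add: agree_def)
        have kV: "int k + 1 \<le> V" using kv val_less[of a] V by linarith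
        have mV: "int (m (Suc k)) \<le> V" using mN[of "Suc k"] V by linarith
        have m': "int (m k) * int (m k) mod int N = int (m (Suc k))"
          using mSuc[OF k(3)] by (simp add: zmod_int)
        have oS: "Or (Suc k) N (m (Suc k)) = ans (Suc k)" using or[of "Suc k"] kv by simp
        have nk: "nat (int k + 1) = Suc k" by simp
        have fin: "I (val a - k) (s'(6 := int k + 1, 7 := int (m (Suc k)), 8 := ans (Suc k))) w'"
          unfolding I_def using k kv by (intro exI[of _ "Suc k"]) (auto intro!: agree_upd)
        show "run ?body s' w' 3 (\<lambda>s' w'. \<exists>j'<j. I j' s' w')"
          using K k(3,5,6,8) s0 kV mV kv absans[of "Suc k"] fin
          by (intro runs_Assign_Seq runs_Query exI[of _ "val a - k"] conjI) (auto simp: m' oS nk)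
      qed (use K in auto)
    qed (use K in auto)
  qed (use K V s N_gt_1 in \<open>auto intro: order_trans[OF less_imp_le[OF pos_mod_bound]]\<close>)
qed

lemma update_prog_correct:
  assumes "s 6 = int v + 1" "s 9 = lo" "s 10 = hi" "0 \<le> lo" "0 \<le> hi" "v < N"
  shows "run update_prog s w 7
    (\<lambda>s' w'. w' = w \<and> (s' 9, s' 10) = update_range (lo, hi) v \<and> agree {6,9,10} s s')"
  unfolding update_prog_def
proof (intro runs_Assign_Seq)
  let ?s = "s(6 := int v)"
  have e: "s(6 := aval (Sub (Reg 6) (Const 1)) s) = ?s" using assms by simp
  let ?Q = "\<lambda>s' w'. w' = w \<and> (s' 9, s' 10) = update_range (lo, hi) v \<and> agree {6,9,10} s s'"
  have V0: "int v \<le> V" using assms V by linarith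
  show "run (If (Less (Const 0) (Reg 6))
     (Seq (If (Eq (Reg 9) (Const 0)) (Assign 9 (Reg 6)) (If (Less (Reg 6) (Reg 9)) (Assign 9 (Reg 6)) Skip))
        (If (Less (Reg 10) (Reg 6)) (Assign 10 (Reg 6)) Skip)) Skip) (s(6 := aval (Sub (Reg 6) (Const 1)) s)) w (7 - 1) ?Q"
    unfolding e
  proof (rule runs_If)
    assume "\<not> bval (Less (Const 0) (Reg 6)) ?s"
    thus "run Skip ?s w (7 - 1 - 1) ?Q"
      using assms K by (intro runs_Skip) (auto simp: update_range_def agree_def)
  next
    assume "bval (Less (Const 0) (Reg 6)) ?s"
    hence v: "v > 0" by simp
    let ?d = "If (Less (Reg 10) (Reg 6)) (Assign 10 (Reg 6)) Skip"
    have d1: "run ?d (s(6 := int v, 9 := int v)) w 2 ?Q" if "lo = 0 \<or> int v < lo"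
      using assms K v V0 that by (intro runs_If runs_Skip runs_Assign) (auto simp: update_range_def agree_def)
    have d2: "run ?d (s(6 := int v)) w 2 ?Q" if "\<not> (lo = 0 \<or> int v < lo)"
      using assms K v V0 that by (intro runs_If runs_Skip runs_Assign) (auto simp: update_range_def agree_def)
    show "run (Seq (If (Eq (Reg 9) (Const 0)) (Assign 9 (Reg 6)) (If (Less (Reg 6) (Reg 9)) (Assign 9 (Reg 6)) Skip)) ?d)
        ?s w (7 - 1 - 1) ?Q"
      using K V0 d1 d2 assms
      by (intro runs_Seq[where k = 3] runs_If[where ?c1.0 = "Assign 9 (Reg 6)"] runs_Assign runs_Skip) auto
  qed (use K in auto)
qed (use K V assms in auto)

end

section \<open>The sampling loop\<close>

text \<open>Abstracts from where samples come from: \<open>vl\<close> reads a value off the loop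
  counter and the coin stream, \<open>nx\<close> is the stream left over. Random draws and plain
  counting are both instances; the counter runs downwards to 1.\<close>

primrec samples :: "(nat \<Rightarrow> bool stream \<Rightarrow> nat) \<Rightarrow> (bool stream \<Rightarrow> bool stream) \<Rightarrow> nat \<Rightarrow> bool stream \<Rightarrow> nat list" where
  "samples vl nx 0 w = []"
| "samples vl nx (Suc n) w = vl (Suc n) w # samples vl nx n (nx w)"

definition main_loop :: "com \<Rightarrow> com" where
  "main_loop gen = While (Less (Const 0) (Reg 13))
     (Seq gen (Seq sample_prog (Assign 13 (Sub (Reg 13) (Const 1)))))"

lemma update_range_nonneg:
  assumes "0 \<le> fst r" "0 \<le> snd r"
  shows "0 \<le> fst (update_range r v)" "0 \<le> snd (update_range r v)"
  using assms by (auto simp: update_range_def)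

lemma foldl_update_range:
  "foldl update_range (0, 0) vs =
     (if set vs - {0} = {} then (0, 0) else (int (Min (set vs - {0})), int (Max (set vs - {0}))))"
proof (induction vs rule: rev_induct)
  case (snoc v vs)
  have f: "foldl update_range (0, 0) (vs @ [v]) = update_range (foldl update_range (0, 0) vs) v" by simp
  show ?case
  proof (cases "v = 0")
    case True
    hence "set (vs @ [v]) - {0} = set vs - {0}" by auto
    thus ?thesis using snoc True by (simp add: update_range_def)
  next
    case False
    hence e: "set (vs @ [v]) - {0} = insert v (set vs - {0})" by auto
    show ?thesis
    proof (cases "set vs - {0} = {}")
      case True
      hence "set (vs @ [v]) - {0} = {v}" by (simp only: e)
      moreover have "foldl update_range (0, 0) vs = (0, 0)" using snoc True by simp
      moreover have "update_range (0, 0) v = (int v, int v)" using False by (simp add: update_range_def)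
      ultimately show ?thesis unfolding f by (simp del: set_append)
    next
      case ne: False
      have "Min (set vs - {0}) \<in> set vs - {0}" using ne by (intro Min_in) auto
      hence m0: "Min (set vs - {0}) \<noteq> 0" by auto
      have "Min (insert v (set vs - {0})) = min v (Min (set vs - {0}))"
        "Max (insert v (set vs - {0})) = max v (Max (set vs - {0}))"
        using ne by (auto intro: Min_insert Max_insert)
      moreover have "foldl update_range (0, 0) vs = (int (Min (set vs - {0})), int (Max (set vs - {0})))"
        unfolding snoc using ne by (rule if_not_P)
      moreover have "update_range (int (Min (set vs - {0})), int (Max (set vs - {0}))) v =
          (int (min v (Min (set vs - {0}))), int (max v (Max (set vs - {0}))))"
        using m0 False by (simp add: update_range_def min_def max_def)
      ultimately show ?thesis unfolding e f by (simp only: insert_not_empty if_False)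
    qed
  qed
qed simp

context semiprime_run
begin

text \<open>Bounds the number of levels tried per sample by the bit length of N, which is what keeps
  the running time polynomial.\<close>

lemma val_less_b: "val a < b"
proof -
  have "2 ^ nu2 (p - 1) < (2::nat) ^ b" "2 ^ nu2 (q - 1) < (2::nat) ^ b"
    using nu2_bounds(3)[OF p] nu2_bounds(3)[OF q] p_le_N b by linarith+
  hence "nu2 (p - 1) < b" "nu2 (q - 1) < b" by simp_all
  thus ?thesis by (auto simp: sample_value_def)
qed

text \<open>In the budget 8 b pays for the gcd, whose arguments have product below 2^(2b), and 4 b
  for the levels.\<close>

lemma sample_prog_correct:
  assumes s: "s 0 = int N" "s 2 = int a" "s 9 = lo" "s 10 = hi" "0 \<le> lo" "0 \<le> hi"
  shows "run sample_prog s w (12 * b + 24)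
    (\<lambda>s' w'. w' = w \<and> (s' 9, s' 10) = update_range (lo, hi) (val a) \<and> agree {3,4,5,6,7,8,9,10} s s')"
    (is "run _ _ _ _ ?Q")
  unfolding sample_prog_def
proof (intro runs_Assign_Seq)
  let ?s = "s(3 := int N, 4 := int (a mod N))"
  have e: "s(3 := aval (Reg 0) s, 4 := aval (aexp.Mod (Reg 2) (Reg 0)) (s(3 := aval (Reg 0) s))) = ?s"
    using s by (simp add: zmod_int)
  have aN: "a mod N < N" using N_gt_1 by simp
  have "N * (a mod N) < 2 ^ b * 2 ^ b" using b aN by (intro mult_strict_mono) auto
  hence "int (N * (a mod N)) < int (2 ^ (2 * b))" by (simp only: of_nat_less_iff) (simp add: mult_2 power_add)
  hence prod: "int N * int (a mod N) < 2 ^ (2 * b)" by simp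
  have gcd: "gcd (int N) (int (a mod N)) = int (gcd a N)"
    by (simp add: gcd_int_int_eq gcd.commute flip: gcd_red_nat)
  have G: "run gcd_prog ?s w (4 * (2 * b + 1))
      (\<lambda>s' w'. w' = w \<and> s' 3 = gcd (?s 3) (?s 4) \<and> agree {3,4,5} ?s s')"
    using aN prod V K by (intro gcd_prog_correct) auto
  show "run (Seq gcd_prog (If (Eq (Reg 3) (Const 1)) (Seq level_prog update_prog) Skip))
     (s(3 := aval (Reg 0) s, 4 := aval (aexp.Mod (Reg 2) (Reg 0)) (s(3 := aval (Reg 0) s)))) w (12 * b + 24 - 1 - 1) ?Q"
    unfolding e
  proof (rule runs_Seq[OF runs_mono[OF G order_refl]])
    fix s1 w1 assume A: "w1 = w \<and> s1 3 = gcd (?s 3) (?s 4) \<and> agree {3,4,5} ?s s1"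
    hence w1: "w1 = w" and s13: "s1 3 = int (gcd a N)" using gcd by auto
    have ag: "agree {3,4,5} s s1" using A by (auto simp: agree_def)
    have s1: "s1 0 = int N" "s1 2 = int a" "s1 9 = lo" "s1 10 = hi" using ag s by (auto simp: agree_def)
    show "run (If (Eq (Reg 3) (Const 1)) (Seq level_prog update_prog) Skip) s1 w1
        (12 * b + 24 - 1 - 1 - 4 * (2 * b + 1)) ?Q"
    proof (rule runs_If)
      assume "\<not> bval (Eq (Reg 3) (Const 1)) s1"
      hence "gcd a N \<noteq> 1" using s13 by auto
      hence "\<not> coprime a N" using coprime_iff_gcd_eq_1 by blast
      hence "val a = 0" unfolding sample_value_def N[symmetric] by (rule if_not_P)
      thus "run Skip s1 w1 (12 * b + 24 - 1 - 1 - 4 * (2 * b + 1) - 1) ?Q"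
        using K w1 s1 ag by (intro runs_Skip) (auto simp: update_range_def elim: agree_mono)
    next
      assume "bval (Eq (Reg 3) (Const 1)) s1"
      hence "int (gcd a N) = int 1" using s13 by simp
      hence "gcd a N = 1" by (simp only: of_nat_eq_iff)
      hence cop: "coprime a N" using coprime_iff_gcd_eq_1 by blast
      show "run (Seq level_prog update_prog) s1 w1 (12 * b + 24 - 1 - 1 - 4 * (2 * b + 1) - 1) ?Q"
      proof (rule runs_Seq[OF runs_mono[OF level_prog_correct[OF cop s1(1,2)] order_refl]])
        fix s2 w2 assume B: "w2 = w1 \<and> s2 6 = int (val a) + 1 \<and> agree {6,7,8} s1 s2"
        have "run update_prog s2 w2 7
            (\<lambda>s' w'. w' = w2 \<and> (s' 9, s' 10) = update_range (lo, hi) (val a) \<and> agree {6,9,10} s2 s')"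
          using B s1 s(5,6) val_less[of a] by (intro update_prog_correct) (auto simp: agree_def)
        thus "run update_prog s2 w2 (12 * b + 24 - 1 - 1 - 4 * (2 * b + 1) - 1 - (4 * val a + 8)) ?Q"
        proof (rule runs_mono)
          show "7 \<le> 12 * b + 24 - 1 - 1 - 4 * (2 * b + 1) - 1 - (4 * val a + 8)"
            using val_less_b[of a] by simp
        qed (use B w1 ag in \<open>auto simp: agree_def\<close>)
      qed (use val_less_b[of a] in simp)
    qed (use K in auto)
  qed simp
qed (use K V s N_gt_1 in \<open>auto intro: order_trans[OF less_imp_le[OF pos_mod_bound]]\<close>)

text \<open>The invariant says that folding the samples still to come into registers 9 and 10 gives
  the final pair. Registers 2, 11 and 12 are reserved for the generator.\<close>

lemma main_loop_correct:
  fixes vl :: "nat \<Rightarrow> bool stream \<Rightarrow> nat" and nx :: "bool stream \<Rightarrow> bool stream"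
  assumes gen: "\<And>n s w. s 0 = int N \<Longrightarrow> s 13 = int n \<Longrightarrow> n > 0 \<Longrightarrow>
      run gen s w g (\<lambda>s' w'. s' 2 = int (vl n w) \<and> w' = nx w \<and> agree {2,11,12} s s')"
    and s: "s 0 = int N" "s 13 = int n" "s 9 = 0" "s 10 = 0"
  shows "run (main_loop gen) s w ((n + 1) * (g + 12 * b + 26))
      (\<lambda>s' w'. (s' 9, s' 10) = foldl update_range (0, 0) (map val (samples vl nx n w)))"
proof -
  define F where "F = foldl update_range (0, 0) (map val (samples vl nx n w))"
  define I where "I = (\<lambda>j (s' :: state) w'. s' 0 = int N \<and> s' 13 = int j \<and> 0 \<le> s' 9 \<and> 0 \<le> s' 10 \<and>
      foldl update_range (s' 9, s' 10) (map val (samples vl nx j w')) = F)"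
  show ?thesis unfolding main_loop_def F_def[symmetric]
  proof (rule runs_While[where I = I and j = n and n = "g + 12 * b + 25"])
    show "I n s w" using s by (simp add: I_def F_def)
  next
    fix j s' w' assume "I j s' w'" "\<not> bval (Less (Const 0) (Reg 13)) s'"
    thus "(s' 9, s' 10) = F" by (auto simp: I_def)
  next
    fix j s' w' assume I: "I j s' w'" and "bval (Less (Const 0) (Reg 13)) s'"
    then obtain i where i: "j = Suc i" by (cases j) (auto simp: I_def)
    have sI: "s' 0 = int N" "s' 13 = int j" "0 \<le> s' 9" "0 \<le> s' 10" using I by (auto simp: I_def)
    show "run (Seq gen (Seq sample_prog (Assign 13 (Sub (Reg 13) (Const 1))))) s' w' (g + 12 * b + 25) (\<lambda>s' w'. \<exists>j'<j. I j' s' w')"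
    proof (rule runs_Seq[OF runs_mono[OF gen[OF sI(1,2)] order_refl]])
      fix s1 w1 assume A: "s1 2 = int (vl j w') \<and> w1 = nx w' \<and> agree {2,11,12} s' s1"
      hence s1: "s1 0 = int N" "s1 2 = int (vl j w')" "s1 9 = s' 9" "s1 10 = s' 10" "s1 13 = int j"
        using sI by (auto simp: agree_def)
      show "run (Seq sample_prog (Assign 13 (Sub (Reg 13) (Const 1)))) s1 w1 (g + 12 * b + 25 - g) (\<lambda>s' w'. \<exists>j'<j. I j' s' w')"
      proof (rule runs_Seq[OF runs_mono[OF sample_prog_correct[OF s1(1-4) sI(3,4)] order_refl]])
        fix s2 w2 assume B: "w2 = w1 \<and> (s2 9, s2 10) = update_range (s' 9, s' 10) (val (vl j w')) \<and> agree {3,4,5,6,7,8,9,10} s1 s2"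
        hence s2: "s2 0 = int N" "s2 13 = int j" using s1 by (auto simp: agree_def)
        have u: "s2 9 = fst (update_range (s' 9, s' 10) (val (vl j w')))" "s2 10 = snd (update_range (s' 9, s' 10) (val (vl j w')))"
          using B by (metis fst_conv, metis snd_conv)
        have "I i (s2(13 := int i)) w2"
          using I B A s2 update_range_nonneg[of "(s' 9, s' 10)" "val (vl j w')"] sI unfolding I_def i by (auto simp: u)
        thus "run (Assign 13 (Sub (Reg 13) (Const 1))) s2 w2 (g + 12 * b + 25 - g - (12 * b + 24)) (\<lambda>s' w'. \<exists>j'<j. I j' s' w')"
          using K s2 i smallD[of V s2 13] by (intro runs_Assign exI[of _ i] conjI) auto
      qed simp
    qed (use i in auto)
  qed (use K in auto)
qed

end

section \<open>Subprograms: random draw, valuation, square root\<close>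

text \<open>Uniform on the numbers below 2^L, the least power of 2 that is at least N. There is no
  rejection: draws of N or more are kept, and the probability estimate counts only those below
  N.\<close>

definition draw_prog :: com where
  "draw_prog = Seq (Assign 2 (Const 0)) (Seq (Assign 11 (Const 1)) (While (Less (Reg 11) (Reg 0))
     (Seq (Flip 12) (Seq (Assign 2 (Add (Mul (Const 2) (Reg 2)) (Reg 12))) (Assign 11 (Mul (Const 2) (Reg 11)))))))"

definition bnum :: "bool list \<Rightarrow> nat" where
  "bnum bs = foldl (\<lambda>x b. 2 * x + (if b then 1 else 0)) 0 bs"

lemma bnum_snoc: "bnum (bs @ [b]) = 2 * bnum bs + (if b then 1 else 0)"
  by (simp add: bnum_def)

lemma bnum_less: "bnum bs < 2 ^ length bs"
proof (induction bs rule: rev_induct)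
  case (snoc b bs) thus ?case by (auto simp: bnum_snoc)
qed (simp add: bnum_def)

definition nbits :: "nat \<Rightarrow> nat" where "nbits n = (LEAST L. n \<le> 2 ^ L)"

lemma nbits: "n \<le> 2 ^ nbits n" "n \<le> 2 ^ L \<Longrightarrow> nbits n \<le> L"
proof -
  have "n \<le> 2 ^ n" by (simp add: less_imp_le)
  thus "n \<le> 2 ^ nbits n" unfolding nbits_def by (rule LeastI)
  show "n \<le> 2 ^ L \<Longrightarrow> nbits n \<le> L" unfolding nbits_def by (rule Least_le)
qed

lemma draw_prog_correct:
  assumes s: "s 0 = int N" and V: "4 * int N + 4 \<le> V" and K: "60 \<le> K"
  shows "runs Or V K draw_prog s w (4 * nbits N + 6)
    (\<lambda>s' w'. s' 2 = int (bnum (stake (nbits N) w)) \<and> w' = sdrop (nbits N) w \<and> agree {2,11,12} s s')"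
    (is "runs _ _ _ _ _ _ _ ?Q")
proof -
  define I where "I = (\<lambda>j s' w'. \<exists>i\<le>nbits N. w' = sdrop i w \<and> s' 2 = int (bnum (stake i w)) \<and> s' 11 = 2 ^ i \<and>
      agree {2,11,12} s s' \<and> j = nbits N - i)"
  show ?thesis unfolding draw_prog_def
  proof (intro runs_Assign_Seq)
    show "runs Or V K (While (Less (Reg 11) (Reg 0)) (Seq (Flip 12) (Seq (Assign 2 (Add (Mul (Const 2) (Reg 2)) (Reg 12)))
       (Assign 11 (Mul (Const 2) (Reg 11)))))) (s(2 := aval (Const 0) s, 11 := aval (Const 1) (s(2 := aval (Const 0) s))))
       w (4 * nbits N + 6 - 1 - 1) ?Q"
    proof (rule runs_While[where I = I and j = "nbits N" and n = 3])
      show "I (nbits N) (s(2 := aval (Const 0) s, 11 := aval (Const 1) (s(2 := aval (Const 0) s)))) w"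
        unfolding I_def by (intro exI[of _ 0]) (auto simp: bnum_def agree_def)
    next
      fix j s' w' assume "I j s' w'" and b: "\<not> bval (Less (Reg 11) (Reg 0)) s'"
      then obtain i where i: "i \<le> nbits N" "w' = sdrop i w" "s' 2 = int (bnum (stake i w))" "s' 11 = 2 ^ i"
        "agree {2,11,12} s s'" by (auto simp: I_def)
      have "int N \<le> int (2 ^ i)" using b i s by (simp add: agree_def)
      hence "N \<le> 2 ^ i" by (simp only: of_nat_le_iff)
      hence "i = nbits N" using nbits(2) i(1) by (intro antisym)
      thus "?Q s' w'" using i by simp
    next
      fix j s' w' assume "I j s' w'" and b: "bval (Less (Reg 11) (Reg 0)) s'"
      then obtain i where i: "i \<le> nbits N" "w' = sdrop i w" "s' 2 = int (bnum (stake i w))" "s' 11 = 2 ^ i"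
        "agree {2,11,12} s s'" "j = nbits N - i" by (auto simp: I_def)
      have "int (2 ^ i) < int N" using b i s by (simp add: agree_def)
      hence lt: "2 ^ i < N" by (simp only: of_nat_less_iff)
      hence iL: "i < nbits N" using nbits(1)[of N] i(1) by (metis le_neq_implies_less not_le)
      have lt': "2 * 2 ^ i < 2 * int N" using lt \<open>int (2 ^ i) < int N\<close> by simp
      hence lV: "2 * 2 ^ i \<le> V" using V by linarith
      have bl: "bnum (stake i w) < 2 ^ i" using bnum_less[of "stake i w"] by simp
      hence "int (bnum (stake i w)) < int N" using lt by linarith
      hence bV: "2 * int (bnum (stake i w)) + 1 \<le> V" using V by linarith
      define c where "c = (if shd w' then 1 else 0 :: int)"
      have st: "stake (Suc i) w = stake i w @ [w !! i]" by (rule stake_Suc)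
      have c: "int (bnum (stake (Suc i) w)) = 2 * int (bnum (stake i w)) + c"
        unfolding st bnum_snoc c_def i(2) by simp
      have fin: "I (nbits N - Suc i) (s'(12 := c, 2 := 2 * int (bnum (stake i w)) + c, 11 := 2 * 2 ^ i)) (stl w')"
        unfolding I_def using iL i c by (intro exI[of _ "Suc i"]) (auto intro!: agree_upd simp del: stake.simps)
      show "runs Or V K (Seq (Flip 12) (Seq (Assign 2 (Add (Mul (Const 2) (Reg 2)) (Reg 12)))
         (Assign 11 (Mul (Const 2) (Reg 11))))) s' w' 3 (\<lambda>s' w'. \<exists>j'<j. I j' s' w')"
      proof (rule runs_Seq[where k = 1], rule runs_Flip)
        have "c \<in> {0, 1}" by (simp add: c_def)
        thus "runs Or V K (Seq (Assign 2 (Add (Mul (Const 2) (Reg 2)) (Reg 12))) (Assign 11 (Mul (Const 2) (Reg 11))))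
          (s'(12 := if shd w' then 1 else 0)) (stl w') (3 - 1) (\<lambda>s' w'. \<exists>j'<j. I j' s' w')"
          unfolding c_def[symmetric] using K V bV lV i iL fin
          by (intro runs_Assign_Seq runs_Assign exI[of _ "nbits N - Suc i"] conjI) auto
      qed (use K V in auto)
    qed (use K in auto)
  qed (use K V in auto)
qed

definition nu2_prog :: com where
  "nu2_prog = Seq (Assign 4 (Const 0)) (While (Eq (aexp.Mod (Reg 3) (Const 2)) (Const 0))
     (Seq (Assign 3 (Div (Reg 3) (Const 2))) (Assign 4 (Add (Reg 4) (Const 1)))))"

lemma nu2_power_odd: "odd y \<Longrightarrow> nu2 (2 ^ i * y) = i"
  by (simp add: prime_elem_multiplicity_mult_distrib not_dvd_imp_multiplicity_0 odd_pos)

lemma nu2_prog_correct: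
  assumes s: "s 3 = int x" "x > 0" "int x + 1 \<le> V" "x < 2 ^ b" and K: "60 \<le> K"
  shows "runs Or V K nu2_prog s w (3 * b + 4) (\<lambda>s' w'. s' 4 = int (nu2 x))"
proof -
  define I where "I = (\<lambda>j (s' :: state) (w' :: bool stream). \<exists>i y. s' 3 = int y \<and> y > 0 \<and> s' 4 = int i \<and> x = 2 ^ i * y \<and> y < 2 ^ j)"
  show ?thesis unfolding nu2_prog_def
  proof (intro runs_Assign_Seq)
    show "runs Or V K (While (Eq (aexp.Mod (Reg 3) (Const 2)) (Const 0))
     (Seq (Assign 3 (Div (Reg 3) (Const 2))) (Assign 4 (Add (Reg 4) (Const 1))))) (s(4 := aval (Const 0) s)) w (3 * b + 4 - 1)
      (\<lambda>s' w'. s' 4 = int (nu2 x))"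
    proof (rule runs_While[where I = I and j = b and n = 2])
      show "I b (s(4 := aval (Const 0) s)) w" unfolding I_def using s by (intro exI[of _ 0] exI[of _ x]) auto
    next
      fix j s' and w' :: "bool stream" assume "I j s' w'" and b: "\<not> bval (Eq (aexp.Mod (Reg 3) (Const 2)) (Const 0)) s'"
      then obtain i y where i: "s' 3 = int y" "s' 4 = int i" "x = 2 ^ i * y" by (auto simp: I_def)
      have "int (y mod 2) \<noteq> int 0" using b i by (simp add: zmod_int)
      hence "odd y" by presburger
      thus "s' 4 = int (nu2 x)" using i nu2_power_odd by simp
    next
      fix j s' w' assume "I j s' w'" and b: "bval (Eq (aexp.Mod (Reg 3) (Const 2)) (Const 0)) s'"
      then obtain i y where i: "s' 3 = int y" "y > 0" "s' 4 = int i" "x = 2 ^ i * y" "y < 2 ^ j" by (auto simp: I_def)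
      have "int (y mod 2) = int 0" using b i by (simp add: zmod_int)
      hence "even y" by presburger
      then obtain z where z: "y = 2 * z" by blast
      have "j \<noteq> 0" using i z by (intro notI) simp
      then obtain j' where j: "j = Suc j'" by (cases j) auto
      have fin: "I j' (s'(3 := int z, 4 := int i + 1)) w'"
        unfolding I_def using i z j by (intro exI[of _ "Suc i"] exI[of _ z]) auto
      have "i < 2 ^ i" by (rule less_exp)
      also have "2 ^ i \<le> x" unfolding i(4) using i(2) by simp
      finally have iV: "int i + 1 \<le> V" using s by linarith
      have "z \<le> x" unfolding i(4) z by simp
      hence zV: "int z \<le> V" using s by linarith
      have z2: "int y div 2 = int z" using z by simp
      show "runs Or V K (Seq (Assign 3 (Div (Reg 3) (Const 2))) (Assign 4 (Add (Reg 4) (Const 1)))) s' w' 2 (\<lambda>s' w'. \<exists>j'<j. I j' s' w')"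
        using K i(1,3) iV zV fin j
        by (intro runs_Assign_Seq runs_Assign exI[of _ j'] conjI) (auto simp: z2)
    qed (use K in auto)
  qed (use K s in auto)
qed

definition sqrt_prog :: com where
  "sqrt_prog = Seq (Assign 3 (Const 0)) (Seq (Assign 4 (Add (Reg 0) (Const 1)))
     (While (Less (Add (Reg 3) (Const 1)) (Reg 4))
       (Seq (Assign 5 (Div (Add (Reg 3) (Reg 4)) (Const 2)))
         (If (Less (Reg 0) (Mul (Reg 5) (Reg 5))) (Assign 4 (Reg 5)) (Assign 3 (Reg 5))))))"

text \<open>Bisection with l^2 \<le> N < h^2; the width h - l starts at N + 1 \<le> 2^b and halves
  up to rounding, so its exponent is the variant.\<close>

lemma sqrt_prog_correct:
  assumes s: "s 0 = int N" "N < 2 ^ b" "int N + 1 \<le> V" and K: "60 \<le> K"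
  shows "runs Or V K sqrt_prog s w (4 * b + 6)
    (\<lambda>s' w'. w' = w \<and> (\<exists>r::nat. s' 3 = int r \<and> r * r \<le> N \<and> N < (r + 1) * (r + 1)) \<and> agree {3,4,5} s s')"
    (is "runs _ _ _ _ _ _ _ ?Q")
proof -
  define I where "I = (\<lambda>j (s' :: state) w'. w' = w \<and> agree {3,4,5} s s' \<and> (\<exists>l h::nat. s' 3 = int l \<and> s' 4 = int h \<and>
     l < h \<and> h \<le> N + 1 \<and> l * l \<le> N \<and> N < h * h \<and> h - l \<le> 2 ^ j))"
  show ?thesis unfolding sqrt_prog_def
  proof (intro runs_Assign_Seq)
    show "runs Or V K (While (Less (Add (Reg 3) (Const 1)) (Reg 4))
       (Seq (Assign 5 (Div (Add (Reg 3) (Reg 4)) (Const 2)))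
         (If (Less (Reg 0) (Mul (Reg 5) (Reg 5))) (Assign 4 (Reg 5)) (Assign 3 (Reg 5)))))
       (s(3 := aval (Const 0) s, 4 := aval (Add (Reg 0) (Const 1)) (s(3 := aval (Const 0) s)))) w (4 * b + 6 - 1 - 1) ?Q"
    proof (rule runs_While[where I = I and j = b and n = 3])
      show "I b (s(3 := aval (Const 0) s, 4 := aval (Add (Reg 0) (Const 1)) (s(3 := aval (Const 0) s)))) w"
        unfolding I_def using s by (intro conjI exI[of _ 0] exI[of _ "N + 1"]) (auto simp: agree_def)
    next
      fix j s' w' assume "I j s' w'" and b: "\<not> bval (Less (Add (Reg 3) (Const 1)) (Reg 4)) s'"
      then obtain l h :: nat where I: "w' = w" "agree {3,4,5} s s'" "s' 3 = int l" "s' 4 = int h"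
        "l < h" "l * l \<le> N" "N < h * h" by (auto simp: I_def)
      have "h = l + 1" using b I by simp
      thus "?Q s' w'" using I by auto
    next
      fix j s' w' assume "I j s' w'" and b: "bval (Less (Add (Reg 3) (Const 1)) (Reg 4)) s'"
      then obtain l h :: nat where I: "w' = w" "agree {3,4,5} s s'" "s' 3 = int l" "s' 4 = int h"
        "l < h" "h \<le> N + 1" "l * l \<le> N" "N < h * h" "h - l \<le> 2 ^ j" by (auto simp: I_def)
      have lh: "l + 1 < h" using b I by simp
      have "j \<noteq> 0" using lh I(9) by (intro notI) simp
      then obtain i where j: "j = Suc i" by (cases j) auto
      define m where "m = (l + h) div 2"
      have m: "l < m" "m < h" "h - m \<le> 2 ^ i" "m - l \<le> 2 ^ i" using lh I(9) unfolding j m_def by simp_all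
      have mi: "(int l + int h) div 2 = int m" unfolding m_def by (simp add: zdiv_int)
      have s0: "s' 0 = int N" using I(2) s by (simp add: agree_def)
      have mV: "int m \<le> V" using m(2) I(6) s(3) by linarith
      have f1: "I i (s'(5 := int m, 4 := int m)) w'" if "N < m * m"
        unfolding I_def using I m that by (intro conjI exI[of _ l] exI[of _ m]) (auto intro!: agree_upd)
      have f2: "I i (s'(5 := int m, 3 := int m)) w'" if "\<not> N < m * m"
        unfolding I_def using I m that by (intro conjI exI[of _ m] exI[of _ h]) (auto intro!: agree_upd)
      have lt: "int N < int m * int m \<longleftrightarrow> N < m * m" by (metis of_nat_less_iff of_nat_mult)
      show "runs Or V K (Seq (Assign 5 (Div (Add (Reg 3) (Reg 4)) (Const 2)))
         (If (Less (Reg 0) (Mul (Reg 5) (Reg 5))) (Assign 4 (Reg 5)) (Assign 3 (Reg 5)))) s' w' 3 (\<lambda>s' w'. \<exists>j'<j. I j' s' w')"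
        using K I(3,4) s0 mV f1 f2 j
        by (intro runs_Assign_Seq runs_If runs_Assign exI[of _ i] conjI) (auto simp: mi lt)
    qed (use K in auto)
  qed (use K s in auto)
qed

definition main_prog :: "com \<Rightarrow> aexp \<Rightarrow> com" where
  "main_prog gen cnt = Seq (Assign 9 (Const 0)) (Seq (Assign 10 (Const 0)) (Seq (Assign 13 cnt)
     (Seq (main_loop gen) (Seq (Assign 0 (Reg 9)) (Assign 1 (Reg 10))))))"

text \<open>For p = q the two symbols always agree, and modulo 2 every symbol is 1, so in these
  cases sampling cannot show both patterns. The primes are then computed directly, as N div 2 or as
  the integer square root.\<close>

definition reduction :: "com \<Rightarrow> aexp \<Rightarrow> com" where
  "reduction gen cnt = If (Eq (aexp.Mod (Reg 0) (Const 2)) (Const 0))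
     (Seq (Assign 3 (Sub (Div (Reg 0) (Const 2)) (Const 1)))
       (Seq nu2_prog (Seq (Assign 0 (Const 0)) (Assign 1 (Reg 4)))))
     (Seq sqrt_prog (If (Eq (Mul (Reg 3) (Reg 3)) (Reg 0))
        (Seq (Assign 3 (Sub (Reg 3) (Const 1))) (Seq nu2_prog (Seq (Assign 0 (Reg 4)) (Assign 1 (Reg 4)))))
        (main_prog gen cnt)))"

definition correct_output :: "nat \<Rightarrow> nat \<Rightarrow> state \<Rightarrow> bool" where
  "correct_output a b s \<longleftrightarrow> s 0 = int a \<and> s 1 = int b \<or> s 0 = int b \<and> s 1 = int a"

definition degenerate :: "nat \<Rightarrow> nat \<Rightarrow> bool" where
  "degenerate p q \<longleftrightarrow> p = 2 \<or> q = 2 \<or> p = q"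

text \<open>Generic in the generator and in the number of samples, so that both reductions are
  instances. For distinct odd primes it only relates the output to the sample list; that the samples
  are good enough is shown separately.\<close>

lemma reduction_correct:
  fixes vl :: "nat \<Rightarrow> bool stream \<Rightarrow> nat" and nx :: "bool stream \<Rightarrow> bool stream"
  assumes p: "prime p" and q: "prime q" and N: "N = p * q"
    and Or: "\<forall>k\<in>{1..max (nu2 (p - 1)) (nu2 (q - 1)) + 1}. solves_CRS Or k"
    and V: "4 * int N + 4 \<le> V" and K: "60 \<le> K" and b: "N < 2 ^ b"
    and gen: "\<And>n s w. s 0 = int N \<Longrightarrow> s 13 = int n \<Longrightarrow> n > 0 \<Longrightarrow>
      runs Or V K gen s w g (\<lambda>s' w'. s' 2 = int (vl n w) \<and> w' = nx w \<and> agree {2,11,12} s s')"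
    and s: "s 0 = int N"
    and cnt: "acoeff cnt + 1 \<le> K" "\<And>s'. s' 0 = s 0 \<Longrightarrow> s' 1 = s 1 \<Longrightarrow> aval cnt s' = int n" "int n \<le> V"
  shows "runs Or V K (reduction gen cnt) s w (10 * b + 24 + (n + 1) * (g + 12 * b + 26))
    (\<lambda>s' w'. if degenerate p q then correct_output (nu2 (p - 1)) (nu2 (q - 1)) s'
       else (s' 0, s' 1) = foldl update_range (0, 0) (map (sample_value p q) (samples vl nx n w)))"
    (is "runs _ _ _ _ _ _ _ ?Q")
  unfolding reduction_def
proof (rule runs_If)
  have two: "even p \<Longrightarrow> p = 2" "even q \<Longrightarrow> q = 2"
    using p q primes_dvd_imp_eq[OF two_is_prime_nat] by auto
  show "bcoeff (Eq (aexp.Mod (Reg 0) (Const 2)) (Const 0)) \<le> K" using K by simp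
  show "1 \<le> 10 * b + 24 + (n + 1) * (g + 12 * b + 26)" by simp
  {
    assume "bval (Eq (aexp.Mod (Reg 0) (Const 2)) (Const 0)) s"
    hence "even (int N)" using s by (simp add: even_iff_mod_2_eq_zero)
    hence "even N" by simp
    define r where "r = N div 2"
    \<comment> \<open>The even prime is 2 and the other one is N div 2; the valuation for 2 is that
      of 1, the 0 put into register 0.\<close>
    have pq2: "p = 2 \<and> q = r \<or> q = 2 \<and> p = r" using \<open>even N\<close> two by (auto simp: N r_def)
    have r: "prime r" using pq2 p q by auto
    have "r \<ge> 2" using r by (rule prime_ge_2_nat)
    have rN: "r \<le> N" by (simp add: r_def)
    have out: "?Q s' w" if "s' 0 = 0" "s' 1 = int (nu2 (r - 1))" for s'
      using that pq2 by (auto simp: degenerate_def correct_output_def)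
    have ri: "int N div 2 - 1 = int (r - 1)" using \<open>r \<ge> 2\<close> by (simp add: r_def zdiv_int of_nat_diff)
    have nu: "runs Or V K nu2_prog (s(3 := int (r - 1))) w (3 * b + 4) (\<lambda>s' w'. s' 4 = int (nu2 (r - 1)))"
      using \<open>r \<ge> 2\<close> rN V K b by (intro nu2_prog_correct) auto
    show "runs Or V K (Seq (Assign 3 (Sub (Div (Reg 0) (Const 2)) (Const 1)))
       (Seq nu2_prog (Seq (Assign 0 (Const 0)) (Assign 1 (Reg 4))))) s w
       (10 * b + 24 + (n + 1) * (g + 12 * b + 26) - 1) ?Q"
    proof (intro runs_Assign_Seq)
      have e: "s(3 := aval (Sub (Div (Reg 0) (Const 2)) (Const 1)) s) = s(3 := int (r - 1))" using s ri by simp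
      show "runs Or V K (Seq nu2_prog (Seq (Assign 0 (Const 0)) (Assign 1 (Reg 4)))) (s(3 := aval (Sub (Div (Reg 0) (Const 2)) (Const 1)) s)) w
        (10 * b + 24 + (n + 1) * (g + 12 * b + 26) - 1 - 1) ?Q"
        unfolding e
      proof (rule runs_Seq[OF runs_mono[OF nu order_refl]])
        fix s1 :: state and w1 assume "s1 4 = int (nu2 (r - 1))"
        thus "runs Or V K (Seq (Assign 0 (Const 0)) (Assign 1 (Reg 4))) s1 w1
           (10 * b + 24 + (n + 1) * (g + 12 * b + 26) - 1 - 1 - (3 * b + 4)) ?Q"
          using K V out[of "s1(0 := 0, 1 := int (nu2 (r - 1)))"] smallD[of V _ 4]
          by (intro runs_Assign_Seq runs_Assign) (auto dest: smallD[of V _ 4])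
      qed simp
      show "\<bar>aval (Sub (Div (Reg 0) (Const 2)) (Const 1)) s\<bar> \<le> V" using s ri rN V by simp
    qed (use K in auto)
  next
    assume "\<not> bval (Eq (aexp.Mod (Reg 0) (Const 2)) (Const 0)) s"
    hence "odd (int N)" using s by (simp add: even_iff_mod_2_eq_zero)
    hence "odd N" by simp
    hence pq: "p > 2" "q > 2" using p q prime_ge_2_nat[of p] prime_ge_2_nat[of q] by (auto simp: N intro: le_neq_implies_less)
    let ?t = "10 * b + 24 + (n + 1) * (g + 12 * b + 26)"
    have sq: "runs Or V K sqrt_prog s w (4 * b + 6)
      (\<lambda>s' w'. w' = w \<and> (\<exists>r::nat. s' 3 = int r \<and> r * r \<le> N \<and> N < (r + 1) * (r + 1)) \<and> agree {3,4,5} s s')"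
      using s b V K by (intro sqrt_prog_correct) auto
    show "runs Or V K (Seq sqrt_prog (If (Eq (Mul (Reg 3) (Reg 3)) (Reg 0))
        (Seq (Assign 3 (Sub (Reg 3) (Const 1))) (Seq nu2_prog (Seq (Assign 0 (Reg 4)) (Assign 1 (Reg 4)))))
        (main_prog gen cnt))) s w (?t - 1) ?Q"
    proof (rule runs_Seq[OF runs_mono[OF sq order_refl]])
      fix s1 w1 assume "w1 = w \<and> (\<exists>r::nat. s1 3 = int r \<and> r * r \<le> N \<and> N < (r + 1) * (r + 1)) \<and> agree {3,4,5} s s1"
      then obtain r :: nat where w1: "w1 = w" and r: "s1 3 = int r" "r * r \<le> N" "N < (r + 1) * (r + 1)"
        and s1: "s1 0 = int N" "s1 1 = s 1" using s by (auto simp: agree_def)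
      show "runs Or V K (If (Eq (Mul (Reg 3) (Reg 3)) (Reg 0))
        (Seq (Assign 3 (Sub (Reg 3) (Const 1))) (Seq nu2_prog (Seq (Assign 0 (Reg 4)) (Assign 1 (Reg 4)))))
        (main_prog gen cnt)) s1 w1 (?t - 1 - (4 * b + 6)) ?Q"
      proof (rule runs_If)
        show "bcoeff (Eq (Mul (Reg 3) (Reg 3)) (Reg 0)) \<le> K" using K by simp
        show "1 \<le> ?t - 1 - (4 * b + 6)" by simp
      next
        assume "bval (Eq (Mul (Reg 3) (Reg 3)) (Reg 0)) s1"
        hence "int (r * r) = int N" using r s1 by simp
        hence rr: "r * r = p * q" by (simp only: of_nat_eq_iff N)
        have "p dvd r" "q dvd r" using p q rr by (metis dvd_triv_left dvd_triv_right prime_dvd_multD)+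
        have pqr: "p = q \<and> r = p"
        proof -
          obtain u where u: "r = p * u" using \<open>p dvd r\<close> by blast
          have "p * (u * r) = p * q" using rr u by (simp add: mult_ac)
          hence "u * r = q" using pq by simp
          hence "r dvd q" by auto
          moreover have "r \<noteq> 1" using \<open>p dvd r\<close> p by auto
          ultimately have "r = q" using q by (auto simp: prime_nat_iff)
          hence "p dvd q" using \<open>p dvd r\<close> by simp
          hence "p = q" using p q primes_dvd_imp_eq by blast
          thus ?thesis using \<open>r = q\<close> by simp
        qed
        have out: "?Q s' w" if "s' 0 = int (nu2 (r - 1))" "s' 1 = int (nu2 (r - 1))" for s'
          using that pqr by (auto simp: degenerate_def correct_output_def)
        have r2: "r > 2" using pqr pq by simp
        have rN: "r \<le> N" using r(2) r2 by (metis le_trans le_square)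
        have nu: "runs Or V K nu2_prog (s1(3 := int (r - 1))) w1 (3 * b + 4) (\<lambda>s' w'. s' 4 = int (nu2 (r - 1)))"
          using r2 rN V K b by (intro nu2_prog_correct) auto
        show "runs Or V K (Seq (Assign 3 (Sub (Reg 3) (Const 1))) (Seq nu2_prog (Seq (Assign 0 (Reg 4)) (Assign 1 (Reg 4)))))
            s1 w1 (?t - 1 - (4 * b + 6) - 1) ?Q"
        proof (intro runs_Assign_Seq)
          have e: "s1(3 := aval (Sub (Reg 3) (Const 1)) s1) = s1(3 := int (r - 1))" using r r2 by (simp add: of_nat_diff)
          show "runs Or V K (Seq nu2_prog (Seq (Assign 0 (Reg 4)) (Assign 1 (Reg 4)))) (s1(3 := aval (Sub (Reg 3) (Const 1)) s1)) w1
             (?t - 1 - (4 * b + 6) - 1 - 1) ?Q"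
            unfolding e
          proof (rule runs_Seq[OF runs_mono[OF nu order_refl]])
            fix s2 :: state and w2 assume "s2 4 = int (nu2 (r - 1))"
            thus "runs Or V K (Seq (Assign 0 (Reg 4)) (Assign 1 (Reg 4))) s2 w2
               (?t - 1 - (4 * b + 6) - 1 - 1 - (3 * b + 4)) ?Q"
              using K V out[of "s2(0 := int (nu2 (r - 1)), 1 := int (nu2 (r - 1)))"]
              by (intro runs_Assign_Seq runs_Assign) (auto dest: smallD[of V _ 4])
          qed simp
          show "\<bar>aval (Sub (Reg 3) (Const 1)) s1\<bar> \<le> V" using r r2 rN V by simp
        qed (use K in auto)
      next
        assume ne: "\<not> bval (Eq (Mul (Reg 3) (Reg 3)) (Reg 0)) s1"
        have "p \<noteq> q"
        proof
          assume "p = q"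
          hence "r * r \<le> p * p" "p * p < (r + 1) * (r + 1)" using r N by auto
          hence "r \<le> p" "p < r + 1"
            using mult_le_mono[of "Suc p" r "Suc p" r] mult_le_mono[of "r + 1" p "r + 1" p] by (auto simp: not_le[symmetric] Suc_le_eq)
          hence "r = p" by simp
          hence "s1 3 * s1 3 = s1 0" using r s1 N \<open>p = q\<close> by simp
          thus False using ne by simp
        qed
        hence ndeg: "\<not> degenerate p q" using pq by (simp add: degenerate_def)
        interpret semiprime_run Or V K p q N b
          using p q pq N Or V K b by unfold_locales auto
        show "runs Or V K (main_prog gen cnt) s1 w1 (?t - 1 - (4 * b + 6) - 1) ?Q"
          unfolding main_prog_def
        proof (intro runs_Assign_Seq)
          let ?s2 = "s1(9 := 0, 10 := 0, 13 := int n)"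
          have e: "s1(9 := aval (Const 0) s1, 10 := aval (Const 0) (s1(9 := aval (Const 0) s1)),
              13 := aval cnt (s1(9 := aval (Const 0) s1, 10 := aval (Const 0) (s1(9 := aval (Const 0) s1))))) = ?s2"
            using cnt(2)[of "s1(9 := 0, 10 := 0)"] s1 s by simp
          have ml: "run (main_loop gen) ?s2 w1 ((n + 1) * (g + 12 * b + 26))
             (\<lambda>s' w'. (s' 9, s' 10) = foldl update_range (0, 0) (map val (samples vl nx n w1)))"
            using s1 by (intro main_loop_correct gen) auto
          show "run (Seq (main_loop gen) (Seq (Assign 0 (Reg 9)) (Assign 1 (Reg 10)))) (s1(9 := aval (Const 0) s1, 10 := aval (Const 0) (s1(9 := aval (Const 0) s1)),
              13 := aval cnt (s1(9 := aval (Const 0) s1, 10 := aval (Const 0) (s1(9 := aval (Const 0) s1)))))) w1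
              (?t - 1 - (4 * b + 6) - 1 - 1 - 1 - 1) ?Q"
            unfolding e
          proof (rule runs_Seq[OF runs_mono[OF ml order_refl]])
            fix s3 :: state and w3 assume "(s3 9, s3 10) = foldl update_range (0, 0) (map val (samples vl nx n w1))"
            thus "run (Seq (Assign 0 (Reg 9)) (Assign 1 (Reg 10))) s3 w3
                (?t - 1 - (4 * b + 6) - 1 - 1 - 1 - 1 - (n + 1) * (g + 12 * b + 26)) ?Q"
              using K ndeg w1 by (intro runs_Assign_Seq runs_Assign) (auto dest: smallD[of V _ 9] smallD[of V _ 10])
          qed simp
          show "\<bar>aval cnt (s1(9 := aval (Const 0) s1, 10 := aval (Const 0) (s1(9 := aval (Const 0) s1))))\<bar> \<le> V"
            using cnt(2)[of "s1(9 := 0, 10 := 0)"] s1 s cnt(3) by simp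
        qed (use K V cnt(1) in auto)
      qed
    qed simp
  }
qed

section \<open>Random and deterministic sampling\<close>

text \<open>Once both patterns have occurred, the nonzero values are exactly the two valuations;
  their minimum and maximum recover the pair even when the valuations coincide.\<close>

lemma update_range_correct:
  assumes p: "prime p" and q: "prime q" and ne: "\<not> degenerate p q"
    and a: "a \<in> set as" "coprime a (p * q)" "chi p (int a) = -1" "chi q (int a) = 1"
    and b: "b \<in> set as" "coprime b (p * q)" "chi p (int b) = 1" "chi q (int b) = -1"
    and s: "(s 0, s 1) = foldl update_range (0, 0) (map (sample_value p q) as)"
  shows "correct_output (nu2 (p - 1)) (nu2 (q - 1)) s"
proof -
  let ?x = "nu2 (p - 1)" and ?y = "nu2 (q - 1)"
  have "p > 2" "q > 2" using p q ne prime_ge_2_nat[of p] prime_ge_2_nat[of q] by (auto simp: degenerate_def)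
  hence xy: "?x \<ge> 1" "?y \<ge> 1" using nu2_bounds(1) p q by auto
  have v: "sample_value p q a = ?x" "sample_value p q b = ?y" using a b by (auto simp: sample_value_def)
  have "set (map (sample_value p q) as) \<subseteq> {0, ?x, ?y}" by (auto simp: sample_value_def)
  moreover have "?x \<in> set (map (sample_value p q) as)" using a(1) v(1) by (metis image_eqI list.set_map)
  moreover have "?y \<in> set (map (sample_value p q) as)" using b(1) v(2) by (metis image_eqI list.set_map)
  ultimately have "set (map (sample_value p q) as) - {0} = {?x, ?y}" using xy by auto
  hence "(s 0, s 1) = (int (min ?x ?y), int (max ?x ?y))"
    using s unfolding foldl_update_range by simp
  thus ?thesis by (auto simp: correct_output_def min_def max_def)
qed

section \<open>Success probability of random sampling\<close>

lemma prob_space_fair_coins: "prob_space fair_coins"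
  unfolding fair_coins_def by (intro prob_space.prob_space_stream_space measure_pmf.prob_space_axioms)

lemma sets_fair_coins: "sets fair_coins = sets (stream_space (count_space UNIV))"
  unfolding fair_coins_def by (rule sets_stream_space_cong) simp

lemma measurable_stake_fair [measurable]: "stake n \<in> measurable fair_coins (count_space UNIV)"
  by (subst measurable_cong_sets[OF sets_fair_coins refl]) (rule measurable_stake)

lemma measurable_sdrop_fair [measurable]: "sdrop n \<in> measurable fair_coins fair_coins"
  unfolding fair_coins_def by (rule measurable_sdrop)

lemma pred_stake: "Measurable.pred fair_coins (\<lambda>w. R (stake L w))"
  by (rule measurable_compose[OF measurable_stake_fair]) simp

lemma pred_sdrop: "Measurable.pred fair_coins Q \<Longrightarrow> Measurable.pred fair_coins (\<lambda>w. Q (sdrop L w))"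
  by (rule measurable_compose[OF measurable_sdrop_fair])

lemma ennreal_half_sum:
  assumes "0 \<le> a" "0 \<le> b"
  shows "ennreal a * ennreal (1/2) + ennreal b * ennreal (1 - 1/2) = ennreal ((a + b) / 2)"
proof -
  have "ennreal a * ennreal (1/2) + ennreal b * ennreal (1 - 1/2) = ennreal (a * (1/2)) + ennreal (b * (1 - 1/2))"
    using assms by (simp only: ennreal_mult)
  also have "\<dots> = ennreal (a * (1/2) + b * (1 - 1/2))"
    using assms by (intro ennreal_plus[symmetric]) auto
  also have "a * (1/2) + b * (1 - 1/2) = (a + b) / 2" by (simp add: field_simps)
  finally show ?thesis .
qed

lemma prob_coin_step:
  assumes "Measurable.pred fair_coins P"
  shows "\<P>(w in fair_coins. P w) = (\<P>(w in fair_coins. P (True ## w)) + \<P>(w in fair_coins. P (False ## w))) / 2"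
proof -
  have "ennreal (\<P>(w in fair_coins. P w)) = (\<integral>\<^sup>+t. \<P>(w in fair_coins. P (t ## w)) \<partial>measure_pmf (bernoulli_pmf (1/2)))"
    unfolding fair_coins_def using assms
    by (intro prob_space.prob_stream_space[OF measure_pmf.prob_space_axioms]) (simp add: fair_coins_def pred_def)
  also have "\<dots> = ennreal (\<P>(w in fair_coins. P (True ## w))) * ennreal (1/2) + ennreal (\<P>(w in fair_coins. P (False ## w))) * ennreal (1 - 1/2)"
    by (subst nn_integral_bernoulli_pmf) auto
  also have "\<dots> = ennreal ((\<P>(w in fair_coins. P (True ## w)) + \<P>(w in fair_coins. P (False ## w))) / 2)"
    by (rule ennreal_half_sum) simp_all
  finally show ?thesis by (subst (asm) ennreal_inj) auto
qed

text \<open>Independence of the first L tosses from the later ones in counting form. The induction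
  conditions on the first toss and absorbs it into R.\<close>

lemma prob_prefix:
  assumes Q: "Measurable.pred fair_coins Q"
  shows "\<P>(w in fair_coins. R (stake L w) \<and> Q (sdrop L w)) =
     real (card {xs. length xs = L \<and> R xs}) / 2 ^ L * \<P>(w in fair_coins. Q w)"
proof (induction L arbitrary: R)
  case 0
  have "{xs. xs = [] \<and> R xs} = (if R [] then {[]} else {})" by auto
  thus ?case by simp
next
  case (Suc L)
  have m: "Measurable.pred fair_coins (\<lambda>w. R (stake (Suc L) w) \<and> Q (sdrop (Suc L) w))"
    by (rule pred_intros_logic(3)[OF pred_stake pred_sdrop[OF Q]])
  have e: "{xs. length xs = Suc L \<and> R xs} = (#) True ` {xs. length xs = L \<and> R (True # xs)} \<union> (#) False ` {xs. length xs = L \<and> R (False # xs)}"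
  proof (rule Set.set_eqI)
    fix xs
    show "xs \<in> {xs. length xs = Suc L \<and> R xs} \<longleftrightarrow>
        xs \<in> (#) True ` {xs. length xs = L \<and> R (True # xs)} \<union> (#) False ` {xs. length xs = L \<and> R (False # xs)}"
      by (cases xs; cases "hd xs") auto
  qed
  have fin: "finite {xs :: bool list. length xs = L \<and> S xs}" for S
    by (rule finite_subset[OF _ finite_lists_length_eq[of UNIV L]]) auto
  have "card {xs. length xs = Suc L \<and> R xs} = card {xs. length xs = L \<and> R (True # xs)} + card {xs. length xs = L \<and> R (False # xs)}"
    unfolding e using fin by (subst card_Un_disjoint) (auto simp: card_image)
  moreover have "\<P>(w in fair_coins. R (stake (Suc L) w) \<and> Q (sdrop (Suc L) w)) =
     (\<P>(w in fair_coins. R (True # stake L w) \<and> Q (sdrop L w)) + \<P>(w in fair_coins. R (False # stake L w) \<and> Q (sdrop L w))) / 2"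
    by (subst prob_coin_step[OF m]) simp
  ultimately show ?case
    unfolding Suc.IH[of "\<lambda>xs. R (True # xs)"] Suc.IH[of "\<lambda>xs. R (False # xs)"]
    by (simp add: field_simps)
qed

abbreviation coin_samples :: "nat \<Rightarrow> nat \<Rightarrow> bool stream \<Rightarrow> nat list" where
  "coin_samples L \<equiv> samples (\<lambda>_ w. bnum (stake L w)) (sdrop L)"

text \<open>The first L tosses form one of countably many bit lists, so the event is a countable
  union of prefix events, each intersected with an event about the rest.\<close>

lemma measurable_coin_samples: "Measurable.pred fair_coins (\<lambda>w. R (coin_samples L n w))"
proof (induction n arbitrary: R)
  case (Suc n)
  have eq: "(\<lambda>w. R (coin_samples L (Suc n) w)) =
     (\<lambda>w. \<exists>xs. stake L w = xs \<and> R (bnum xs # coin_samples L n (sdrop L w)))" by auto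
  have "Measurable.pred fair_coins (\<lambda>w. R (bnum xs # coin_samples L n (sdrop L w)))" for xs
    by (rule pred_sdrop[OF Suc.IH[of "\<lambda>ys. R (bnum xs # ys)"]])
  moreover have "Measurable.pred fair_coins (\<lambda>w. stake L w = xs)" for xs
    by (rule pred_stake)
  ultimately show ?case unfolding eq by (intro pred_intros_countable(2) pred_intros_logic(3))
qed simp

lemma bnum_surj: "a < 2 ^ L \<Longrightarrow> \<exists>xs. length xs = L \<and> bnum xs = a"
proof (induction L arbitrary: a)
  case (Suc L)
  have "a div 2 < 2 ^ L" using Suc.prems by simp
  then obtain xs where "length xs = L" "bnum xs = a div 2" using Suc.IH by blast
  thus ?case by (intro exI[of _ "xs @ [odd a]"]) (auto simp: bnum_snoc)
qed (simp add: bnum_def)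

text \<open>Each draw misses A with probability at most 15/16, independently of the later ones.
  Counting bit strings suffices because \<open>bnum\<close> maps those of length L onto the numbers
  below 2^L.\<close>

lemma prob_all_samples_miss:
  assumes A: "2 ^ L \<le> 16 * card {a. a < 2 ^ L \<and> A a}"
  shows "\<P>(w in fair_coins. \<forall>a\<in>set (coin_samples L n w). \<not> A a) \<le> (15/16) ^ n"
proof (induction n)
  case 0
  interpret prob_space fair_coins by (rule prob_space_fair_coins)
  show ?case by simp
next
  case (Suc n)
  let ?l = "\<lambda>P. {xs :: bool list. length xs = L \<and> P xs}"
  have fin: "finite (?l P)" for P
    by (rule finite_subset[OF _ finite_lists_length_eq[of UNIV L]]) auto
  have "{a. a < 2 ^ L \<and> A a} \<subseteq> bnum ` ?l (\<lambda>xs. A (bnum xs))" using bnum_surj by fastforce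
  hence "card {a. a < 2 ^ L \<and> A a} \<le> card (bnum ` ?l (\<lambda>xs. A (bnum xs)))"
    by (rule card_mono[OF finite_imageI[OF fin]])
  also have "\<dots> \<le> card (?l (\<lambda>xs. A (bnum xs)))" by (rule card_image_le[OF fin])
  finally have "card {a. a < 2 ^ L \<and> A a} \<le> card (?l (\<lambda>xs. A (bnum xs)))" .
  moreover have "card (?l (\<lambda>xs. A (bnum xs))) + card (?l (\<lambda>xs. \<not> A (bnum xs))) = card (?l (\<lambda>_. True))"
  proof -
    have u: "?l (\<lambda>xs. A (bnum xs)) \<union> ?l (\<lambda>xs. \<not> A (bnum xs)) = ?l (\<lambda>_. True)" by auto
    have "?l (\<lambda>xs. A (bnum xs)) \<inter> ?l (\<lambda>xs. \<not> A (bnum xs)) = {}" by auto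
    from card_Un_disjoint[OF fin fin this] show ?thesis unfolding u by (rule sym)
  qed
  moreover have "card (?l (\<lambda>_. True)) = 2 ^ L"
    using card_lists_length_eq[of "UNIV :: bool set" L] by simp
  ultimately have "16 * card (?l (\<lambda>xs. \<not> A (bnum xs))) \<le> 15 * 2 ^ L" using A by linarith
  hence "real (16 * card (?l (\<lambda>xs. \<not> A (bnum xs)))) \<le> real (15 * 2 ^ L)" by (simp only: of_nat_le_iff)
  hence c: "real (card (?l (\<lambda>xs. \<not> A (bnum xs)))) / 2 ^ L \<le> 15/16" by (simp add: field_simps)
  have "\<P>(w in fair_coins. \<forall>a\<in>set (coin_samples L (Suc n) w). \<not> A a) =
     \<P>(w in fair_coins. \<not> A (bnum (stake L w)) \<and> (\<forall>a\<in>set (coin_samples L n (sdrop L w)). \<not> A a))" by simp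
  also have "\<dots> = real (card (?l (\<lambda>xs. \<not> A (bnum xs)))) / 2 ^ L * \<P>(w in fair_coins. \<forall>a\<in>set (coin_samples L n w). \<not> A a)"
    by (rule prob_prefix[OF measurable_coin_samples[of "\<lambda>ys. \<forall>a\<in>set ys. \<not> A a"]])
  also have "\<dots> \<le> 15/16 * (15/16) ^ n" using c Suc by (intro mult_mono) auto
  finally show ?case by simp
qed

text \<open>(15/16)^16 is below 1/2, so 16 (t + 1) samples miss a given pattern with probability at
  most 2^(-t-1), and one of the two patterns with probability at most 2^(-t).\<close>

definition random_reduction :: com where
  "random_reduction = reduction draw_prog (Mul (Const 16) (Add (Reg 1) (Const 1)))"

text \<open>The first polynomial bounds the number of steps, the second the cost 60
  \<open>bit_size V\<close> of each, both as functions of b + t.\<close>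

lemma random_reduction_correct:
  assumes p: "prime p" and q: "prime q" and N: "N = p * q"
    and Or: "\<forall>k\<in>{1..max (nu2 (p - 1)) (nu2 (q - 1)) + 1}. solves_CRS Or k"
  shows "\<exists>T s' w'. exec Or random_reduction (input_state [N, t]) w T s' w' \<and>
     T \<le> poly ([:24, 10:] + [:17, 16:] * [:32, 16:]) (bit_size (int N) + t) * poly [:1620, 960:] (bit_size (int N) + t) \<and>
     (if degenerate p q then correct_output (nu2 (p - 1)) (nu2 (q - 1)) s'
       else (s' 0, s' 1) = foldl update_range (0, 0) (map (sample_value p q) (coin_samples (nbits N) (16 * (t + 1)) w)))"
proof -
  define b where "b = bit_size (int N)"
  define V where "V = 4 * int N + 4 + 16 * (int t + 1)"
  let ?s = "input_state [N, t]"
  have "int N < 2 ^ (b - 1)" using less_power_bit_size[of "int N"] by (simp add: b_def)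
  also have "\<dots> \<le> 2 ^ b" by (intro power_increasing) auto
  finally have "int N < int (2 ^ b)" by simp
  hence Nb: "N < 2 ^ b" by (simp only: of_nat_less_iff)
  hence Lb: "nbits N \<le> b" by (intro nbits(2)) simp
  have gen: "runs Or V 60 draw_prog s w (4 * b + 6)
      (\<lambda>s' w'. s' 2 = int (bnum (stake (nbits N) w)) \<and> w' = sdrop (nbits N) w \<and> agree {2,11,12} s s')"
    if "s 0 = int N" for s w
  proof (rule runs_mono)
    show "runs Or V 60 draw_prog s w (4 * nbits N + 6)
      (\<lambda>s' w'. s' 2 = int (bnum (stake (nbits N) w)) \<and> w' = sdrop (nbits N) w \<and> agree {2,11,12} s s')"
      using that by (intro draw_prog_correct) (auto simp: V_def)
  qed (use Lb in auto)
  have R: "runs Or V 60 random_reduction ?s w (10 * b + 24 + (16 * (t + 1) + 1) * ((4 * b + 6) + 12 * b + 26))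
    (\<lambda>s' w'. if degenerate p q then correct_output (nu2 (p - 1)) (nu2 (q - 1)) s'
       else (s' 0, s' 1) = foldl update_range (0, 0) (map (sample_value p q) (coin_samples (nbits N) (16 * (t + 1)) w)))"
    unfolding random_reduction_def
    by (rule reduction_correct[OF p q N Or _ _ Nb gen])
      (auto simp: V_def input_state_def)
  have "small V ?s" by (auto simp: small_def input_state_def V_def nth_Cons')
  then obtain T s' w' where T: "exec Or random_reduction ?s w T s' w'"
     "T \<le> (10 * b + 24 + (16 * (t + 1) + 1) * ((4 * b + 6) + 12 * b + 26)) * (60 * bit_size V)"
     "if degenerate p q then correct_output (nu2 (p - 1)) (nu2 (q - 1)) s'
       else (s' 0, s' 1) = foldl update_range (0, 0) (map (sample_value p q) (coin_samples (nbits N) (16 * (t + 1)) w))"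
    using R unfolding runs_def by blast
  have "bit_size V \<le> bit_size (4 * int N) + bit_size (16 * int t + 20)"
    by (rule bit_size_le_add) (simp add: V_def)
  also have "bit_size (4 * int N) \<le> bit_size 4 + b" unfolding b_def by (rule bit_size_mult)
  also have "bit_size 4 \<le> 5" using bit_size_le_abs[of 4] by simp
  also have "bit_size (16 * int t + 20) \<le> 16 * t + 21"
    using bit_size_le_abs[of "16 * int t + 20"] by (simp add: nat_add_distrib nat_mult_distrib)
  finally have "bit_size V \<le> 5 + b + (16 * t + 21)" by simp
  hence V60: "60 * bit_size V \<le> poly [:1620, 960:] (b + t)" by simp
  have "10 * b + 24 + (16 * (t + 1) + 1) * ((4 * b + 6) + 12 * b + 26) \<le>
      10 * (b + t) + 24 + (17 + 16 * (b + t)) * (32 + 16 * (b + t))"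
  proof (rule add_le_mono)
    show "(16 * (t + 1) + 1) * ((4 * b + 6) + 12 * b + 26) \<le> (17 + 16 * (b + t)) * (32 + 16 * (b + t))"
      by (rule mult_le_mono) simp_all
  qed simp
  also have "\<dots> = poly ([:24, 10:] + [:17, 16:] * [:32, 16:]) (b + t)"
    by (simp only: poly_add poly_mult poly_pCons poly_0) (simp add: mult_ac)
  finally have "T \<le> poly ([:24, 10:] + [:17, 16:] * [:32, 16:]) (b + t) * poly [:1620, 960:] (b + t)"
    using T(2) V60 by (meson mult_le_mono order_trans)
  thus ?thesis using T unfolding b_def by blast
qed

text \<open>Determinism of execution makes the existential in \<open>outputs_pair\<close> a
  statement about the one final state.\<close>

lemma outputs_pair_iff:
  assumes "exec Or c (input_state xs) w T s' w'"
  shows "outputs_pair Or c xs w a b \<longleftrightarrow> correct_output a b s'"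
  using assms exec_deterministic[OF assms] unfolding outputs_pair_def correct_output_def by blast

text \<open>A pattern holds for at least N/8 of the numbers below N, and the draw ranges over at
  most 2N numbers; this is the density 1/16. A union bound over the two patterns finishes.\<close>

lemma random_reduction_prob:
  assumes p: "prime p" and q: "prime q" and N: "N = p * q"
    and Or: "\<forall>k\<in>{1..max (nu2 (p - 1)) (nu2 (q - 1)) + 1}. solves_CRS Or k"
  shows "\<P>(w in fair_coins. outputs_pair Or random_reduction [N, t] w (nu2 (p - 1)) (nu2 (q - 1))) \<ge> 1 - 1 / 2 ^ t"
proof -
  interpret prob_space fair_coins by (rule prob_space_fair_coins)
  let ?out = "\<lambda>w. outputs_pair Or random_reduction [N, t] w (nu2 (p - 1)) (nu2 (q - 1))"
  note run = random_reduction_correct[OF p q N Or, of t]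
  show ?thesis
  proof (cases "degenerate p q")
    case True
    have "?out w" for w using run[of w] True outputs_pair_iff by fastforce
    hence "{w \<in> space fair_coins. ?out w} = space fair_coins" by auto
    thus ?thesis by (simp add: prob_space)
  next
    case False
    define L n where "L = nbits N" and "n = 16 * (t + 1)"
    let ?S = "coin_samples L n"
    \<comment> \<open>Writing success as a property of the sample list alone reduces measurability
      to \<open>measurable_coin_samples\<close>.\<close>
    have iff: "?out w \<longleftrightarrow> (case foldl update_range (0, 0) (map (sample_value p q) (?S w)) of (x, y) \<Rightarrow>
        x = int (nu2 (p - 1)) \<and> y = int (nu2 (q - 1)) \<or> x = int (nu2 (q - 1)) \<and> y = int (nu2 (p - 1)))" for w
    proof -
      obtain T s' w' where T: "exec Or random_reduction (input_state [N, t]) w T s' w'"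
        "(s' 0, s' 1) = foldl update_range (0, 0) (map (sample_value p q) (?S w))"
        using run[of w] False by (auto simp: L_def n_def)
      show ?thesis unfolding outputs_pair_iff[OF T(1)] T(2)[symmetric] by (simp add: correct_output_def)
    qed
    have meas: "Measurable.pred fair_coins ?out"
      unfolding iff by (rule measurable_coin_samples)
    have pq: "p > 2" "q > 2" "p \<noteq> q"
      using p q False prime_ge_2_nat[of p] prime_ge_2_nat[of q] by (auto simp: degenerate_def)
    have N2: "N \<ge> 2" unfolding N using mult_le_mono[of 2 p 1 q] pq by simp
    define A where "A = (\<lambda>e f a. coprime a (p * q) \<and> chi p (int a) = e \<and> chi q (int a) = f)"
    \<comment> \<open>L is minimal, so 2^(L-1) < N.\<close>
    have half: "2 ^ L \<le> 2 * N"
    proof -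
      have "L \<noteq> 0" using nbits(1)[of N] N2 by (intro notI) (simp add: L_def)
      then obtain l where l: "L = Suc l" by (cases L) auto
      have "\<not> N \<le> 2 ^ l" using nbits(2)[of N l] l by (auto simp: L_def)
      thus ?thesis by (simp add: l)
    qed
    have miss: "\<P>(w in fair_coins. \<forall>a\<in>set (?S w). \<not> A e f a) \<le> 1 / 2 ^ (t + 1)"
      if ef: "e = 1 \<or> e = -1" "f = 1 \<or> f = -1" for e f
    proof -
      have "2 ^ L \<le> 2 * (8 * card {a. a < N \<and> A e f a})"
        using card_pattern[OF p pq(1) q pq(2,3) ef] half by (simp add: A_def N)
      also have "card {a. a < N \<and> A e f a} \<le> card {a. a < 2 ^ L \<and> A e f a}"
      proof (rule card_mono)
        show "{a. a < N \<and> A e f a} \<subseteq> {a. a < 2 ^ L \<and> A e f a}" using nbits(1)[of N] by (auto simp: L_def)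
      qed simp
      finally have "\<P>(w in fair_coins. \<forall>a\<in>set (?S w). \<not> A e f a) \<le> (15/16) ^ n"
        by (intro prob_all_samples_miss) simp
      also have "\<dots> = ((15/16) ^ 16) ^ (t + 1)" by (simp only: n_def power_mult)
      also have "\<dots> \<le> (1/2 :: real) ^ (t + 1)" by (intro power_mono) (simp_all add: power_divide field_simps)
      finally show ?thesis by (simp add: power_divide)
    qed
    define B where "B = (\<lambda>e f. {w \<in> space fair_coins. \<forall>a\<in>set (?S w). \<not> A e f a})"
    have Bs: "B e f \<in> sets fair_coins" for e f
      unfolding B_def using measurable_coin_samples[of "\<lambda>ys. \<forall>a\<in>set ys. \<not> A e f a" L n] by (simp add: pred_def)
    have "{w \<in> space fair_coins. \<not> ?out w} \<subseteq> B (-1) 1 \<union> B 1 (-1)"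
    proof
      fix w assume w: "w \<in> {w \<in> space fair_coins. \<not> ?out w}"
      show "w \<in> B (-1) 1 \<union> B 1 (-1)"
      proof (rule ccontr)
        assume "w \<notin> B (-1) 1 \<union> B 1 (-1)"
        then obtain a c where ac: "a \<in> set (?S w)" "A (-1) 1 a" "c \<in> set (?S w)" "A 1 (-1) c"
          using w by (auto simp: B_def)
        obtain T s' w' where T: "exec Or random_reduction (input_state [N, t]) w T s' w'"
          "(s' 0, s' 1) = foldl update_range (0, 0) (map (sample_value p q) (?S w))"
          using run[of w] False by (auto simp: L_def n_def)
        have "correct_output (nu2 (p - 1)) (nu2 (q - 1)) s'"
          using update_range_correct[OF p q False ac(1) _ _ _ ac(3) _ _ _ T(2)] ac(2,4) by (simp add: A_def)
        thus False using w outputs_pair_iff[OF T(1)] by simp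
      qed
    qed
    hence "prob {w \<in> space fair_coins. \<not> ?out w} \<le> prob (B (-1) 1 \<union> B 1 (-1))"
      using Bs by (intro finite_measure_mono) auto
    also have "\<dots> \<le> prob (B (-1) 1) + prob (B 1 (-1))" using Bs by (intro measure_Un_le) auto
    also have "\<dots> \<le> 1 / 2 ^ (t + 1) + 1 / 2 ^ (t + 1)"
      unfolding B_def by (intro add_mono miss) auto
    also have "\<dots> = 1 / 2 ^ t" by simp
    finally have "prob {w \<in> space fair_coins. \<not> ?out w} \<le> 1 / 2 ^ t" .
    moreover have "prob {w \<in> space fair_coins. \<not> ?out w} = 1 - prob {w \<in> space fair_coins. ?out w}"
      using meas by (intro prob_neg) (simp add: pred_def)
    ultimately show ?thesis by simp
  qed
qed

section \<open>The deterministic reduction\<close>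

primrec power_exp :: "aexp \<Rightarrow> nat \<Rightarrow> aexp" where
  "power_exp e 0 = Const 1"
| "power_exp e (Suc n) = Mul e (power_exp e n)"

lemma aval_power_exp: "aval (power_exp e n) s = aval e s ^ n"
  by (induction n) auto

text \<open>Register 1 starts at 1 and not at 0 so that it ends as \<open>bit_size\<close> of N,
  which exceeds the binary length by one.\<close>

definition bit_length_prog :: com where
  "bit_length_prog = Seq (Assign 1 (Const 1)) (Seq (Assign 3 (Reg 0)) (While (Less (Const 0) (Reg 3))
     (Seq (Assign 3 (Div (Reg 3) (Const 2))) (Assign 1 (Add (Reg 1) (Const 1))))))"

lemma bit_length_prog_correct:
  assumes s: "s 0 = int N" and b: "N < 2 ^ b" and V: "int N \<le> V" "int b + 1 \<le> V" and K: "60 \<le> K"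
  shows "runs Or V K bit_length_prog s w (3 * b + 5)
    (\<lambda>s' w'. w' = w \<and> s' 0 = int N \<and> (\<exists>i\<le>b. s' 1 = int (i + 1) \<and> N < 2 ^ i))"
    (is "runs _ _ _ _ _ _ _ ?Q")
proof -
  define I where "I = (\<lambda>j (s' :: state) w'. w' = w \<and> s' 0 = int N \<and> (\<exists>i y::nat. s' 1 = int (i + 1) \<and> s' 3 = int y \<and>
     i + j = b \<and> y < 2 ^ j \<and> N < 2 ^ i * (y + 1)))"
  show ?thesis unfolding bit_length_prog_def
  proof (intro runs_Assign_Seq)
    show "runs Or V K (While (Less (Const 0) (Reg 3))
      (Seq (Assign 3 (Div (Reg 3) (Const 2))) (Assign 1 (Add (Reg 1) (Const 1)))))
      (s(1 := aval (Const 1) s, 3 := aval (Reg 0) (s(1 := aval (Const 1) s)))) w (3 * b + 5 - 1 - 1) ?Q"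
    proof (rule runs_While[where I = I and j = b and n = 2])
      show "I b (s(1 := aval (Const 1) s, 3 := aval (Reg 0) (s(1 := aval (Const 1) s)))) w"
        unfolding I_def using s b by (intro conjI exI[of _ 0] exI[of _ N]) auto
    next
      fix j s' w' assume "I j s' w'" "\<not> bval (Less (Const 0) (Reg 3)) s'"
      then obtain i y :: nat where "w' = w" "s' 0 = int N" "s' 1 = int (i + 1)" "y = 0" "i + j = b" "N < 2 ^ i * (y + 1)"
        by (auto simp: I_def)
      thus "?Q s' w'" by (intro conjI exI[of _ i]) auto
    next
      fix j s' w' assume "I j s' w'" and bv: "bval (Less (Const 0) (Reg 3)) s'"
      then obtain i y :: nat where I: "w' = w" "s' 0 = int N" "s' 1 = int (i + 1)" "s' 3 = int y" "i + j = b" "y < 2 ^ j" "N < 2 ^ i * (y + 1)"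
        by (auto simp: I_def)
      have y: "y > 0" using bv I by simp
      have "j \<noteq> 0" using I(6) y by (intro notI) simp
      then obtain j' where j: "j = Suc j'" by (cases j) auto
      have "y + 1 \<le> 2 * (y div 2 + 1)" by simp
      hence "2 ^ i * (y + 1) \<le> 2 ^ i * (2 * (y div 2 + 1))" by (rule mult_le_mono2)
      hence N': "N < 2 ^ Suc i * (y div 2 + 1)" using I(7) by simp
      have yd: "y div 2 < 2 ^ j'" using I(6) j by simp
      have fin: "I j' (s'(3 := int (y div 2), 1 := int (Suc i + 1))) w'"
        unfolding I_def using I(1,2,5) j N' yd by (intro conjI exI[of _ "Suc i"] exI[of _ "y div 2"]) simp_all
      have yV: "int (y div 2) \<le> V" if "small V s'" using smallD[OF that, of 3] I(4) by simp
      have iV: "int i + 2 \<le> V" using V(2) I(5) j by simp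
      have yi: "int y div 2 = int (y div 2)" by (simp add: zdiv_int)
      show "runs Or V K (Seq (Assign 3 (Div (Reg 3) (Const 2))) (Assign 1 (Add (Reg 1) (Const 1)))) s' w' 2 (\<lambda>s' w'. \<exists>j'<j. I j' s' w')"
      proof (intro runs_Assign_Seq runs_Assign exI[of _ j'] conjI)
        have "s'(3 := aval (Div (Reg 3) (Const 2)) s', 1 := aval (Add (Reg 1) (Const 1)) (s'(3 := aval (Div (Reg 3) (Const 2)) s')))
           = s'(3 := int (y div 2), 1 := int (Suc i + 1))" using I(3,4) yi by simp
        thus "I j' (s'(3 := aval (Div (Reg 3) (Const 2)) s', 1 := aval (Add (Reg 1) (Const 1)) (s'(3 := aval (Div (Reg 3) (Const 2)) s')))) w'"
          using fin by simp
        show "small V s' \<Longrightarrow> \<bar>aval (Div (Reg 3) (Const 2)) s'\<bar> \<le> V" using yV I(4) yi by simp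
      qed (use K iV I(3) j in auto)
    qed (use K in auto)
  qed (use K V s in auto)
qed

definition det_count :: "nat \<Rightarrow> aexp" where
  "det_count C = power_exp (Mul (Const (int C)) (Reg 1)) C"

text \<open>The loop counter itself is the sample, so every number from 1 up to the bound of
  \<open>erh_patterns\<close> is tried.\<close>

definition det_reduction :: "nat \<Rightarrow> com" where
  "det_reduction C = Seq bit_length_prog (reduction (Assign 2 (Reg 13)) (det_count C))"

lemma coin_free_det_reduction: "coin_free (det_reduction C)"
  by (simp add: det_reduction_def bit_length_prog_def reduction_def nu2_prog_def sqrt_prog_def main_prog_def
      main_loop_def sample_prog_def gcd_prog_def level_prog_def update_prog_def)

lemma set_samples_id: "set (samples (\<lambda>n _. n) (\<lambda>w. w) n w) = {1..n}"
  by (induction n) (auto simp: atLeastAtMostSuc_conv)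

text \<open>Three factors: the number of steps, the cost coefficient (which now depends on C through
  the sample count), and a bound for the bit size of all registers.\<close>

definition det_bound :: "nat \<Rightarrow> nat poly" where
  "det_bound C = ([:29, 13:] + ([:0, C:] ^ C + 1) * [:27, 12:]) *
     [:60 + acoeff (det_count C):] * ([:12, 2:] + [:0, C:] ^ C)"

lemma det_reduction_correct:
  assumes p: "prime p" and q: "prime q" and N: "N = p * q"
    and Or: "\<forall>k\<in>{1..max (nu2 (p - 1)) (nu2 (q - 1)) + 1}. solves_CRS Or k"
    and pat: "\<And>p q. prime p \<Longrightarrow> p > 2 \<Longrightarrow> prime q \<Longrightarrow> q > 2 \<Longrightarrow> p \<noteq> q \<Longrightarrow>
     \<exists>a\<le>(C * bit_size (int (p * q))) ^ C. coprime a (p * q) \<and> chi p (int a) = -1 \<and> chi q (int a) = 1"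
  shows "\<exists>T s' w'. exec Or (det_reduction C) (input_state [N]) w T s' w' \<and>
     T \<le> poly (det_bound C) (bit_size (int N)) \<and> correct_output (nu2 (p - 1)) (nu2 (q - 1)) s'"
proof -
  define b where "b = bit_size (int N)"
  \<comment> \<open>The binary length of N. The loop gives i \<le> b', and N < 2^i gives b \<le> i +
    1, so register 1 ends as exactly b.\<close>
  define b' where "b' = b - 1"
  define K where "K = 60 + acoeff (det_count C)"
  define V where "V = 4 * int N + 4 + (int b + 1) + int ((C * b) ^ C)"
  let ?s = "input_state [N]"
  have b1: "b \<ge> 1" unfolding b_def by (rule bit_size_pos)
  have "int N < int (2 ^ b')" using less_power_bit_size[of "int N"] by (simp add: b_def b'_def)
  hence Nb': "N < 2 ^ b'" by (simp only: of_nat_less_iff)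
  have "(2::nat) ^ b' \<le> 2 ^ b" by (intro power_increasing) (auto simp: b'_def)
  hence Nb: "N < 2 ^ b" by (rule less_le_trans[OF Nb'])
  let ?t = "13 * b + 29 + ((C * b) ^ C + 1) * (12 * b + 27)"
  have R: "runs Or V K (det_reduction C) ?s w ?t (\<lambda>s' w'. correct_output (nu2 (p - 1)) (nu2 (q - 1)) s')"
    unfolding det_reduction_def
  proof (rule runs_Seq)
    show "runs Or V K bit_length_prog ?s w (3 * b' + 5)
      (\<lambda>s1 w1. runs Or V K (reduction (Assign 2 (Reg 13)) (det_count C)) s1 w1 (?t - (3 * b' + 5))
         (\<lambda>s' w'. correct_output (nu2 (p - 1)) (nu2 (q - 1)) s'))"
    proof (rule runs_mono[OF bit_length_prog_correct order_refl])
      show "?s 0 = int N" by (simp add: input_state_def)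
      show "N < 2 ^ b'" by (rule Nb')
      show "int N \<le> V" "int b' + 1 \<le> V" using b1 by (simp_all add: V_def b'_def of_nat_diff)
      show "60 \<le> K" by (simp add: K_def)
      fix s1 :: state and w1
      assume "w1 = w \<and> s1 0 = int N \<and> (\<exists>i\<le>b'. s1 1 = int (i + 1) \<and> N < 2 ^ i)"
      then obtain i where s1: "s1 0 = int N" "s1 1 = int (i + 1)" and i: "i \<le> b'" "N < 2 ^ i" by blast
      have "int N < int (2 ^ i)" using i(2) by (simp only: of_nat_less_iff)
      hence "b \<le> i + 1" unfolding b_def by (intro bit_size_le) simp
      hence ib: "i + 1 = b" using i(1) b1 by (simp add: b'_def)
      have s1b: "s1 1 = int b" using s1(2) unfolding ib .
      define n where "n = (C * b) ^ C"
      have main: "runs Or V K (reduction (Assign 2 (Reg 13)) (det_count C)) s1 w1 (10 * b + 24 + (n + 1) * (1 + 12 * b + 26))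
        (\<lambda>s' w'. if degenerate p q then correct_output (nu2 (p - 1)) (nu2 (q - 1)) s'
           else (s' 0, s' 1) = foldl update_range (0, 0) (map (sample_value p q) (samples (\<lambda>n _. n) (\<lambda>w. w) n w1)))"
      proof (rule reduction_correct[OF p q N Or _ _ Nb])
        show "4 * int N + 4 \<le> V" by (simp add: V_def)
        show "60 \<le> K" by (simp add: K_def)
        show "runs Or V K (Assign 2 (Reg 13)) s w 1 (\<lambda>s' w'. s' 2 = int n \<and> w' = w \<and> agree {2, 11, 12} s s')"
          if "s 13 = int n" for n and s :: state and w
          using that by (intro runs_Assign) (auto simp: K_def agree_def dest: smallD[of V _ 13])
        show "s1 0 = int N" by (rule s1)
        show "acoeff (det_count C) + 1 \<le> K" by (simp add: K_def)
        show "aval (det_count C) s' = int n" if "s' 1 = s1 1" for s' :: state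
          using that s1b by (simp add: det_count_def aval_power_exp n_def)
        show "int n \<le> V" by (simp add: V_def n_def)
      qed
      show "runs Or V K (reduction (Assign 2 (Reg 13)) (det_count C)) s1 w1 (?t - (3 * b' + 5))
         (\<lambda>s' w'. correct_output (nu2 (p - 1)) (nu2 (q - 1)) s')"
      proof (rule runs_mono[OF main])
        show "10 * b + 24 + (n + 1) * (1 + 12 * b + 26) \<le> ?t - (3 * b' + 5)"
          using b1 by (simp add: n_def b'_def algebra_simps)
        fix s' :: state and w' :: "bool stream"
        assume A: "if degenerate p q then correct_output (nu2 (p - 1)) (nu2 (q - 1)) s'
           else (s' 0, s' 1) = foldl update_range (0, 0) (map (sample_value p q) (samples (\<lambda>n _. n) (\<lambda>w. w) n w1))"
        show "correct_output (nu2 (p - 1)) (nu2 (q - 1)) s'"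
        proof (cases "degenerate p q")
          case False
          have pq: "p > 2" "q > 2" "p \<noteq> q"
            using p q False prime_ge_2_nat[of p] prime_ge_2_nat[of q] by (auto simp: degenerate_def)
          obtain a where a: "a \<le> n" "coprime a (p * q)" "chi p (int a) = -1" "chi q (int a) = 1"
            using pat[OF p pq(1) q pq(2,3)] by (auto simp: n_def b_def N)
          \<comment> \<open>The second pattern is the first with the primes exchanged; both are
            bounded in terms of the same N.\<close>
          obtain c where c: "c \<le> n" "coprime c (p * q)" "chi q (int c) = -1" "chi p (int c) = 1"
            using pat[OF q pq(2) p pq(1) pq(3)[symmetric]] by (auto simp: n_def b_def N mult.commute)
          \<comment> \<open>The samples start at 1, and 0 is not prime to p q.\<close>
          have "a \<noteq> 0" using a(2) pq by (intro notI) auto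
          moreover have "c \<noteq> 0" using c(2) pq by (intro notI) auto
          ultimately have ac: "a \<in> set (samples (\<lambda>n _. n) (\<lambda>w. w) n w1)" "c \<in> set (samples (\<lambda>n _. n) (\<lambda>w. w) n w1)"
            using a(1) c(1) unfolding set_samples_id by auto
          show ?thesis
            using update_range_correct[OF p q False ac(1) a(2-4) ac(2) c(2) c(4) c(3)] A False by simp
        qed (use A in simp)
      qed
    qed
    show "3 * b' + 5 \<le> ?t" by (simp add: b'_def)
  qed
  have "\<bar>?s x\<bar> \<le> V" for x by (auto simp: input_state_def V_def)
  hence "small V ?s" by (simp add: small_def)
  then obtain T s' w' where T: "exec Or (det_reduction C) ?s w T s' w'" "T \<le> ?t * (K * bit_size V)"
      "correct_output (nu2 (p - 1)) (nu2 (q - 1)) s'"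
    using R unfolding runs_def by blast
  have "bit_size V \<le> bit_size (4 * int N) + bit_size (int (b + 5 + (C * b) ^ C))"
    by (rule bit_size_le_add) (simp add: V_def)
  also have "bit_size (4 * int N) \<le> bit_size 4 + b" unfolding b_def by (rule bit_size_mult)
  also have "bit_size 4 \<le> 5" using bit_size_le_abs[of 4] by simp
  also have "bit_size (int (b + 5 + (C * b) ^ C)) \<le> b + 6 + (C * b) ^ C"
    using bit_size_le_abs[of "int (b + 5 + (C * b) ^ C)"] by (simp only: abs_of_nat nat_int)
  finally have Vb: "bit_size V \<le> 12 + 2 * b + (C * b) ^ C" by simp
  have "T \<le> ?t * (K * (12 + 2 * b + (C * b) ^ C))"
    using T(2) Vb by (meson mult_le_mono2 order_trans)
  also have "\<dots> = poly (det_bound C) b"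
    by (simp add: det_bound_def K_def poly_power) (simp add: algebra_simps)
  finally show ?thesis using T unfolding b_def by blast
qed

theorem theorem2:
  shows "(\<exists>(c :: com) (P :: nat poly).
            \<forall>(p :: nat) (q :: nat) (N :: nat) (t :: nat) (Or :: crs_oracle).
              prime p \<and> prime q \<and> N = p * q \<and>
              (\<forall>k\<in>{1..max (nu2 (p - 1)) (nu2 (q - 1)) + 1}. solves_CRS Or k) \<longrightarrow>
                (\<forall>w. halts_within Or c [N, t] w (poly P (bit_size (int N) + t))) \<and>
                \<P>(w in fair_coins. outputs_pair Or c [N, t] w (nu2 (p - 1)) (nu2 (q - 1)))
                  \<ge> 1 - 1 / 2 ^ t)
       \<and>
         (extended_riemann_hypothesis \<longrightarrow>
          (\<exists>(c :: com) (P :: nat poly). coin_free c \<and>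
            (\<forall>(p :: nat) (q :: nat) (N :: nat) (Or :: crs_oracle) w.
              prime p \<and> prime q \<and> N = p * q \<and>
              (\<forall>k\<in>{1..max (nu2 (p - 1)) (nu2 (q - 1)) + 1}. solves_CRS Or k) \<longrightarrow>
                halts_within Or c [N] w (poly P (bit_size (int N))) \<and>
                outputs_pair Or c [N] w (nu2 (p - 1)) (nu2 (q - 1)))))"
proof (rule conjI, rule exI[of _ random_reduction],
    rule exI[of _ "([:24, 10:] + [:17, 16:] * [:32, 16:]) * [:1620, 960:]"],
    intro allI impI, elim conjE, intro conjI allI)
  fix p q N t :: nat and Or :: crs_oracle and w :: "bool stream"
  assume A: "prime p" "prime q" "N = p * q" "\<forall>k\<in>{1..max (nu2 (p - 1)) (nu2 (q - 1)) + 1}. solves_CRS Or k"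
  show "halts_within Or random_reduction [N, t] w
      (poly (([:24, 10:] + [:17, 16:] * [:32, 16:]) * [:1620, 960:]) (bit_size (int N) + t))"
    unfolding halts_within_def poly_mult[of "[:24, 10:] + [:17, 16:] * [:32, 16:]"]
    using random_reduction_correct[OF A, of t w] by blast
  show "\<P>(w in fair_coins. outputs_pair Or random_reduction [N, t] w (nu2 (p - 1)) (nu2 (q - 1))) \<ge> 1 - 1 / 2 ^ t"
    by (rule random_reduction_prob[OF A])
next
  show "extended_riemann_hypothesis \<longrightarrow>
      (\<exists>c P. coin_free c \<and> (\<forall>p q N Or w. prime p \<and> prime q \<and> N = p * q \<and>
        (\<forall>k\<in>{1..max (nu2 (p - 1)) (nu2 (q - 1)) + 1}. solves_CRS Or k) \<longrightarrow>
        halts_within Or c [N] w (poly P (bit_size (int N))) \<and>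
        outputs_pair Or c [N] w (nu2 (p - 1)) (nu2 (q - 1))))"
  proof
    assume extended_riemann_hypothesis
    then obtain C :: nat where C: "\<And>p q. prime p \<Longrightarrow> p > 2 \<Longrightarrow> prime q \<Longrightarrow> q > 2 \<Longrightarrow> p \<noteq> q \<Longrightarrow>
       \<exists>a\<le>(C * bit_size (int (p * q))) ^ C. coprime a (p * q) \<and> chi p (int a) = -1 \<and> chi q (int a) = 1"
      using erh_patterns by blast
    have "halts_within Or (det_reduction C) [N] w (poly (det_bound C) (bit_size (int N))) \<and>
        outputs_pair Or (det_reduction C) [N] w (nu2 (p - 1)) (nu2 (q - 1))"
      if A: "prime p" "prime q" "N = p * q" "\<forall>k\<in>{1..max (nu2 (p - 1)) (nu2 (q - 1)) + 1}. solves_CRS Or k"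
      for p q N :: nat and Or :: crs_oracle and w
    proof -
      obtain T s' w' where "exec Or (det_reduction C) (input_state [N]) w T s' w'"
         "T \<le> poly (det_bound C) (bit_size (int N))" "correct_output (nu2 (p - 1)) (nu2 (q - 1)) s'"
        using det_reduction_correct[OF A C, of w] by blast
      thus ?thesis using outputs_pair_iff by (auto simp: halts_within_def)
    qed
    thus "\<exists>c P. coin_free c \<and> (\<forall>p q N Or w. prime p \<and> prime q \<and> N = p * q \<and>
        (\<forall>k\<in>{1..max (nu2 (p - 1)) (nu2 (q - 1)) + 1}. solves_CRS Or k) \<longrightarrow>
        halts_within Or c [N] w (poly P (bit_size (int N))) \<and>
        outputs_pair Or c [N] w (nu2 (p - 1)) (nu2 (q - 1)))"
      using coin_free_det_reduction by blast
  qed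
qed

end
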